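(* Let $\Omega\subset\mathbb{R}^n$ be a bounded extension domain for $W^{s,p}$ and let $q\in(1,\infty)\cap(\tfrac{n}{sp},\infty)$. Let $\bar B(0,1)=\{V\in L^q(\Omega)\colon\|V\|_{L^q(\Omega)}\le1\}$ and $\partial B(0,1)=\{V\in L^q(\Omega)\colon\|V\|_{L^q(\Omega)}=1\}$. There exists $V_*\in\partial B(0,1)$ such that $$\lambda(V_* )=\min\{\lambda(V)\colon V\in\bar B(0,1)\}.$$ Moreover, $V_*$ is nonpositive, $\|V_*\|_{L^q(\Omega)}=1$, and $$\int_\Omega W(x)|u_*|^p\,dx=0\quad\text{for all }W\in T_{V_*}(\partial B(0,1)),$$ where $u_*$ is the positive eigenfunction associated to $\lambda(V_* )$ normalized by $\|u_*\|_p=1$.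
   Context: Fix $n\ge 1$, $0<s<1<p<\infty$. For an open set $\Omega\subset\mathbb{R}^n$, $W^{s,p}(\Omega)$ is the space of $u\in L^p(\Omega)$ with $[u]_{s,p;\Omega}:=\left(\iint_{\Omega\times\Omega}\frac{|u(x)-u(y)|^p}{|x-y|^{n+sp}}\,dx\,dy\right)^{1/p}<\infty$, normed by $\|u\|_{s,p;\Omega}=(\|u\|_{L^p(\Omega)}^p+[u]_{s,p;\Omega}^p)^{1/p}$. When $\Omega=\mathbb{R}^n$ the set is omitted: $[u]_{s,p}$, $\|u\|_{s,p}$, $\|u\|_p$. An open set $\Omega$ is an extension domain for $W^{s,p}$ if there is $C=C(n,s,p,\Omega)>0$ such that every $u\in W^{s,p}(\Omega)$ has an extension $\tilde u\in W^{s,p}(\mathbb{R}^n)$ with $\tilde u=u$ on $\Omega$ and $\|\tilde u\|_{s,p}\le C\|u\|_{s,p;\Omega}$. $\widetilde W^{s,p}(\Omega)$ is the space of all $u\in W^{s,p}(\Omega)$ whose extension by zero outside $\Omega$ belongs to $W^{s,p}(\mathbb{R}^n)$, normed by the $W^{s,p}(\mathbb{R}^n)$ norm of the zero extension; such $u$ are always identified with their zero extension to $\mathbb{R}^n$. For $u,v\in W^{s,p}(\mathbb{R}^n)$ put $\mathcal{H}(u,v)=\frac12\iint_{\mathbb{R}^n\times\mathbb{R}^n}\frac{|u(x)-u(y)|^{p-2}(u(x)-u(y))(v(x)-v(y))}{|x-y|^{n+sp}}\,dx\,dy$. For $V\in L^q(\Omega)$, a number $\lambda\in\mathbb{R}$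 is an eigenvalue (for the potential $V$) if there is a nontrivial $u\in\widetilde W^{s,p}(\Omega)$ (an associated eigenfunction) with $\mathcal{H}(u,v)+\int_\Omega V|u|^{p-2}uv\,dx=\lambda\int_{\mathbb{R}^n}|u|^{p-2}uv\,dx$ for all $v\in\widetilde W^{s,p}(\Omega)$. $\lambda(V)=\inf\{\frac12[u]_{s,p}^p+\int_\Omega V|u|^p\,dx\colon u\in\widetilde W^{s,p}(\Omega),\ \|u\|_p=1\}$. It is an eigenvalue and has a unique positive eigenfunction with $\|u\|_p=1$. For $V\in\partial B(0,1)$, the tangent space is $T_V(\partial B(0,1))=\{W\in L^q(\Omega)\colon\int_\Omega|V|^{q-2}VW\,dx=0\}$. *)

theory Defs
  imports "HOL-Analysis.Analysis"
begin

text \<open>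
  Functions on an open set \<open>S\<close> of the Euclidean space \<open>'a\<close> are total functions
  \<open>'a \<Rightarrow> real\<close> whose values outside \<open>S\<close> are irrelevant; elements of Lebesgue and Sobolev spaces
  are representatives, so equality of elements is equality almost everywhere.
  The nonlinearity $|t|^{p-2}t$ is written \<open>\<bar>t\<bar> powr (p - 2) * t\<close>; since \<open>0 powr a = 0\<close> it is
  \<open>0\<close> at \<open>t = 0\<close>, also when \<open>p < 2\<close>.
\<close>

definition Lp_space :: "real \<Rightarrow> 'a::euclidean_space set \<Rightarrow> ('a \<Rightarrow> real) set" where
  "Lp_space p S = {u \<in> borel_measurable (lebesgue_on S).
     integrable (lebesgue_on S) (\<lambda>x. \<bar>u x\<bar> powr p)}"

definition Lp_norm :: "real \<Rightarrow> 'a::euclidean_space set \<Rightarrow> ('a \<Rightarrow> real) \<Rightarrow> real" where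
  "Lp_norm p S u = (\<integral>x. \<bar>u x\<bar> powr p \<partial>lebesgue_on S) powr (1 / p)"

definition gagliardo_integrand ::
    "real \<Rightarrow> real \<Rightarrow> ('a::euclidean_space \<Rightarrow> real) \<Rightarrow> 'a \<times> 'a \<Rightarrow> real" where
  "gagliardo_integrand s p u =
     (\<lambda>(x, y). \<bar>u x - u y\<bar> powr p / norm (x - y) powr (real DIM('a) + s * p))"

definition W_space :: "real \<Rightarrow> real \<Rightarrow> 'a::euclidean_space set \<Rightarrow> ('a \<Rightarrow> real) set" where
  "W_space s p S = {u \<in> Lp_space p S.
     integrable (lebesgue_on S \<Otimes>\<^sub>M lebesgue_on S) (gagliardo_integrand s p u)}"

definition gagliardo_seminorm ::
    "real \<Rightarrow> real \<Rightarrow> 'a::euclidean_space set \<Rightarrow> ('a \<Rightarrow> real) \<Rightarrow> real" where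
  "gagliardo_seminorm s p S u =
     (\<integral>z. gagliardo_integrand s p u z \<partial>(lebesgue_on S \<Otimes>\<^sub>M lebesgue_on S)) powr (1 / p)"

definition W_norm :: "real \<Rightarrow> real \<Rightarrow> 'a::euclidean_space set \<Rightarrow> ('a \<Rightarrow> real) \<Rightarrow> real" where
  "W_norm s p S u = (Lp_norm p S u powr p + gagliardo_seminorm s p S u powr p) powr (1 / p)"

definition extension_domain :: "real \<Rightarrow> real \<Rightarrow> 'a::euclidean_space set \<Rightarrow> bool" where
  "extension_domain s p \<Omega> \<longleftrightarrow> open \<Omega> \<and>
     (\<exists>C>0. \<forall>u\<in>W_space s p \<Omega>. \<exists>v\<in>W_space s p UNIV.
        (AE x in lebesgue_on \<Omega>. v x = u x) \<and> W_norm s p UNIV v \<le> C * W_norm s p \<Omega> u)"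

definition zero_ext :: "'a set \<Rightarrow> ('a \<Rightarrow> real) \<Rightarrow> 'a \<Rightarrow> real" where
  "zero_ext \<Omega> u = (\<lambda>x. if x \<in> \<Omega> then u x else 0)"

text \<open>
  The elements of $\widetilde W^{s,p}(\Omega)$ are identified with their extensions by zero, so the
  space is defined as the set of these extensions.
\<close>

definition W_tilde :: "real \<Rightarrow> real \<Rightarrow> 'a::euclidean_space set \<Rightarrow> ('a \<Rightarrow> real) set" where
  "W_tilde s p \<Omega> = zero_ext \<Omega> ` {u \<in> W_space s p \<Omega>. zero_ext \<Omega> u \<in> W_space s p UNIV}"

definition H_form ::
    "real \<Rightarrow> real \<Rightarrow> ('a::euclidean_space \<Rightarrow> real) \<Rightarrow> ('a \<Rightarrow> real) \<Rightarrow> real" where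
  "H_form s p u v = 1 / 2 *
     (\<integral>(x, y). \<bar>u x - u y\<bar> powr (p - 2) * (u x - u y) * (v x - v y)
        / norm (x - y) powr (real DIM('a) + s * p) \<partial>(lebesgue \<Otimes>\<^sub>M lebesgue))"

definition eigenfunction ::
    "real \<Rightarrow> real \<Rightarrow> 'a::euclidean_space set \<Rightarrow> ('a \<Rightarrow> real) \<Rightarrow> real \<Rightarrow> ('a \<Rightarrow> real) \<Rightarrow> bool" where
  "eigenfunction s p \<Omega> V \<mu> u \<longleftrightarrow> u \<in> W_tilde s p \<Omega> \<and> \<not> (AE x in lebesgue. u x = 0) \<and>
     (\<forall>v\<in>W_tilde s p \<Omega>.
        H_form s p u v + (\<integral>x. V x * \<bar>u x\<bar> powr (p - 2) * u x * v x \<partial>lebesgue_on \<Omega>)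
          = \<mu> * (\<integral>x. \<bar>u x\<bar> powr (p - 2) * u x * v x \<partial>lebesgue))"

text \<open>
  The infimum below is the one of \<^typ>\<open>real\<close>; it is the true infimum when \<open>\<Omega>\<close> is a nonempty
  bounded extension domain and \<open>V\<close> is in $L^q(\Omega)$ with $q > \max(1, n/(sp))$, since the
  functional is then bounded below.
\<close>

definition first_eigenvalue ::
    "real \<Rightarrow> real \<Rightarrow> 'a::euclidean_space set \<Rightarrow> ('a \<Rightarrow> real) \<Rightarrow> real" where
  "first_eigenvalue s p \<Omega> V =
     (INF u \<in> {u \<in> W_tilde s p \<Omega>. Lp_norm p UNIV u = 1}.
        1 / 2 * gagliardo_seminorm s p UNIV u powr p
          + (\<integral>x. V x * \<bar>u x\<bar> powr p \<partial>lebesgue_on \<Omega>))"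

definition positive_normalized_eigenfunction ::
    "real \<Rightarrow> real \<Rightarrow> 'a::euclidean_space set \<Rightarrow> ('a \<Rightarrow> real) \<Rightarrow> ('a \<Rightarrow> real) \<Rightarrow> bool" where
  "positive_normalized_eigenfunction s p \<Omega> V u \<longleftrightarrow>
     eigenfunction s p \<Omega> V (first_eigenvalue s p \<Omega> V) u \<and>
     (AE x in lebesgue_on \<Omega>. u x > 0) \<and> Lp_norm p UNIV u = 1"

definition Lq_unit_ball :: "real \<Rightarrow> 'a::euclidean_space set \<Rightarrow> ('a \<Rightarrow> real) set" where
  "Lq_unit_ball q \<Omega> = {V \<in> Lp_space q \<Omega>. Lp_norm q \<Omega> V \<le> 1}"

definition Lq_unit_sphere :: "real \<Rightarrow> 'a::euclidean_space set \<Rightarrow> ('a \<Rightarrow> real) set" where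
  "Lq_unit_sphere q \<Omega> = {V \<in> Lp_space q \<Omega>. Lp_norm q \<Omega> V = 1}"

definition tangent_space ::
    "real \<Rightarrow> 'a::euclidean_space set \<Rightarrow> ('a \<Rightarrow> real) \<Rightarrow> ('a \<Rightarrow> real) set" where
  "tangent_space q \<Omega> V = {W \<in> Lp_space q \<Omega>.
     (\<integral>x. \<bar>V x\<bar> powr (q - 2) * V x * W x \<partial>lebesgue_on \<Omega>) = 0}"

end

theory Submission
  imports Defs "HOL-Complex_Analysis.Great_Picard"
begin

text \<open>
  For fixed \<open>u\<close>, Hoelder's inequality shows that the smallest value of \<open>\<integral> V \<bar>u\<bar> powr p\<close> over the unit ball of
  $L^q(\Omega)$ is minus the norm of \<open>\<bar>u\<bar> powr p\<close> in the dual space, and that it is attained at a nonpositive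
  potential of norm one, proportional to \<open>- \<bar>u\<bar> powr (p / (q - 1))\<close>. Interchanging the two minimizations, the
  least first eigenvalue is the minimum of the reduced functional
  \<open>u \<mapsto> [u]^p / 2 - (\<integral> \<bar>u\<bar> powr r) powr (1 - 1 / q)\<close> with \<open>r = p q / (q - 1)\<close>, over functions with
  \<open>\<integral> \<bar>u\<bar> powr p = 1\<close>.

  A minimizer \<open>u \<ge> 0\<close> exists by the direct method (\<open>reduced_minimizer\<close>). Coercivity comes from the
  subcritical embedding \<open>fractional_embedding\<close>, which holds since \<open>q > n / (s p)\<close>; compactness comes from
  \<open>fractional_rellich\<close> and from the embedding with a slightly smaller value of \<open>q\<close>.

  Let \<open>V\<^sub>0\<close> be the optimal potential of that minimizer. Then \<open>u\<close> also minimizes the functional with potential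
  \<open>V\<^sub>0\<close>, so it satisfies the eigenvalue equation (\<open>Euler_Lagrange\<close>), and it is positive almost everywhere
  (\<open>minimizer_positive\<close>). For the orthogonality to tangent vectors no uniqueness of eigenfunctions is needed: testing
  the equation of any positive normalized eigenfunction for \<open>V\<^sub>0\<close> with itself shows that it attains the least
  value, and so \<open>V\<^sub>0\<close> is best for it among all potentials in the unit ball; varying \<open>V\<^sub>0\<close> along the sphere
  gives the claim (\<open>tangent_orthogonality\<close>).
\<close>

section \<open>Function spaces and measurability\<close>

lemma sigma_finite_lebesgue: "sigma_finite_measure (lebesgue :: 'a::euclidean_space measure)"
proof -
  obtain A :: "'a set set" where A: "countable A" "A \<subseteq> sets lborel" "\<Union>A = space lborel"
    "\<forall>a\<in>A. emeasure lborel a \<noteq> \<infinity>"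
    using lborel.sigma_finite_countable by blast
  show ?thesis
    unfolding sigma_finite_measure_def
  proof (intro exI conjI)
    show "A \<subseteq> sets lebesgue" using A(2) by (auto intro: sets_completionI_sets)
    show "\<forall>a\<in>A. emeasure lebesgue a \<noteq> \<infinity>"
      using A(2,4) by (auto simp: subset_iff)
  qed (use A in auto)
qed

interpretation lebesgue: sigma_finite_measure "lebesgue :: 'a::euclidean_space measure"
  by (rule sigma_finite_lebesgue)

interpretation lebesgue_pair: pair_sigma_finite
    "lebesgue :: 'a::euclidean_space measure" "lebesgue :: 'b::euclidean_space measure" ..

lemma id_borel_measurable_lebesgue [measurable]: "(\<lambda>x. x) \<in> borel_measurable (lebesgue :: 'a::euclidean_space measure)"
  using measurable_completion[of "\<lambda>x. x" lborel borel] by simp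

lemma fst_borel_lebesgue_pair [measurable]:
  "fst \<in> borel_measurable ((lebesgue :: 'a::euclidean_space measure) \<Otimes>\<^sub>M (lebesgue :: 'b::euclidean_space measure))"
  using measurable_compose[OF measurable_fst id_borel_measurable_lebesgue] by simp

lemma snd_borel_lebesgue_pair [measurable]:
  "snd \<in> borel_measurable ((lebesgue :: 'b::euclidean_space measure) \<Otimes>\<^sub>M (lebesgue :: 'a::euclidean_space measure))"
  using measurable_compose[OF measurable_snd id_borel_measurable_lebesgue] by simp

lemma gagliardo_integrand_measurable [measurable]:
  fixes u :: "'a::euclidean_space \<Rightarrow> real"
  assumes [measurable]: "u \<in> borel_measurable lebesgue"
  shows "gagliardo_integrand s p u \<in> borel_measurable (lebesgue \<Otimes>\<^sub>M lebesgue)"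
  unfolding gagliardo_integrand_def split_beta by measurable

lemma gagliardo_integrand_nonneg [simp]: "0 \<le> gagliardo_integrand s p u z"
  by (simp add: gagliardo_integrand_def split_beta)

lemma Lp_norm_powr:
  assumes "0 < p" shows "Lp_norm p S u powr p = (\<integral>x. \<bar>u x\<bar> powr p \<partial>lebesgue_on S)"
  using assms by (simp add: Lp_norm_def powr_powr integral_nonneg)

lemma Lp_norm_eq_1_iff:
  assumes "0 < p" shows "Lp_norm p S u = 1 \<longleftrightarrow> (\<integral>x. \<bar>u x\<bar> powr p \<partial>lebesgue_on S) = 1"
  using Lp_norm_powr[OF assms, of S u] assms by (auto simp: Lp_norm_def)

lemma gagliardo_seminorm_powr:
  assumes "0 < p"
  shows "gagliardo_seminorm s p S u powr p
    = (\<integral>z. gagliardo_integrand s p u z \<partial>(lebesgue_on S \<Otimes>\<^sub>M lebesgue_on S))"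
  using assms by (simp add: gagliardo_seminorm_def powr_powr integral_nonneg)

text \<open>
  The \<open>p\<close>-th power of the Gagliardo seminorm on the whole space, without the factor \<open>1/2\<close>.
\<close>

definition energy :: "real \<Rightarrow> real \<Rightarrow> ('a::euclidean_space \<Rightarrow> real) \<Rightarrow> real" where
  "energy s p u = (\<integral>z. gagliardo_integrand s p u z \<partial>(lebesgue \<Otimes>\<^sub>M lebesgue))"

lemma energy_nonneg [simp]: "0 \<le> energy s p u"
  by (simp add: energy_def integral_nonneg)

lemma W_space_UNIV_iff:
  "u \<in> W_space s p UNIV \<longleftrightarrow> u \<in> borel_measurable lebesgue \<and> integrable lebesgue (\<lambda>x. \<bar>u x\<bar> powr p)
     \<and> integrable (lebesgue \<Otimes>\<^sub>M lebesgue) (gagliardo_integrand s p u)"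
  by (auto simp: W_space_def Lp_space_def lebesgue_on_UNIV_eq)

lemma W_space_restrict:
  assumes u: "u \<in> W_space s p UNIV" and S: "S \<in> sets lebesgue"
  shows "u \<in> W_space s p S"
proof -
  have [measurable]: "u \<in> borel_measurable lebesgue"
    and 1: "integrable lebesgue (\<lambda>x. \<bar>u x\<bar> powr p)"
    and 2: "integrable (lebesgue \<Otimes>\<^sub>M lebesgue) (gagliardo_integrand s p u)"
    using u by (auto simp: W_space_UNIV_iff)
  have sf: "sigma_finite_measure (lebesgue_on S)"
    using S by (intro sigma_finite_measure_restrict_space sigma_finite_lebesgue) auto
  then interpret L: sigma_finite_measure "lebesgue_on S" .
  have id: "(\<lambda>x. x) \<in> lebesgue_on S \<rightarrow>\<^sub>M lebesgue"
    by (rule measurable_restrict_space1) simp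
  have idp: "(\<lambda>z. (fst z, snd z)) \<in> lebesgue_on S \<Otimes>\<^sub>M lebesgue_on S \<rightarrow>\<^sub>M lebesgue \<Otimes>\<^sub>M lebesgue"
    by (intro measurable_Pair measurable_compose[OF measurable_fst id] measurable_compose[OF measurable_snd id])
  have m: "gagliardo_integrand s p u \<in> borel_measurable (lebesgue_on S \<Otimes>\<^sub>M lebesgue_on S)"
    using measurable_compose[OF idp gagliardo_integrand_measurable[of u s p]] by simp
  have "(\<integral>\<^sup>+z. ennreal (gagliardo_integrand s p u z) \<partial>(lebesgue_on S \<Otimes>\<^sub>M lebesgue_on S))
      = (\<integral>\<^sup>+x. \<integral>\<^sup>+y. ennreal (gagliardo_integrand s p u (x, y)) \<partial>lebesgue_on S \<partial>lebesgue_on S)"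
    using m by (subst L.nn_integral_fst) auto
  also have "\<dots> \<le> (\<integral>\<^sup>+x. \<integral>\<^sup>+y. ennreal (gagliardo_integrand s p u (x, y)) \<partial>lebesgue \<partial>lebesgue_on S)"
    using S by (intro nn_integral_mono) (auto simp: nn_integral_restrict_space indicator_def intro!: nn_integral_mono)
  also have "\<dots> \<le> (\<integral>\<^sup>+x. \<integral>\<^sup>+y. ennreal (gagliardo_integrand s p u (x, y)) \<partial>lebesgue \<partial>lebesgue)"
    using S by (auto simp: nn_integral_restrict_space indicator_def intro!: nn_integral_mono)
  also have "\<dots> = (\<integral>\<^sup>+z. ennreal (gagliardo_integrand s p u z) \<partial>(lebesgue \<Otimes>\<^sub>M lebesgue))"
    by (subst lebesgue.nn_integral_fst) auto
  also have "\<dots> < \<infinity>"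
    using 2 by (simp add: integrable_iff_bounded)
  finally have "integrable (lebesgue_on S \<Otimes>\<^sub>M lebesgue_on S) (gagliardo_integrand s p u)"
    using m by (simp add: integrable_iff_bounded)
  moreover have "integrable (lebesgue_on S) (\<lambda>x. \<bar>u x\<bar> powr p)"
    using integrable_mult_indicator[OF S 1] S by (simp add: integrable_restrict_space set_integrable_def)
  moreover have "u \<in> borel_measurable (lebesgue_on S)"
    by (intro measurable_restrict_space1) simp
  ultimately show ?thesis
    by (simp add: W_space_def Lp_space_def)
qed

text \<open>
  For an open \<open>\<Omega>\<close> the space \<open>W_tilde s p \<Omega>\<close> consists of the elements of \<open>W_space s p UNIV\<close> that vanish
  at every point outside \<open>\<Omega>\<close>; the condition on the restriction to \<open>\<Omega>\<close> is redundant.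
\<close>

lemma W_tilde_iff:
  assumes "open \<Omega>"
  shows "w \<in> W_tilde s p \<Omega> \<longleftrightarrow> w \<in> W_space s p UNIV \<and> (\<forall>x. x \<notin> \<Omega> \<longrightarrow> w x = 0)"
proof
  assume R: "w \<in> W_space s p UNIV \<and> (\<forall>x. x \<notin> \<Omega> \<longrightarrow> w x = 0)"
  then have "zero_ext \<Omega> w = w" by (auto simp: zero_ext_def)
  moreover have "w \<in> W_space s p \<Omega>" using R assms by (auto intro!: W_space_restrict)
  ultimately show "w \<in> W_tilde s p \<Omega>"
    using R unfolding W_tilde_def by (metis (mono_tags, lifting) image_eqI mem_Collect_eq)
qed (auto simp: W_tilde_def zero_ext_def)

lemma abs_add_powr_le:
  fixes a b p :: real
  assumes "0 \<le> p"
  shows "\<bar>a + b\<bar> powr p \<le> 2 powr p * (\<bar>a\<bar> powr p + \<bar>b\<bar> powr p)"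
proof -
  have "\<bar>a + b\<bar> powr p \<le> (2 * max \<bar>a\<bar> \<bar>b\<bar>) powr p"
    using assms by (intro powr_mono2) auto
  also have "\<dots> = 2 powr p * (max \<bar>a\<bar> \<bar>b\<bar>) powr p" by (simp add: powr_mult)
  also have "\<dots> \<le> 2 powr p * (\<bar>a\<bar> powr p + \<bar>b\<bar> powr p)"
    by (intro mult_left_mono) (auto simp: max_def)
  finally show ?thesis .
qed

text \<open>
  A common criterion for membership: it yields closure under linear combinations, absolute values,
  maxima, minima and truncations.
\<close>

lemma W_space_dominated:
  fixes u v w :: "'a::euclidean_space \<Rightarrow> real"
  assumes p: "0 < p" and u: "u \<in> W_space s p UNIV" and v: "v \<in> W_space s p UNIV"
    and w[measurable]: "w \<in> borel_measurable lebesgue"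
    and le: "\<And>x. \<bar>w x\<bar> \<le> A * (\<bar>u x\<bar> + \<bar>v x\<bar>)"
    and le': "\<And>x y. \<bar>w x - w y\<bar> \<le> A * (\<bar>u x - u y\<bar> + \<bar>v x - v y\<bar>)"
    and A: "0 \<le> A"
  shows "w \<in> W_space s p UNIV"
proof -
  have [measurable]: "u \<in> borel_measurable lebesgue" "v \<in> borel_measurable lebesgue"
    using u v by (auto simp: W_space_UNIV_iff)
  have *: "a powr p \<le> A powr p * 2 powr p * (\<bar>b\<bar> powr p + \<bar>c\<bar> powr p)"
    if "0 \<le> a" "a \<le> A * (\<bar>b\<bar> + \<bar>c\<bar>)" for a b c :: real
  proof -
    have "a powr p \<le> (A * \<bar>\<bar>b\<bar> + \<bar>c\<bar>\<bar>) powr p" using that p by (intro powr_mono2) auto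
    also have "\<dots> = A powr p * (\<bar>\<bar>b\<bar> + \<bar>c\<bar>\<bar>) powr p" using A by (simp add: powr_mult)
    also have "\<dots> \<le> A powr p * (2 powr p * (\<bar>\<bar>b\<bar>\<bar> powr p + \<bar>\<bar>c\<bar>\<bar> powr p))"
      using p by (intro mult_left_mono abs_add_powr_le) auto
    finally show ?thesis by (simp add: mult.assoc)
  qed
  have "integrable lebesgue (\<lambda>x. \<bar>w x\<bar> powr p)"
  proof (rule Bochner_Integration.integrable_bound)
    show "integrable lebesgue (\<lambda>x. A powr p * 2 powr p * (\<bar>u x\<bar> powr p + \<bar>v x\<bar> powr p))"
      using u v by (auto simp: W_space_UNIV_iff)
    show "AE x in lebesgue. norm (\<bar>w x\<bar> powr p) \<le> norm (A powr p * 2 powr p * (\<bar>u x\<bar> powr p + \<bar>v x\<bar> powr p))"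
      using *[OF _ le] by (auto simp: abs_of_nonneg)
  qed measurable
  moreover have "integrable (lebesgue \<Otimes>\<^sub>M lebesgue) (gagliardo_integrand s p w)"
  proof (rule Bochner_Integration.integrable_bound)
    show "integrable (lebesgue \<Otimes>\<^sub>M lebesgue)
      (\<lambda>z. A powr p * 2 powr p * (gagliardo_integrand s p u z + gagliardo_integrand s p v z))"
      using u v by (auto simp: W_space_UNIV_iff)
    show "AE z in lebesgue \<Otimes>\<^sub>M lebesgue. norm (gagliardo_integrand s p w z)
       \<le> norm (A powr p * 2 powr p * (gagliardo_integrand s p u z + gagliardo_integrand s p v z))"
    proof (rule AE_I2)
      fix z :: "'a \<times> 'a"
      have "gagliardo_integrand s p w z
         \<le> A powr p * 2 powr p * (\<bar>u (fst z) - u (snd z)\<bar> powr p + \<bar>v (fst z) - v (snd z)\<bar> powr p)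
            / norm (fst z - snd z) powr (real DIM('a) + s * p)"
        unfolding gagliardo_integrand_def split_beta
        by (intro divide_right_mono *[OF _ le']) auto
      then show "norm (gagliardo_integrand s p w z)
         \<le> norm (A powr p * 2 powr p * (gagliardo_integrand s p u z + gagliardo_integrand s p v z))"
        by (simp add: abs_mult) (simp add: gagliardo_integrand_def split_beta add_divide_distrib ring_distribs mult.assoc)
    qed
  qed measurable
  ultimately show ?thesis
    by (simp add: W_space_UNIV_iff)
qed

lemma W_tilde_dominated:
  fixes u v w :: "'a::euclidean_space \<Rightarrow> real"
  assumes "open \<Omega>" "0 < p" "u \<in> W_tilde s p \<Omega>" "v \<in> W_tilde s p \<Omega>" "w \<in> borel_measurable lebesgue"
    and le: "\<And>x. \<bar>w x\<bar> \<le> A * (\<bar>u x\<bar> + \<bar>v x\<bar>)"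
    and "\<And>x y. \<bar>w x - w y\<bar> \<le> A * (\<bar>u x - u y\<bar> + \<bar>v x - v y\<bar>)" "0 \<le> A"
  shows "w \<in> W_tilde s p \<Omega>"
proof -
  have "w x = 0" if "x \<notin> \<Omega>" for x
    using le[of x] assms(1,3,4) that by (simp add: W_tilde_iff)
  then show ?thesis
    using W_space_dominated[OF assms(2) _ _ assms(5-8)] assms(1,3,4) by (auto simp: W_tilde_iff)
qed

lemma W_tilde_measurable: "open \<Omega> \<Longrightarrow> u \<in> W_tilde s p \<Omega> \<Longrightarrow> u \<in> borel_measurable lebesgue"
  by (auto simp: W_tilde_iff W_space_UNIV_iff)

lemma W_tilde_lincomb:
  assumes "open \<Omega>" "0 < p" "u \<in> W_tilde s p \<Omega>" "v \<in> W_tilde s p \<Omega>"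
  shows "(\<lambda>x. a * u x + b * v x) \<in> W_tilde s p \<Omega>"
proof (rule W_tilde_dominated[OF assms, where A = "\<bar>a\<bar> + \<bar>b\<bar>"])
  have [measurable]: "u \<in> borel_measurable lebesgue" "v \<in> borel_measurable lebesgue"
    using assms by (auto simp: W_tilde_measurable)
  show "(\<lambda>x. a * u x + b * v x) \<in> borel_measurable lebesgue" by measurable
  have *: "\<bar>a * c + b * d\<bar> \<le> (\<bar>a\<bar> + \<bar>b\<bar>) * (\<bar>c\<bar> + \<bar>d\<bar>)" for c d :: real
  proof -
    have "\<bar>a * c + b * d\<bar> \<le> \<bar>a\<bar> * \<bar>c\<bar> + \<bar>b\<bar> * \<bar>d\<bar>" by (metis abs_mult abs_triangle_ineq)
    also have "\<dots> \<le> (\<bar>a\<bar> + \<bar>b\<bar>) * (\<bar>c\<bar> + \<bar>d\<bar>)" by (simp add: algebra_simps)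
    finally show ?thesis .
  qed
  show "\<bar>a * u x + b * v x\<bar> \<le> (\<bar>a\<bar> + \<bar>b\<bar>) * (\<bar>u x\<bar> + \<bar>v x\<bar>)" for x by (rule *)
  show "\<bar>a * u x + b * v x - (a * u y + b * v y)\<bar> \<le> (\<bar>a\<bar> + \<bar>b\<bar>) * (\<bar>u x - u y\<bar> + \<bar>v x - v y\<bar>)" for x y
    using *[of "u x - u y" "v x - v y"] by (simp add: algebra_simps)
qed auto

lemma W_tilde_max:
  assumes "open \<Omega>" "0 < p" "u \<in> W_tilde s p \<Omega>" "v \<in> W_tilde s p \<Omega>"
  shows "(\<lambda>x. max (u x) (v x)) \<in> W_tilde s p \<Omega>"
  by (rule W_tilde_dominated[OF assms, where A = 1])
    (use assms in \<open>auto intro!: borel_measurable_max simp: W_tilde_measurable\<close>)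

lemma W_tilde_min:
  assumes "open \<Omega>" "0 < p" "u \<in> W_tilde s p \<Omega>" "v \<in> W_tilde s p \<Omega>"
  shows "(\<lambda>x. min (u x) (v x)) \<in> W_tilde s p \<Omega>"
  by (rule W_tilde_dominated[OF assms, where A = 1])
    (use assms in \<open>auto intro!: borel_measurable_min simp: W_tilde_measurable\<close>)

lemma W_tilde_abs:
  assumes "open \<Omega>" "0 < p" "u \<in> W_tilde s p \<Omega>"
  shows "(\<lambda>x. \<bar>u x\<bar>) \<in> W_tilde s p \<Omega>"
proof (rule W_tilde_dominated[OF assms assms(3), where A = 1])
  show "(\<lambda>x. \<bar>u x\<bar>) \<in> borel_measurable lebesgue"
    using W_tilde_measurable[OF assms(1,3)] by simp
  show "\<bar>\<bar>u x\<bar> - \<bar>u y\<bar>\<bar> \<le> 1 * (\<bar>u x - u y\<bar> + \<bar>u x - u y\<bar>)" for x y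
    using abs_triangle_ineq3[of "u x" "u y"] abs_ge_zero[of "u x - u y"] unfolding mult_1 by linarith
qed auto

section \<open>Integral inequalities and convergence\<close>

lemma powr_diff_le:
  fixes a b p :: real
  assumes "1 \<le> p" "0 \<le> b" "b \<le> a"
  shows "a powr p - b powr p \<le> p * a powr (p - 1) * (a - b)"
proof (cases "b = 0 \<or> a = b")
  case True
  have "a powr p \<le> p * (a powr (p - 1) * a)" if "0 < a"
    using that assms by (simp add: powr_mult_base powr_diff)
  with True assms show ?thesis by (cases "a = 0") (auto simp: mult.assoc)
next
  case False
  then have b: "0 < b" "b < a" using assms by auto
  have "\<exists>z. b < z \<and> z < a \<and> a powr p - b powr p = (a - b) * (p * z powr (p - 1))"
    using b by (intro MVT2) (auto intro!: has_real_derivative_powr)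
  then obtain z where z: "b < z" "z < a" "a powr p - b powr p = (a - b) * (p * z powr (p - 1))"
    by blast
  have "z powr (p - 1) \<le> a powr (p - 1)" using z b assms by (intro powr_mono2) auto
  then have "(a - b) * (p * z powr (p - 1)) \<le> (a - b) * (p * a powr (p - 1))"
    using b assms by (intro mult_left_mono) auto
  then show ?thesis using z by (simp add: mult_ac)
qed

lemma abs_powr_diff_le:
  fixes a b p :: real
  assumes "1 \<le> p" "\<bar>a\<bar> \<le> c" "\<bar>b\<bar> \<le> c"
  shows "\<bar>\<bar>a\<bar> powr p - \<bar>b\<bar> powr p\<bar> \<le> p * c powr (p - 1) * \<bar>a - b\<bar>"
proof -
  have *: "x powr p - y powr p \<le> p * c powr (p - 1) * (x - y)"
    if "0 \<le> y" "y \<le> x" "x \<le> c" for x y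
  proof -
    have "x powr p - y powr p \<le> p * x powr (p - 1) * (x - y)"
      using that assms by (intro powr_diff_le) auto
    also have "\<dots> \<le> p * c powr (p - 1) * (x - y)"
      using that assms by (intro mult_right_mono mult_left_mono powr_mono2) auto
    finally show ?thesis .
  qed
  have "\<bar>\<bar>a\<bar> powr p - \<bar>b\<bar> powr p\<bar> \<le> p * c powr (p - 1) * \<bar>\<bar>a\<bar> - \<bar>b\<bar>\<bar>"
  proof (cases "\<bar>b\<bar> \<le> \<bar>a\<bar>")
    case True
    then have "\<bar>b\<bar> powr p \<le> \<bar>a\<bar> powr p" using assms by (intro powr_mono2) auto
    with True * [of "\<bar>b\<bar>" "\<bar>a\<bar>"] assms show ?thesis by simp
  next
    case False
    then have "\<bar>a\<bar> powr p \<le> \<bar>b\<bar> powr p" using assms by (intro powr_mono2) auto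
    with False * [of "\<bar>a\<bar>" "\<bar>b\<bar>"] assms show ?thesis by simp
  qed
  also have "\<dots> \<le> p * c powr (p - 1) * \<bar>a - b\<bar>"
    using assms by (intro mult_left_mono) auto
  finally show ?thesis .
qed

lemma convex_abs_powr:
  fixes p :: real
  assumes "1 \<le> p" shows "convex_on UNIV (\<lambda>x::real. \<bar>x\<bar> powr p)"
proof (intro convex_onI)
  fix t x y :: real assume t: "0 < t" "t < 1"
  have pos: "((1 - t) * a + t * b) powr p \<le> (1 - t) * a powr p + t * b powr p"
    if "0 \<le> a" "0 \<le> b" for a b
  proof -
    have small: "(r * c) powr p \<le> r * c powr p" if "0 \<le> r" "r \<le> 1" for r c :: real
    proof -
      have "r powr p \<le> r" using that assms powr_mono'[of 1 p r] by (cases "r = 0") auto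
      then show ?thesis using that by (cases "c \<ge> 0") (auto simp: powr_mult intro!: mult_right_mono)
    qed
    consider "a = 0" | "b = 0" | "0 < a" "0 < b" using \<open>0 \<le> a\<close> \<open>0 \<le> b\<close> by linarith
    then show ?thesis
    proof cases
      case 3
      then show ?thesis using convex_onD[OF powr_convex[OF assms], of t a b] t by simp
    qed (use small[of t b] small[of "1-t" a] t assms in auto)
  qed
  have "\<bar>(1 - t) * x + t * y\<bar> powr p \<le> ((1 - t) * \<bar>x\<bar> + t * \<bar>y\<bar>) powr p"
    using t assms by (intro powr_mono2) (auto intro: order_trans[OF abs_triangle_ineq] simp: abs_mult)
  also have "\<dots> \<le> (1 - t) * \<bar>x\<bar> powr p + t * \<bar>y\<bar> powr p"
    by (rule pos) auto
  finally show "\<bar>(1 - t) *\<^sub>R x + t *\<^sub>R y\<bar> powr p \<le> (1 - t) * \<bar>x\<bar> powr p + t * \<bar>y\<bar> powr p"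
    by simp
qed auto

text \<open>
  Convexity of \<open>\<bar>t\<bar> powr p\<close> makes the Gagliardo energy submodular. Only the case in which the two functions
  cross between the two points needs an argument: then the differences of the maximum and of the minimum
  lie between the two original differences and have the same sum.
\<close>

lemma abs_powr_submodular:
  fixes a b c d p :: real
  assumes p: "1 \<le> p"
  shows "\<bar>max a c - max b d\<bar> powr p + \<bar>min a c - min b d\<bar> powr p \<le> \<bar>a - b\<bar> powr p + \<bar>c - d\<bar> powr p"
proof -
  have cross: "\<bar>c - b\<bar> powr p + \<bar>a - d\<bar> powr p \<le> \<bar>a - b\<bar> powr p + \<bar>c - d\<bar> powr p"
    if "a \<le> c" "d \<le> b" for a b c d
  proof (cases "a = c \<and> d = b")
    case False
    define D where "D = (c - d) - (a - b)"
    have D: "D > 0" using that False by (auto simp: D_def)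
    define t where "t = (c - a) / D"
    have t: "0 \<le> t" "t \<le> 1" using that D by (auto simp: t_def D_def divide_simps)
    have tD: "t * D = c - a" using D by (simp add: t_def)
    have 1: "c - b = (1 - t) * (a - b) + t * (c - d)"
      using tD unfolding D_def by (simp add: algebra_simps)
    have 2: "a - d = (1 - t) * (c - d) + t * (a - b)"
      using tD unfolding D_def by (simp add: algebra_simps)
    have "\<bar>c - b\<bar> powr p \<le> (1 - t) * \<bar>a - b\<bar> powr p + t * \<bar>c - d\<bar> powr p"
      unfolding 1 using convex_onD[OF convex_abs_powr[OF p], of t "a - b" "c - d"] t by simp
    moreover have "\<bar>a - d\<bar> powr p \<le> (1 - t) * \<bar>c - d\<bar> powr p + t * \<bar>a - b\<bar> powr p"
      unfolding 2 using convex_onD[OF convex_abs_powr[OF p], of t "c - d" "a - b"] t by simp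
    ultimately show ?thesis by (simp add: algebra_simps)
  qed auto
  consider "a \<le> c" "b \<le> d" | "c \<le> a" "d \<le> b" | "a \<le> c" "d \<le> b" | "c \<le> a" "b \<le> d" by linarith
  then show ?thesis
  proof cases
    case 3
    then show ?thesis using cross[OF 3] by (simp add: max_def min_def)
  next
    case 4
    then show ?thesis using cross[OF 4] by (simp add: max_def min_def)
  qed (simp_all add: max_def min_def)
qed

lemma le_add_powr:
  fixes t \<eta> p :: real
  assumes "1 \<le> p" "0 \<le> t" "0 < \<eta>"
  shows "t \<le> \<eta> + \<eta> powr (1 - p) * t powr p"
proof (cases "t \<le> \<eta>")
  case False
  have "t = t powr (1 - p) * t powr p" using False assms by (simp flip: powr_add)
  also have "\<dots> \<le> \<eta> powr (1 - p) * t powr p"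
    using False assms by (intro mult_right_mono powr_mono2') auto
  finally show ?thesis using assms by linarith
qed (use assms in \<open>auto intro: add_increasing2\<close>)

lemma DERIV_abs_powr:
  fixes p y :: real
  assumes p: "1 < p"
  shows "((\<lambda>y. \<bar>y\<bar> powr p) has_real_derivative p * (\<bar>y\<bar> powr (p - 2) * y)) (at y)"
proof -
  consider "y > 0" | "y < 0" | "y = 0" by linarith
  then show ?thesis
  proof cases
    case 1
    have e: "y powr (p - 1) = y powr (p - 2) * y"
      using 1 powr_add[of y "p - 2" 1] by simp
    have "((\<lambda>y. y powr p) has_real_derivative p * y powr (p - 1)) (at y)"
      using 1 by (rule has_real_derivative_powr)
    then show ?thesis
    proof (rule has_field_derivative_transform_within_open[where S = "{0<..}", THEN DERIV_cong])
    qed (use 1 e in auto)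
  next
    case 2
    have e: "(-y) powr (p - 1) = (-y) powr (p - 2) * (-y)"
      using 2 powr_add[of "-y" "p - 2" 1] by simp
    have "((\<lambda>y. (-y) powr p) has_real_derivative p * (-y) powr (p - 1) * (-1)) (at y)"
      using 2 by (auto intro!: derivative_eq_intros)
    then show ?thesis
    proof (rule has_field_derivative_transform_within_open[where S = "{..<0}", THEN DERIV_cong])
    qed (use 2 e in auto)
  next
    case 3
    have "((\<lambda>h. \<bar>h\<bar> powr (p - 1)) \<longlongrightarrow> \<bar>0::real\<bar> powr (p - 1)) (at 0)"
      using p by (intro tendsto_powr' tendsto_rabs tendsto_ident_at) auto
    then have 4: "((\<lambda>h::real. \<bar>h\<bar> powr (p - 1)) \<longlongrightarrow> 0) (at 0)" by simp
    have "((\<lambda>h::real. \<bar>h\<bar> powr p / h) \<longlongrightarrow> 0) (at 0)"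
    proof (rule Lim_null_comparison[OF _ 4], rule eventually_at_filter[THEN iffD2], rule always_eventually, safe)
      fix h :: real assume "h \<noteq> 0"
      then show "norm (\<bar>h\<bar> powr p / h) \<le> \<bar>h\<bar> powr (p - 1)" by (simp add: powr_diff)
    qed
    then show ?thesis using 3 p by (simp add: DERIV_def)
  qed
qed

text \<open>
  Differentiation under the integral sign with an arbitrary, possibly signed, weight. It serves for the
  Gagliardo energy (the weight is the kernel), for the potential term, and for the $L^p$ and $L^q$ norms.
\<close>

lemma has_derivative_integral_abs_powr:
  fixes w f g :: "'a \<Rightarrow> real" and p :: real
  assumes p: "1 < p"
    and [measurable]: "w \<in> borel_measurable M" "f \<in> borel_measurable M" "g \<in> borel_measurable M"
    and intf: "integrable M (\<lambda>x. w x * \<bar>f x\<bar> powr p)"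
    and intg: "integrable M (\<lambda>x. w x * \<bar>g x\<bar> powr p)"
  shows "integrable M (\<lambda>x. w x * \<bar>f x + t * g x\<bar> powr p)" (is ?I)
    and "((\<lambda>t. \<integral>x. w x * \<bar>f x + t * g x\<bar> powr p \<partial>M) has_real_derivative
          p * (\<integral>x. w x * (\<bar>f x\<bar> powr (p - 2) * f x) * g x \<partial>M)) (at 0)" (is ?D)
proof -
  have int: "integrable M (\<lambda>x. w x * \<bar>f x + t * g x\<bar> powr p)" for t
  proof (rule Bochner_Integration.integrable_bound)
    show "integrable M (\<lambda>x. 2 powr p * (\<bar>w x * \<bar>f x\<bar> powr p\<bar> + \<bar>t\<bar> powr p * \<bar>w x * \<bar>g x\<bar> powr p\<bar>))"
      using intf intg by (intro integrable_mult_right Bochner_Integration.integrable_add integrable_abs) auto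
    show "AE x in M. norm (w x * \<bar>f x + t * g x\<bar> powr p)
      \<le> norm (2 powr p * (\<bar>w x * \<bar>f x\<bar> powr p\<bar> + \<bar>t\<bar> powr p * \<bar>w x * \<bar>g x\<bar> powr p\<bar>))"
    proof (rule AE_I2)
      fix x
      have "\<bar>f x + t * g x\<bar> powr p \<le> (2 * max \<bar>f x\<bar> \<bar>t * g x\<bar>) powr p"
        using p by (intro powr_mono2) auto
      also have "\<dots> = 2 powr p * (max \<bar>f x\<bar> \<bar>t * g x\<bar>) powr p" by (simp add: powr_mult)
      also have "\<dots> \<le> 2 powr p * (\<bar>f x\<bar> powr p + \<bar>t\<bar> powr p * \<bar>g x\<bar> powr p)"
        by (intro mult_left_mono) (auto simp: max_def abs_mult powr_mult)
      finally have "\<bar>w x\<bar> * \<bar>f x + t * g x\<bar> powr p \<le> \<bar>w x\<bar> * (2 powr p * (\<bar>f x\<bar> powr p + \<bar>t\<bar> powr p * \<bar>g x\<bar> powr p))"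
        by (intro mult_left_mono) auto
      then show "norm (w x * \<bar>f x + t * g x\<bar> powr p)
        \<le> norm (2 powr p * (\<bar>w x * \<bar>f x\<bar> powr p\<bar> + \<bar>t\<bar> powr p * \<bar>w x * \<bar>g x\<bar> powr p\<bar>))"
        by (simp add: abs_mult algebra_simps)
    qed
  qed measurable
  show ?I by (rule int)
  define F where "F = (\<lambda>t. \<integral>x. w x * \<bar>f x + t * g x\<bar> powr p \<partial>M)"
  define B where "B = (\<lambda>x. p * 2 powr p * (\<bar>w x * \<bar>f x\<bar> powr p\<bar> + \<bar>w x * \<bar>g x\<bar> powr p\<bar>))"
  have intB: "integrable M B"
    unfolding B_def using intf intg
    by (intro integrable_mult_right Bochner_Integration.integrable_add integrable_abs) auto
  define Q where "Q = (\<lambda>t x. (w x * \<bar>f x + t * g x\<bar> powr p - w x * \<bar>f x\<bar> powr p) / t)"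
  have Q_le: "norm (Q t x) \<le> B x" if "\<bar>t\<bar> \<le> 1" "t \<noteq> 0" for t x
  proof -
    let ?c = "\<bar>f x\<bar> + \<bar>g x\<bar>"
    have tg: "\<bar>t * g x\<bar> \<le> \<bar>g x\<bar>"
      using that by (simp add: abs_mult mult_left_le_one_le)
    have "\<bar>f x + t * g x\<bar> \<le> ?c" using tg by linarith
    then have "\<bar>\<bar>f x + t * g x\<bar> powr p - \<bar>f x\<bar> powr p\<bar> \<le> p * ?c powr (p - 1) * \<bar>f x + t * g x - f x\<bar>"
      using p by (intro abs_powr_diff_le) auto
    also have "\<dots> = \<bar>t\<bar> * (p * (?c powr (p - 1) * \<bar>g x\<bar>))" by (simp add: abs_mult)
    also have "\<dots> \<le> \<bar>t\<bar> * (p * (?c powr (p - 1) * ?c))"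
      using p by (intro mult_left_mono) auto
    also have "?c powr (p - 1) * ?c = ?c powr p"
    proof (cases "?c = 0")
      case False
      then show ?thesis using powr_add[of ?c "p - 1" 1] by simp
    next
      case True
      then have "f x = 0" "g x = 0" by auto
      then show ?thesis by simp
    qed
    also have "?c powr p \<le> (2 * max \<bar>f x\<bar> \<bar>g x\<bar>) powr p" using p by (intro powr_mono2) auto
    also have "\<dots> = 2 powr p * (max \<bar>f x\<bar> \<bar>g x\<bar>) powr p" by (simp add: powr_mult)
    also have "\<dots> \<le> 2 powr p * (\<bar>f x\<bar> powr p + \<bar>g x\<bar> powr p)"
      by (intro mult_left_mono) (auto simp: max_def)
    finally have *: "\<bar>\<bar>f x + t * g x\<bar> powr p - \<bar>f x\<bar> powr p\<bar>
        \<le> \<bar>t\<bar> * (p * (2 powr p * (\<bar>f x\<bar> powr p + \<bar>g x\<bar> powr p)))"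
      using p by (simp add: mult_left_mono)
    have "norm (Q t x) = \<bar>w x\<bar> * (\<bar>\<bar>f x + t * g x\<bar> powr p - \<bar>f x\<bar> powr p\<bar> / \<bar>t\<bar>)"
      by (simp add: Q_def abs_mult flip: right_diff_distrib)
    also have "\<dots> \<le> \<bar>w x\<bar> * (p * (2 powr p * (\<bar>f x\<bar> powr p + \<bar>g x\<bar> powr p)))"
      using * that by (intro mult_left_mono) (auto simp: divide_simps mult_ac)
    also have "\<dots> = B x" by (simp add: B_def abs_mult algebra_simps)
    finally show ?thesis .
  qed
  have Q_lim: "((\<lambda>t. Q t x) \<longlongrightarrow> p * (w x * (\<bar>f x\<bar> powr (p - 2) * f x) * g x)) (at 0)" for x
  proof -
    have "((\<lambda>t. \<bar>f x + t * g x\<bar> powr p) has_real_derivative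
        p * (\<bar>f x + 0 * g x\<bar> powr (p - 2) * (f x + 0 * g x)) * g x) (at 0)"
      by (rule DERIV_chain2[OF DERIV_abs_powr[OF p]]) (auto intro!: derivative_eq_intros)
    then have "((\<lambda>t. w x * \<bar>f x + t * g x\<bar> powr p) has_real_derivative
        w x * (p * (\<bar>f x\<bar> powr (p - 2) * f x) * g x)) (at 0)"
      by (intro DERIV_cmult) simp
    then show ?thesis by (simp add: DERIV_def Q_def mult_ac)
  qed
  have "((\<lambda>t. (F t - F 0) / t) \<longlongrightarrow> p * (\<integral>x. w x * (\<bar>f x\<bar> powr (p - 2) * f x) * g x \<partial>M)) (at 0)"
    unfolding tendsto_at_iff_sequentially
  proof safe
    fix X :: "nat \<Rightarrow> real" assume X: "\<forall>i. X i \<in> UNIV - {0}" "X \<longlonglongrightarrow> 0"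
    have "eventually (\<lambda>i. \<bar>X i\<bar> < 1) sequentially"
      using tendstoD[OF X(2), of 1] by simp
    then obtain N where N: "\<And>i. i \<ge> N \<Longrightarrow> \<bar>X i\<bar> < 1" by (auto simp: eventually_sequentially)
    have FQ: "(F t - F 0) / t = (\<integral>x. Q t x \<partial>M)" for t
      unfolding F_def Q_def using int[of t] int[of 0] by simp
    have "(\<lambda>i. \<integral>x. Q (X (i + N)) x \<partial>M) \<longlonglongrightarrow> (\<integral>x. p * (w x * (\<bar>f x\<bar> powr (p - 2) * f x) * g x) \<partial>M)"
    proof (rule integral_dominated_convergence[where w = B])
      show "AE x in M. norm (Q (X (i + N)) x) \<le> B x" for i
        using Q_le[of "X (i + N)"] N[of "i + N"] X(1) by force
      have X2: "filterlim X (at 0) sequentially"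
        using X by (auto simp: filterlim_at)
      show "AE x in M. (\<lambda>i. Q (X (i + N)) x) \<longlonglongrightarrow> p * (w x * (\<bar>f x\<bar> powr (p - 2) * f x) * g x)"
        by (rule AE_I2) (intro LIMSEQ_ignore_initial_segment filterlim_compose[OF Q_lim X2])
    qed (auto simp: Q_def intB)
    then have "(\<lambda>i. (F (X i) - F 0) / X i) \<longlonglongrightarrow> p * (\<integral>x. w x * (\<bar>f x\<bar> powr (p - 2) * f x) * g x \<partial>M)"
      unfolding FQ integral_mult_right_zero by (rule LIMSEQ_offset)
    then show "((\<lambda>t. (F t - F 0) / t) \<circ> X) \<longlonglongrightarrow> p * (\<integral>x. w x * (\<bar>f x\<bar> powr (p - 2) * f x) * g x \<partial>M)"
      by (simp add: o_def)
  qed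
  then show ?D by (simp add: DERIV_def F_def)
qed

lemma fatou_bounded:
  fixes h :: "nat \<Rightarrow> 'a \<Rightarrow> real"
  assumes [measurable]: "f \<in> borel_measurable M" and int: "\<And>k. integrable M (h k)"
    and nonneg: "\<And>k x. 0 \<le> h k x"
    and lim: "AE x in M. (\<lambda>k. h k x) \<longlonglongrightarrow> f x"
    and C: "eventually (\<lambda>k. integral\<^sup>L M (h k) \<le> C) sequentially"
  shows "integrable M f \<and> integral\<^sup>L M f \<le> C"
proof -
  have [measurable]: "h k \<in> borel_measurable M" for k using int by auto
  have nn: "AE x in M. 0 \<le> f x"
    using lim by eventually_elim (auto intro: LIMSEQ_le_const simp: nonneg)
  have C0: "0 \<le> C"
  proof -
    obtain k where "integral\<^sup>L M (h k) \<le> C" using C by (auto simp: eventually_sequentially)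
    then show ?thesis using Bochner_Integration.integral_nonneg[of M "h k", OF nonneg] by linarith
  qed
  have "(\<integral>\<^sup>+x. ennreal (f x) \<partial>M) = (\<integral>\<^sup>+x. liminf (\<lambda>k. ennreal (h k x)) \<partial>M)"
  proof (rule nn_integral_cong_AE)
    show "AE x in M. ennreal (f x) = liminf (\<lambda>k. ennreal (h k x))"
      using lim by eventually_elim (metis lim_imp_Liminf sequentially_bot tendsto_ennrealI)
  qed
  also have "\<dots> \<le> liminf (\<lambda>k. \<integral>\<^sup>+x. ennreal (h k x) \<partial>M)"
    by (rule nn_integral_liminf) measurable
  also have "\<dots> \<le> ennreal C"
  proof (rule Liminf_le)
    show "eventually (\<lambda>k. (\<integral>\<^sup>+x. ennreal (h k x) \<partial>M) \<le> ennreal C) sequentially"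
      using C by eventually_elim (simp add: nn_integral_eq_integral int nonneg ennreal_leI)
  qed simp
  finally have le: "(\<integral>\<^sup>+x. ennreal (f x) \<partial>M) \<le> ennreal C" .
  have int_f: "integrable M f"
    using le nn by (intro integrableI_nonneg) (auto intro: le_less_trans)
  then have "ennreal (integral\<^sup>L M f) \<le> ennreal C"
    using le nn by (simp add: nn_integral_eq_integral)
  then show ?thesis using int_f C0 by simp
qed

lemma fatou_limit:
  fixes h :: "nat \<Rightarrow> 'a \<Rightarrow> real"
  assumes f: "f \<in> borel_measurable M" and int: "\<And>k. integrable M (h k)"
    and nonneg: "\<And>k x. 0 \<le> h k x"
    and lim: "AE x in M. (\<lambda>k. h k x) \<longlonglongrightarrow> f x"
    and L: "(\<lambda>k. integral\<^sup>L M (h k)) \<longlonglongrightarrow> L"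
  shows "integrable M f" "integral\<^sup>L M f \<le> L"
proof -
  have *: "integrable M f \<and> integral\<^sup>L M f \<le> L + e" if "0 < e" for e
  proof (rule fatou_bounded[OF f int nonneg lim])
    show "eventually (\<lambda>k. integral\<^sup>L M (h k) \<le> L + e) sequentially"
      using order_tendstoD(2)[OF L, of "L + e"] that by (auto elim: eventually_mono)
  qed
  show "integrable M f" using *[of 1] by simp
  show "integral\<^sup>L M f \<le> L" by (rule field_le_epsilon) (use * in blast)
qed

text \<open>
  A Vitali-type theorem: on a finite measure space, convergence almost everywhere and boundedness in
  \<open>L^b\<close> give convergence of the \<open>a\<close>-th moments for every exponent \<open>a < b\<close>. The contribution of the
  values above the level \<open>K\<close> is at most \<open>K powr (a - b) * C\<close>.
\<close>

lemma integral_abs_powr_convergence: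
  fixes h :: "nat \<Rightarrow> 'a \<Rightarrow> real" and a b :: real
  assumes fin: "finite_measure M" and ab: "0 < a" "a < b"
    and [measurable]: "f \<in> borel_measurable M" "\<And>k. h k \<in> borel_measurable M"
    and int: "\<And>k. integrable M (\<lambda>x. \<bar>h k x\<bar> powr b)"
    and C: "\<And>k. (\<integral>x. \<bar>h k x\<bar> powr b \<partial>M) \<le> C"
    and lim: "AE x in M. (\<lambda>k. h k x) \<longlonglongrightarrow> f x"
  shows "integrable M (\<lambda>x. \<bar>f x\<bar> powr a)"
    and "(\<lambda>k. \<integral>x. \<bar>h k x\<bar> powr a \<partial>M) \<longlonglongrightarrow> (\<integral>x. \<bar>f x\<bar> powr a \<partial>M)"
proof -
  interpret finite_measure M by (rule fin)
  have powr_le: "\<bar>t\<bar> powr a \<le> 1 + \<bar>t\<bar> powr b" for t :: real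
  proof (cases "\<bar>t\<bar> \<le> 1")
    case True
    then have "\<bar>t\<bar> powr a \<le> 1" using ab by (simp add: powr_le1)
    then show ?thesis using powr_ge_zero[of "\<bar>t\<bar>" b] by linarith
  next
    case False
    then have "\<bar>t\<bar> powr a \<le> \<bar>t\<bar> powr b" using ab by (intro powr_mono) auto
    then show ?thesis by linarith
  qed
  have inta: "integrable M (\<lambda>x. \<bar>g x\<bar> powr a)"
    if [measurable]: "g \<in> borel_measurable M" and "integrable M (\<lambda>x. \<bar>g x\<bar> powr b)" for g
    by (rule Bochner_Integration.integrable_bound[of M "\<lambda>x. 1 + \<bar>g x\<bar> powr b"])
      (use that powr_le in \<open>auto simp: abs_of_nonneg\<close>)
  have "integrable M (\<lambda>x. \<bar>f x\<bar> powr b) \<and> (\<integral>x. \<bar>f x\<bar> powr b \<partial>M) \<le> C"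
  proof (rule fatou_bounded[where h = "\<lambda>k x. \<bar>h k x\<bar> powr b"])
    show "AE x in M. (\<lambda>k. \<bar>h k x\<bar> powr b) \<longlonglongrightarrow> \<bar>f x\<bar> powr b"
      using lim by eventually_elim (use ab in \<open>auto intro!: tendsto_powr' tendsto_rabs\<close>)
  qed (use int C in auto)
  then have fb: "integrable M (\<lambda>x. \<bar>f x\<bar> powr b)" "(\<integral>x. \<bar>f x\<bar> powr b \<partial>M) \<le> C" by auto
  show fa: "integrable M (\<lambda>x. \<bar>f x\<bar> powr a)" by (rule inta[OF _ fb(1)]) simp
  have ha: "integrable M (\<lambda>x. \<bar>h k x\<bar> powr a)" for k by (rule inta[OF _ int]) simp
  have trunc_int: "integrable M (\<lambda>x. (min \<bar>g x\<bar> K) powr a)"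
    if [measurable]: "g \<in> borel_measurable M" and "0 < K" for g and K :: real
    by (rule integrable_const_bound[where B = "K powr a"])
      (use that ab in \<open>auto intro!: powr_mono2\<close>)
  have trunc: "\<bar>(\<integral>x. \<bar>g x\<bar> powr a \<partial>M) - (\<integral>x. (min \<bar>g x\<bar> K) powr a \<partial>M)\<bar> \<le> K powr (a - b) * C"
    if g: "g \<in> borel_measurable M" "integrable M (\<lambda>x. \<bar>g x\<bar> powr b)" "(\<integral>x. \<bar>g x\<bar> powr b \<partial>M) \<le> C"
      and K: "0 < K" for g K
  proof -
    have pt: "0 \<le> \<bar>t\<bar> powr a - (min \<bar>t\<bar> K) powr a" "\<bar>t\<bar> powr a - (min \<bar>t\<bar> K) powr a \<le> K powr (a - b) * \<bar>t\<bar> powr b" for t :: real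
    proof -
      show "0 \<le> \<bar>t\<bar> powr a - (min \<bar>t\<bar> K) powr a" using ab K by (auto intro!: powr_mono2)
      show "\<bar>t\<bar> powr a - (min \<bar>t\<bar> K) powr a \<le> K powr (a - b) * \<bar>t\<bar> powr b"
      proof (cases "\<bar>t\<bar> \<le> K")
        case False
        have "\<bar>t\<bar> powr a = \<bar>t\<bar> powr (a - b) * \<bar>t\<bar> powr b"
          using False K by (simp flip: powr_add)
        also have "\<dots> \<le> K powr (a - b) * \<bar>t\<bar> powr b"
          using False K ab by (intro mult_right_mono powr_mono2') auto
        finally show ?thesis using powr_ge_zero[of "min \<bar>t\<bar> K" a] by linarith
      qed auto
    qed
    have ia: "integrable M (\<lambda>x. \<bar>g x\<bar> powr a)" by (rule inta) (use g in auto)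
    have "(\<integral>x. \<bar>g x\<bar> powr a \<partial>M) - (\<integral>x. (min \<bar>g x\<bar> K) powr a \<partial>M)
        = (\<integral>x. \<bar>g x\<bar> powr a - (min \<bar>g x\<bar> K) powr a \<partial>M)"
      by (rule Bochner_Integration.integral_diff[symmetric, OF ia trunc_int]) (use g K in auto)
    moreover have "0 \<le> (\<integral>x. \<bar>g x\<bar> powr a - (min \<bar>g x\<bar> K) powr a \<partial>M)"
      using pt by (intro Bochner_Integration.integral_nonneg) auto
    moreover have "(\<integral>x. \<bar>g x\<bar> powr a - (min \<bar>g x\<bar> K) powr a \<partial>M) \<le> (\<integral>x. K powr (a - b) * \<bar>g x\<bar> powr b \<partial>M)"
      using pt g K ia trunc_int[OF g(1) K] by (intro integral_mono) auto
    moreover have "\<dots> \<le> K powr (a - b) * C"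
      using g K by (simp add: mult_left_mono)
    ultimately show ?thesis by linarith
  qed
  have tl: "(\<lambda>k. \<integral>x. (min \<bar>h k x\<bar> K) powr a \<partial>M) \<longlonglongrightarrow> (\<integral>x. (min \<bar>f x\<bar> K) powr a \<partial>M)" if K: "0 < K" for K
  proof (rule integral_dominated_convergence[where w = "\<lambda>_. K powr a"])
    show "AE x in M. (\<lambda>k. (min \<bar>h k x\<bar> K) powr a) \<longlonglongrightarrow> (min \<bar>f x\<bar> K) powr a"
      using lim by eventually_elim (use ab K in \<open>auto intro!: tendsto_powr' tendsto_min tendsto_rabs\<close>)
    show "AE x in M. norm ((min \<bar>h k x\<bar> K) powr a) \<le> K powr a" for k
      using K ab by (auto intro!: powr_mono2)
  qed auto
  show "(\<lambda>k. \<integral>x. \<bar>h k x\<bar> powr a \<partial>M) \<longlonglongrightarrow> (\<integral>x. \<bar>f x\<bar> powr a \<partial>M)"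
  proof (rule LIMSEQ_I)
    fix e :: real assume e: "0 < e"
    have "((\<lambda>K. K powr (a - b) * C) \<longlongrightarrow> 0 * C) at_top"
      using ab by (intro tendsto_mult tendsto_neg_powr filterlim_ident tendsto_const) auto
    then have "eventually (\<lambda>K. K powr (a - b) * C < e / 3) at_top"
      using e by (intro order_tendstoD(2)) auto
    then have "eventually (\<lambda>K. K powr (a - b) * C < e / 3 \<and> 0 < K) at_top"
      using eventually_gt_at_top[of 0] by eventually_elim simp
    then obtain K where K: "K powr (a - b) * C < e / 3" "0 < K"
      by (auto simp: eventually_at_top_linorder)
    obtain N where N: "\<And>k. k \<ge> N \<Longrightarrow> norm ((\<integral>x. (min \<bar>h k x\<bar> K) powr a \<partial>M) - (\<integral>x. (min \<bar>f x\<bar> K) powr a \<partial>M)) < e / 3"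
      using LIMSEQ_D[OF tl[OF K(2)], of "e / 3"] e by auto
    show "\<exists>N. \<forall>k\<ge>N. norm ((\<integral>x. \<bar>h k x\<bar> powr a \<partial>M) - (\<integral>x. \<bar>f x\<bar> powr a \<partial>M)) < e"
    proof (intro exI allI impI)
      fix k assume "k \<ge> N"
      from N[OF this] trunc[OF assms(5) int[of k] C K(2)] trunc[OF assms(4) fb K(2)] K(1)
      show "norm ((\<integral>x. \<bar>h k x\<bar> powr a \<partial>M) - (\<integral>x. \<bar>f x\<bar> powr a \<partial>M)) < e"
        unfolding real_norm_def by linarith
    qed
  qed
qed

lemma Holder_inequality:
  fixes V f :: "'a \<Rightarrow> real" and q q' :: real
  assumes q: "1 < q" "1 < q'" "1 / q + 1 / q' = 1"
    and [measurable]: "V \<in> borel_measurable M" "f \<in> borel_measurable M"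
    and V: "integrable M (\<lambda>x. \<bar>V x\<bar> powr q)" and f: "integrable M (\<lambda>x. \<bar>f x\<bar> powr q')"
  shows "integrable M (\<lambda>x. V x * f x)"
    and "\<bar>\<integral>x. V x * f x \<partial>M\<bar> \<le> (\<integral>x. \<bar>V x\<bar> powr q \<partial>M) powr (1 / q) * (\<integral>x. \<bar>f x\<bar> powr q' \<partial>M) powr (1 / q')"
proof -
  have le: "\<bar>a * b\<bar> \<le> \<bar>a\<bar> powr q / q + \<bar>b\<bar> powr q' / q'" for a b :: real
    using Youngs_inequality[OF q, of "\<bar>a\<bar>" "\<bar>b\<bar>"] by (simp add: abs_mult)
  show int: "integrable M (\<lambda>x. V x * f x)"
    by (rule Bochner_Integration.integrable_bound[of M "\<lambda>x. \<bar>V x\<bar> powr q / q + \<bar>f x\<bar> powr q' / q'"])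
      (use V f le q in \<open>auto simp: abs_of_nonneg\<close>)
  define A where "A = (\<integral>x. \<bar>V x\<bar> powr q \<partial>M)"
  define B where "B = (\<integral>x. \<bar>f x\<bar> powr q' \<partial>M)"
  have AB: "0 \<le> A" "0 \<le> B" by (auto simp: A_def B_def)
  show "\<bar>\<integral>x. V x * f x \<partial>M\<bar> \<le> (\<integral>x. \<bar>V x\<bar> powr q \<partial>M) powr (1 / q) * (\<integral>x. \<bar>f x\<bar> powr q' \<partial>M) powr (1 / q')"
  proof (cases "A = 0 \<or> B = 0")
    case True
    then have "AE x in M. V x * f x = 0"
    proof
      assume "A = 0"
      then have "AE x in M. \<bar>V x\<bar> powr q = 0"
        using V by (simp add: A_def integral_nonneg_eq_0_iff_AE)
      then show ?thesis by eventually_elim auto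
    next
      assume "B = 0"
      then have "AE x in M. \<bar>f x\<bar> powr q' = 0"
        using f by (simp add: B_def integral_nonneg_eq_0_iff_AE)
      then show ?thesis by eventually_elim auto
    qed
    then have "(\<integral>x. V x * f x \<partial>M) = 0" by (rule integral_eq_zero_AE)
    then show ?thesis by simp
  next
    case False
    then have pos: "0 < A" "0 < B" using AB by auto
    define \<alpha> where "\<alpha> = A powr (1 / q)"
    define \<beta> where "\<beta> = B powr (1 / q')"
    have ab: "0 < \<alpha>" "0 < \<beta>" "\<alpha> powr q = A" "\<beta> powr q' = B"
      using pos q by (auto simp: \<alpha>_def \<beta>_def powr_powr)
    have "\<bar>\<integral>x. V x * f x \<partial>M\<bar> / (\<alpha> * \<beta>) = \<bar>\<integral>x. (V x / \<alpha>) * (f x / \<beta>) \<partial>M\<bar>"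
      using ab by (simp add: abs_mult)
    also have "\<dots> \<le> (\<integral>x. \<bar>(V x / \<alpha>) * (f x / \<beta>)\<bar> \<partial>M)" by (rule integral_abs_bound)
    also have "\<dots> \<le> (\<integral>x. \<bar>V x\<bar> powr q / (A * q) + \<bar>f x\<bar> powr q' / (B * q') \<partial>M)"
    proof (rule integral_mono)
      fix x
      show "\<bar>(V x / \<alpha>) * (f x / \<beta>)\<bar> \<le> \<bar>V x\<bar> powr q / (A * q) + \<bar>f x\<bar> powr q' / (B * q')"
        using le[of "V x / \<alpha>" "f x / \<beta>"] ab by (simp add: powr_divide)
    qed (use V f int in auto)
    also have "\<dots> = 1 / q + 1 / q'"
      using V f pos by (simp flip: A_def B_def)
    finally have "\<bar>\<integral>x. V x * f x \<partial>M\<bar> \<le> \<alpha> * \<beta>"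
      using ab q by (simp add: divide_simps)
    then show ?thesis by (simp add: \<alpha>_def \<beta>_def A_def B_def)
  qed
qed

section \<open>Subcritical Sobolev embedding\<close>

lemma emeasure_lebesgue_ball:
  "0 \<le> r \<Longrightarrow> emeasure lebesgue (ball (c::'a::euclidean_space) r) = ennreal (unit_ball_vol (real DIM('a)) * r ^ DIM('a))"
  by (simp add: emeasure_ball)

lemma gagliardo_integrand_section_measurable [measurable]:
  fixes u :: "'a::euclidean_space \<Rightarrow> real"
  assumes [measurable]: "u \<in> borel_measurable lebesgue"
  shows "(\<lambda>y. gagliardo_integrand s p u (x, y)) \<in> borel_measurable lebesgue"
  unfolding gagliardo_integrand_def split_beta by simp

lemma energy_eq_nn_integral:
  assumes "u \<in> W_space s p UNIV"
  shows "(\<integral>\<^sup>+x. \<integral>\<^sup>+y. ennreal (gagliardo_integrand s p u (x, y)) \<partial>lebesgue \<partial>lebesgue) = ennreal (energy s p u)"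
proof -
  have [measurable]: "u \<in> borel_measurable lebesgue" using assms by (simp add: W_space_UNIV_iff)
  have "(\<integral>\<^sup>+x. \<integral>\<^sup>+y. ennreal (gagliardo_integrand s p u (x, y)) \<partial>lebesgue \<partial>lebesgue)
    = (\<integral>\<^sup>+z. ennreal (gagliardo_integrand s p u z) \<partial>(lebesgue \<Otimes>\<^sub>M lebesgue))"
    by (subst lebesgue.nn_integral_fst) auto
  also have "\<dots> = ennreal (energy s p u)"
    unfolding energy_def using assms by (intro nn_integral_eq_integral) (auto simp: W_space_UNIV_iff)
  finally show ?thesis .
qed

text \<open>
  If the ball of radius \<open>\<delta>\<close> around \<open>x\<close> has twice the volume that Chebyshev's inequality allows for the set where
  \<open>u > u x / 2\<close>, then on at least half of the ball \<open>u\<close> differs from \<open>u x\<close> by \<open>u x / 2\<close> or more, which forces the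
  nonlocal energy density at \<open>x\<close> to be large.
\<close>

lemma section_energy_lower_bound:
  fixes u :: "'a::euclidean_space \<Rightarrow> real" and \<delta> r s p :: real
  defines "\<omega> \<equiv> unit_ball_vol (real DIM('a))"
  assumes [measurable]: "u \<in> borel_measurable lebesgue"
    and int: "integrable lebesgue (\<lambda>x. \<bar>u x\<bar> powr r)" and r: "0 < r" and p: "0 < p" and s: "0 < s"
    and a: "0 < u x" and d: "0 < \<delta>"
    and eq: "\<omega> * \<delta> ^ DIM('a) = 2 * (2 / u x) powr r * (\<integral>x. \<bar>u x\<bar> powr r \<partial>lebesgue)"
  shows "ennreal (\<omega> / 2 * (u x / 2) powr p * \<delta> powr (- (s * p)))
     \<le> (\<integral>\<^sup>+y. ennreal (gagliardo_integrand s p u (x, y)) \<partial>lebesgue)"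
proof -
  define a where "a = u x"
  have a0: "0 < a" using a by (simp add: a_def)
  define B where "B = {y \<in> space lebesgue. (a / 2) powr r \<le> \<bar>u y\<bar> powr r}"
  define A where "A = {y \<in> ball x \<delta>. u y \<le> a / 2}"
  have "A = ball x \<delta> \<inter> {y \<in> space lebesgue. u y \<le> a / 2}" by (auto simp: A_def)
  also have "\<dots> \<in> sets lebesgue" by (intro sets.Int borel_measurable_le) auto
  finally have [measurable]: "A \<in> sets lebesgue" .
  have [measurable]: "B \<in> sets lebesgue" unfolding B_def by (intro borel_measurable_le) auto
  have \<omega>: "0 < \<omega>" by (simp add: \<omega>_def)
  have sub: "ball x \<delta> \<subseteq> A \<union> B"
  proof
    fix y assume "y \<in> ball x \<delta>"
    then show "y \<in> A \<union> B"
      using a0 r by (cases "u y \<le> a / 2") (auto simp: A_def B_def intro!: powr_mono2)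
  qed
  have fB: "emeasure lebesgue B \<le> ennreal (1 / (a / 2) powr r * (\<integral>x. \<bar>u x\<bar> powr r \<partial>lebesgue))"
    unfolding B_def by (rule integral_Markov_inequality) (use int a0 in auto)
  have "1 / (a / 2) powr r * (\<integral>x. \<bar>u x\<bar> powr r \<partial>lebesgue) = \<omega> * \<delta> ^ DIM('a) / 2"
    using a0 by (simp add: eq a_def[symmetric] powr_divide)
  then have mB: "emeasure lebesgue B \<le> ennreal (\<omega> * \<delta> ^ DIM('a) / 2)" using fB by metis
  have "ennreal (\<omega> * \<delta> ^ DIM('a)) = emeasure lebesgue (ball x \<delta>)"
    using d by (simp add: emeasure_lebesgue_ball \<omega>_def del: emeasure_completion)
  also have "\<dots> \<le> emeasure lebesgue (A \<union> B)"
    by (rule emeasure_mono[OF sub]) measurable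
  also have "\<dots> \<le> emeasure lebesgue A + emeasure lebesgue B"
    by (rule emeasure_subadditive) measurable
  also have "\<dots> \<le> emeasure lebesgue A + ennreal (\<omega> * \<delta> ^ DIM('a) / 2)"
    using mB by (rule add_left_mono)
  finally have *: "ennreal (\<omega> * \<delta> ^ DIM('a)) \<le> emeasure lebesgue A + ennreal (\<omega> * \<delta> ^ DIM('a) / 2)" .
  have mA: "ennreal (\<omega> * \<delta> ^ DIM('a) / 2) \<le> emeasure lebesgue A"
  proof (cases "emeasure lebesgue A" rule: ennreal_cases)
    case (real m)
    have "ennreal (\<omega> * \<delta> ^ DIM('a)) \<le> ennreal (m + \<omega> * \<delta> ^ DIM('a) / 2)"
      using * real \<omega> d by (simp del: emeasure_completion flip: ennreal_plus)
    then have "\<omega> * \<delta> ^ DIM('a) \<le> m + \<omega> * \<delta> ^ DIM('a) / 2"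
      using real \<omega> d by (subst (asm) ennreal_le_iff) (auto intro!: add_nonneg_nonneg)
    then show ?thesis using real by (simp add: ennreal_leI del: emeasure_completion)
  next
    case top
    then show ?thesis by simp
  qed
  let ?c = "(a / 2) powr p / \<delta> powr (real DIM('a) + s * p)"
  have "\<omega> / 2 * (a / 2) powr p * \<delta> powr (- (s * p)) = ?c * (\<omega> * \<delta> ^ DIM('a) / 2)"
    using d by (simp add: powr_add powr_realpow powr_minus field_simps)
  then have "ennreal (\<omega> / 2 * (a / 2) powr p * \<delta> powr (- (s * p))) = ennreal (?c * (\<omega> * \<delta> ^ DIM('a) / 2))"
    by (rule arg_cong)
  also have "\<dots> = ennreal ?c * ennreal (\<omega> * \<delta> ^ DIM('a) / 2)"
    using \<omega> d by (intro ennreal_mult) auto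
  also have "\<dots> \<le> ennreal ?c * emeasure lebesgue A"
    using mA by (rule mult_left_mono) simp
  also have "\<dots> = (\<integral>\<^sup>+y. ennreal ?c * indicator A y \<partial>lebesgue)"
    by (subst nn_integral_cmult_indicator) auto
  also have "\<dots> \<le> (\<integral>\<^sup>+y. ennreal (gagliardo_integrand s p u (x, y)) \<partial>lebesgue)"
  proof (rule nn_integral_mono)
    fix y :: 'a
    show "ennreal ?c * indicator A y \<le> ennreal (gagliardo_integrand s p u (x, y))"
    proof (cases "y \<in> A")
      case True
      then have y: "u y \<le> a / 2" "norm (x - y) < \<delta>" by (auto simp: A_def dist_norm)
      then have "x \<noteq> y" using a0 by (auto simp: a_def)
      then have "?c \<le> \<bar>u x - u y\<bar> powr p / norm (x - y) powr (real DIM('a) + s * p)"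
        using y p s a0 by (intro frac_le powr_mono2) (auto simp: a_def)
      then show ?thesis using True by (simp add: gagliardo_integrand_def ennreal_leI)
    qed auto
  qed
  finally show ?thesis by (simp add: a_def)
qed

text \<open>
  Pointwise form of the embedding, with \<open>\<delta>\<close> the radius of the preceding lemma. If \<open>\<delta> \<le> \<rho>\<close>, the energy
  density controls \<open>u x powr r\<close>; if \<open>\<delta> > \<rho>\<close>, the \<open>L^r\<close> norm bounds the factor
  \<open>u x powr (r / q)\<close> and leaves \<open>u x powr p\<close>. The exponents fit together because \<open>r = p + r / q\<close>.
\<close>

lemma embedding_pointwise:
  fixes u :: "'a::euclidean_space \<Rightarrow> real" and r s p q \<rho> :: real
  defines "\<omega> \<equiv> unit_ball_vol (real DIM('a))"
  defines "c \<equiv> (2 powr (1 + r) / \<omega>) powr (1 / q)"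
  assumes [measurable]: "u \<in> borel_measurable lebesgue" and nonneg: "0 \<le> u x"
    and I: "integrable lebesgue (\<lambda>x. \<bar>u x\<bar> powr r)"
    and p: "0 < p" and s: "0 < s" and q: "1 < q" "real DIM('a) / (s * p) < q" and r: "r = p * q / (q - 1)"
    and rho: "0 < \<rho>" and Ipos: "0 < (\<integral>x. \<bar>u x\<bar> powr r \<partial>lebesgue)"
  shows "ennreal (\<bar>u x\<bar> powr r) \<le> ennreal ((\<integral>x. \<bar>u x\<bar> powr r \<partial>lebesgue) powr (1 / q)) *
     (ennreal (2 powr (p + 1) / \<omega> * c * \<rho> powr (s * p - real DIM('a) / q))
         * (\<integral>\<^sup>+y. ennreal (gagliardo_integrand s p u (x, y)) \<partial>lebesgue)
      + ennreal (c * \<rho> powr (- real DIM('a) / q) * \<bar>u x\<bar> powr p))"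
proof (cases "u x = 0")
  case True
  then show ?thesis by simp
next
  case False
  define n where "n = real DIM('a)"
  define J where "J = (\<integral>x. \<bar>u x\<bar> powr r \<partial>lebesgue)"
  have J: "0 < J" using Ipos by (simp add: J_def)
  define a where "a = u x"
  have a: "0 < a" using False nonneg by (simp add: a_def)
  have \<omega>: "0 < \<omega>" by (simp add: \<omega>_def)
  have n: "0 < n" by (simp add: n_def)
  have r0: "0 < r" using p q by (simp add: r)
  define c0 where "c0 = 2 powr (1 + r) / \<omega>"
  have c0: "0 < c0" using \<omega> by (simp add: c0_def)
  \<comment> \<open>The radius at which the ball has volume \<open>2 * (2 / a) powr r * J\<close>.\<close>
  define \<delta> where "\<delta> = (c0 * a powr (- r) * J) powr (1 / n)"
  have d: "0 < \<delta>" using c0 a J by (simp add: \<delta>_def)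
  have dn: "\<delta> powr n = c0 * a powr (- r) * J" using n c0 a J by (simp add: \<delta>_def powr_powr)
  have key: "c * J powr (1 / q) = \<delta> powr (n / q) * a powr (r / q)"
  proof -
    have "\<delta> powr (n / q) * a powr (r / q) = (\<delta> powr n * a powr r) powr (1 / q)"
      using d a by (simp add: powr_mult powr_powr)
    also have "\<delta> powr n * a powr r = c0 * J"
      using a by (simp add: dn powr_minus)
    finally show ?thesis using c0 J by (simp add: c_def c0_def[symmetric] powr_mult)
  qed
  have ar: "a powr r = a powr p * a powr (r / q)"
  proof -
    have "r = p + r / q" using q by (simp add: r field_simps)
    then show ?thesis by (metis powr_add)
  qed
  show ?thesis
  proof (cases "\<delta> \<le> \<rho>")
    case True
    define K where "K = 2 powr (p + 1) / \<omega> * c * \<rho> powr (s * p - n / q)"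
    have K0: "0 \<le> K" using \<omega> by (simp add: K_def c_def)
    have lb: "ennreal (\<omega> / 2 * (u x / 2) powr p * \<delta> powr (- (s * p)))
       \<le> (\<integral>\<^sup>+y. ennreal (gagliardo_integrand s p u (x, y)) \<partial>lebesgue)"
      unfolding \<omega>_def
    proof (rule section_energy_lower_bound[OF _ I r0 p s])
      have "\<omega> * \<delta> ^ DIM('a) = \<omega> * \<delta> powr n" using d by (simp add: n_def powr_realpow)
      also have "\<dots> = 2 * (2 / a) powr r * J"
        using \<omega> a by (simp add: dn c0_def powr_add powr_divide powr_minus field_simps)
      finally show "unit_ball_vol (real DIM('a)) * \<delta> ^ DIM('a) = 2 * (2 / u x) powr r * (\<integral>x. \<bar>u x\<bar> powr r \<partial>lebesgue)"
        by (simp add: \<omega>_def a_def J_def)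
    qed (use a d in \<open>auto simp: a_def\<close>)
    have kap: "0 < s * p - n / q" using q s p by (simp add: n_def field_simps)
    have "a powr r = a powr r * (\<delta> powr (s * p - n / q) * \<delta> powr (n / q - s * p))"
      using d by (simp flip: powr_add)
    also have "\<dots> \<le> a powr r * (\<rho> powr (s * p - n / q) * \<delta> powr (n / q - s * p))"
      using True d kap by (intro mult_left_mono mult_right_mono powr_mono2) auto
    also have "\<dots> = (\<delta> powr (n / q) * a powr (r / q)) * \<rho> powr (s * p - n / q) * (a powr p * \<delta> powr (- (s * p)))"
      using d by (simp add: ar powr_minus powr_diff field_simps)
    also have "\<dots> = J powr (1 / q) * (K * (\<omega> / 2 * (a / 2) powr p * \<delta> powr (- (s * p))))"
      unfolding key[symmetric] K_def using \<omega> by (simp add: powr_add powr_divide a less_imp_le field_simps)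
    finally have "ennreal (a powr r) \<le> ennreal (J powr (1 / q)) * (ennreal K * ennreal (\<omega> / 2 * (a / 2) powr p * \<delta> powr (- (s * p))))"
      using K0 \<omega> by (simp flip: ennreal_mult add: ennreal_leI)
    also have "\<dots> \<le> ennreal (J powr (1 / q)) * (ennreal K * (\<integral>\<^sup>+y. ennreal (gagliardo_integrand s p u (x, y)) \<partial>lebesgue))"
      using lb by (intro mult_left_mono) (auto simp: a_def)
    also have "\<dots> \<le> ennreal (J powr (1 / q)) * (ennreal K * (\<integral>\<^sup>+y. ennreal (gagliardo_integrand s p u (x, y)) \<partial>lebesgue)
        + ennreal (c * \<rho> powr (- real DIM('a) / q) * \<bar>u x\<bar> powr p))"
      by (intro mult_left_mono) auto
    finally show ?thesis using a by (simp add: J_def a_def K_def n_def)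
  next
    case False
    then have "\<delta> powr (n / q) * \<rho> powr (- (n / q)) \<ge> \<rho> powr (n / q) * \<rho> powr (- (n / q))"
      using rho n q by (intro mult_right_mono powr_mono2) auto
    then have ge1: "1 \<le> \<delta> powr (n / q) * \<rho> powr (- (n / q))"
      using rho by (simp flip: powr_add)
    have "a powr r \<le> a powr r * (\<delta> powr (n / q) * \<rho> powr (- (n / q)))"
      using mult_left_mono[OF ge1, of "a powr r"] by simp
    also have "\<dots> = J powr (1 / q) * (c * \<rho> powr (- (n / q)) * a powr p)"
      using key by (simp add: ar mult_ac)
    finally have "ennreal (a powr r) \<le> ennreal (J powr (1 / q)) * ennreal (c * \<rho> powr (- (n / q)) * a powr p)"
      by (simp flip: ennreal_mult' add: ennreal_leI)
    also have "\<dots> \<le> ennreal (J powr (1 / q)) * (ennreal (2 powr (p + 1) / \<omega> * c * \<rho> powr (s * p - real DIM('a) / q))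
         * (\<integral>\<^sup>+y. ennreal (gagliardo_integrand s p u (x, y)) \<partial>lebesgue)
         + ennreal (c * \<rho> powr (- (n / q)) * a powr p))"
      by (intro mult_left_mono) auto
    finally show ?thesis using a by (simp add: J_def a_def n_def)
  qed
qed

lemma energy_mono:
  assumes p: "0 < p" and u: "u \<in> W_space s p UNIV" and w: "w \<in> W_space s p UNIV"
    and le: "\<And>x y. \<bar>w x - w y\<bar> \<le> \<bar>u x - u y\<bar>"
  shows "energy s p w \<le> energy s p u"
  unfolding energy_def
proof (rule integral_mono)
  show "gagliardo_integrand s p w z \<le> gagliardo_integrand s p u z" for z
    unfolding gagliardo_integrand_def split_beta using p le by (intro divide_right_mono powr_mono2) auto
qed (use u w in \<open>auto simp: W_space_UNIV_iff\<close>)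

lemma embedding_integrable:
  fixes u :: "'a::euclidean_space \<Rightarrow> real" and r s p q \<rho> :: real
  defines "\<omega> \<equiv> unit_ball_vol (real DIM('a))"
  defines "c \<equiv> (2 powr (1 + r) / \<omega>) powr (1 / q)"
  assumes u: "u \<in> W_space s p UNIV" and nonneg: "\<And>x. 0 \<le> u x"
    and I: "integrable lebesgue (\<lambda>x. \<bar>u x\<bar> powr r)"
    and p: "0 < p" and s: "0 < s" and q: "1 < q" "real DIM('a) / (s * p) < q" and r: "r = p * q / (q - 1)"
    and rho: "0 < \<rho>"
  shows "(\<integral>x. \<bar>u x\<bar> powr r \<partial>lebesgue) powr (1 - 1 / q)
     \<le> 2 powr (p + 1) / \<omega> * c * \<rho> powr (s * p - real DIM('a) / q) * energy s p u
      + c * \<rho> powr (- real DIM('a) / q) * (\<integral>x. \<bar>u x\<bar> powr p \<partial>lebesgue)"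
proof -
  define J where "J = (\<integral>x. \<bar>u x\<bar> powr r \<partial>lebesgue)"
  define K1 where "K1 = 2 powr (p + 1) / \<omega> * c * \<rho> powr (s * p - real DIM('a) / q)"
  define K2 where "K2 = c * \<rho> powr (- real DIM('a) / q)"
  define P where "P = (\<integral>x. \<bar>u x\<bar> powr p \<partial>lebesgue)"
  have K: "0 \<le> K1" "0 \<le> K2" by (auto simp: K1_def K2_def c_def \<omega>_def)
  have P: "0 \<le> P" by (simp add: P_def)
  have [measurable]: "u \<in> borel_measurable lebesgue" and intp: "integrable lebesgue (\<lambda>x. \<bar>u x\<bar> powr p)"
    using u by (auto simp: W_space_UNIV_iff)
  have "J powr (1 - 1 / q) \<le> K1 * energy s p u + K2 * P"
  proof (cases "0 < J")
    case False
    moreover have "0 \<le> J" by (simp add: J_def)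
    ultimately have "J = 0" by simp
    then show ?thesis using K P by simp
  next
    case True
    have [measurable]: "(\<lambda>x. \<integral>\<^sup>+y. ennreal (gagliardo_integrand s p u (x, y)) \<partial>lebesgue) \<in> borel_measurable lebesgue"
      by (rule lebesgue.borel_measurable_nn_integral_fst) measurable
    have "ennreal J = (\<integral>\<^sup>+x. ennreal (\<bar>u x\<bar> powr r) \<partial>lebesgue)"
      unfolding J_def using I by (intro nn_integral_eq_integral[symmetric]) auto
    also have "\<dots> \<le> (\<integral>\<^sup>+x. ennreal (J powr (1 / q)) * (ennreal K1 * (\<integral>\<^sup>+y. ennreal (gagliardo_integrand s p u (x, y)) \<partial>lebesgue)
        + ennreal (K2 * \<bar>u x\<bar> powr p)) \<partial>lebesgue)"
      unfolding K1_def K2_def c_def \<omega>_def J_def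
      by (intro nn_integral_mono embedding_pointwise)
        (use nonneg I p s q r rho True in \<open>auto simp: J_def\<close>)
    also have "\<dots> = ennreal (J powr (1 / q)) * (ennreal K1 * (\<integral>\<^sup>+x. \<integral>\<^sup>+y. ennreal (gagliardo_integrand s p u (x, y)) \<partial>lebesgue \<partial>lebesgue)
        + (\<integral>\<^sup>+x. ennreal (K2 * \<bar>u x\<bar> powr p) \<partial>lebesgue))"
      by (simp add: nn_integral_cmult nn_integral_add)
    also have "(\<integral>\<^sup>+x. ennreal (K2 * \<bar>u x\<bar> powr p) \<partial>lebesgue) = ennreal (K2 * P)"
      using K intp by (subst nn_integral_eq_integral) (auto simp: P_def)
    also have "ennreal (J powr (1 / q)) * (ennreal K1 * (\<integral>\<^sup>+x. \<integral>\<^sup>+y. ennreal (gagliardo_integrand s p u (x, y)) \<partial>lebesgue \<partial>lebesgue) + ennreal (K2 * P))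
      = ennreal (J powr (1 / q) * (K1 * energy s p u + K2 * P))"
      unfolding energy_eq_nn_integral[OF u] using K P by (simp add: ennreal_mult ennreal_plus)
    finally have "J \<le> J powr (1 / q) * (K1 * energy s p u + K2 * P)"
      using K P by (subst (asm) ennreal_le_iff) auto
    moreover have "J = J powr (1 / q) * J powr (1 - 1 / q)"
      using True by (simp flip: powr_add)
    ultimately have "J powr (1 / q) * J powr (1 - 1 / q) \<le> J powr (1 / q) * (K1 * energy s p u + K2 * P)" by simp
    then show ?thesis using True by simp
  qed
  then show ?thesis by (simp add: J_def K1_def K2_def P_def)
qed

text \<open>
  The subcritical Sobolev embedding into \<open>L^r\<close> with \<open>r = p q / (q - 1)\<close>, in a form in which the energy enters with
  an arbitrarily small constant. A priori finiteness of the \<open>L^r\<close> norm is obtained by truncation.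
\<close>

theorem fractional_embedding:
  fixes s p q \<epsilon> :: real
  assumes p: "1 < p" and s: "0 < s" and q: "1 < q" "real DIM('a::euclidean_space) / (s * p) < q"
    and eps: "0 < \<epsilon>"
  obtains C where "0 \<le> C"
    "\<And>u :: 'a \<Rightarrow> real. u \<in> W_space s p UNIV \<Longrightarrow> integrable lebesgue (\<lambda>x. \<bar>u x\<bar> powr (p * q / (q - 1)))"
    "\<And>u :: 'a \<Rightarrow> real. u \<in> W_space s p UNIV \<Longrightarrow> (\<integral>x. \<bar>u x\<bar> powr (p * q / (q - 1)) \<partial>lebesgue) powr (1 - 1 / q)
       \<le> \<epsilon> * energy s p u + C * (\<integral>x. \<bar>u x\<bar> powr p \<partial>lebesgue)"
proof -
  define \<omega> where "\<omega> = unit_ball_vol (real DIM('a))"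
  define r where "r = p * q / (q - 1)"
  define c where "c = (2 powr (1 + r) / \<omega>) powr (1 / q)"
  define \<kappa> where "\<kappa> = s * p - real DIM('a) / q"
  have kap: "0 < \<kappa>" using q s p by (simp add: \<kappa>_def field_simps)
  define K where "K = 2 powr (p + 1) / \<omega> * c"
  have "0 < \<omega>" by (simp add: \<omega>_def)
  then have K: "0 < K" by (simp add: K_def c_def)
  \<comment> \<open>Chosen so that the coefficient of the energy becomes \<open>\<epsilon>\<close>.\<close>
  define \<rho> where "\<rho> = (\<epsilon> / K) powr (1 / \<kappa>)"
  have rho: "0 < \<rho>" using K eps by (simp add: \<rho>_def)
  have rk: "\<rho> powr \<kappa> = \<epsilon> / K" using K eps kap by (simp add: \<rho>_def powr_powr)
  define C where "C = c * \<rho> powr (- real DIM('a) / q)"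
  have C: "0 \<le> C" by (simp add: C_def c_def)
  have rp: "p < r" using p q by (simp add: r_def field_simps)
  have main: "integrable lebesgue (\<lambda>x. \<bar>u x\<bar> powr r) \<and>
     (\<integral>x. \<bar>u x\<bar> powr r \<partial>lebesgue) \<le> (\<epsilon> * energy s p u + C * (\<integral>x. \<bar>u x\<bar> powr p \<partial>lebesgue)) powr (q / (q - 1))"
    if u: "u \<in> W_space s p UNIV" for u :: "'a \<Rightarrow> real"
  proof -
    have [measurable]: "u \<in> borel_measurable lebesgue" and intp: "integrable lebesgue (\<lambda>x. \<bar>u x\<bar> powr p)"
      using u by (auto simp: W_space_UNIV_iff)
    define R where "R = \<epsilon> * energy s p u + C * (\<integral>x. \<bar>u x\<bar> powr p \<partial>lebesgue)"
    define v where "v = (\<lambda>k::nat. \<lambda>x. min \<bar>u x\<bar> (real k))"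
    have [measurable]: "v k \<in> borel_measurable lebesgue" for k unfolding v_def by measurable
    have vdiff: "\<bar>v k x - v k y\<bar> \<le> \<bar>u x - u y\<bar>" for k x y
      unfolding v_def by (simp add: min_def abs_if)
    have vW: "v k \<in> W_space s p UNIV" for k
    proof (rule W_space_dominated[OF _ u u, where A = 1])
      show "\<bar>v k x - v k y\<bar> \<le> 1 * (\<bar>u x - u y\<bar> + \<bar>u x - u y\<bar>)" for x y
        using vdiff[of k x y] abs_ge_zero[of "u x - u y"] unfolding mult_1 by linarith
    qed (use p in \<open>auto simp: v_def\<close>)
    have v_int: "integrable lebesgue (\<lambda>x. \<bar>v k x\<bar> powr r)" for k
    proof (rule Bochner_Integration.integrable_bound)
      show "integrable lebesgue (\<lambda>x. real k powr (r - p) * \<bar>u x\<bar> powr p)" using intp by simp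
      show "AE x in lebesgue. norm (\<bar>v k x\<bar> powr r) \<le> norm (real k powr (r - p) * \<bar>u x\<bar> powr p)"
      proof (rule AE_I2)
        fix x
        have "\<bar>v k x\<bar> powr r = \<bar>v k x\<bar> powr (r - p) * \<bar>v k x\<bar> powr p" by (simp flip: powr_add)
        also have "\<dots> \<le> real k powr (r - p) * \<bar>u x\<bar> powr p"
          using rp p by (intro mult_mono powr_mono2) (auto simp: v_def)
        finally show "norm (\<bar>v k x\<bar> powr r) \<le> norm (real k powr (r - p) * \<bar>u x\<bar> powr p)" by simp
      qed
    qed measurable
    have v_le: "(\<integral>x. \<bar>v k x\<bar> powr r \<partial>lebesgue) \<le> R powr (q / (q - 1))" for k
    proof -
      have "(\<integral>x. \<bar>v k x\<bar> powr r \<partial>lebesgue) powr (1 - 1 / q)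
        \<le> K * \<rho> powr \<kappa> * energy s p (v k) + C * (\<integral>x. \<bar>v k x\<bar> powr p \<partial>lebesgue)"
        unfolding K_def \<kappa>_def C_def c_def \<omega>_def
        by (rule embedding_integrable[OF vW _ v_int]) (use p s q rho in \<open>auto simp: v_def r_def\<close>)
      also have "\<dots> \<le> \<epsilon> * energy s p u + C * (\<integral>x. \<bar>u x\<bar> powr p \<partial>lebesgue)"
      proof (intro add_mono mult_left_mono)
        show "K * \<rho> powr \<kappa> * energy s p (v k) \<le> \<epsilon> * energy s p u"
          using K eps energy_mono[OF _ u vW vdiff] p by (simp add: rk)
        show "(\<integral>x. \<bar>v k x\<bar> powr p \<partial>lebesgue) \<le> (\<integral>x. \<bar>u x\<bar> powr p \<partial>lebesgue)"
          using vW[of k] intp p by (intro integral_mono) (auto simp: W_space_UNIV_iff v_def intro!: powr_mono2)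
      qed (use C in auto)
      finally have "(\<integral>x. \<bar>v k x\<bar> powr r \<partial>lebesgue) powr (1 - 1 / q) \<le> R" by (simp add: R_def)
      then have "((\<integral>x. \<bar>v k x\<bar> powr r \<partial>lebesgue) powr (1 - 1 / q)) powr (q / (q - 1)) \<le> R powr (q / (q - 1))"
        using q by (intro powr_mono2) auto
      moreover have "(1 - 1 / q) * (q / (q - 1)) = 1" using q by (simp add: field_simps)
      ultimately show ?thesis by (simp only: powr_powr) simp
    qed
    show ?thesis unfolding R_def[symmetric]
    proof (rule fatou_bounded[where h = "\<lambda>k x. \<bar>v k x\<bar> powr r"])
      show "AE x in lebesgue. (\<lambda>k. \<bar>v k x\<bar> powr r) \<longlonglongrightarrow> \<bar>u x\<bar> powr r"
      proof (rule AE_I2, rule tendsto_eventually)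
        fix x
        obtain N :: nat where "\<bar>u x\<bar> \<le> real N" using real_arch_simple by blast
        then have "\<bar>v k x\<bar> powr r = \<bar>u x\<bar> powr r" if "k \<ge> N" for k
          using that by (simp add: v_def min_def)
        then show "\<forall>\<^sub>F k in sequentially. \<bar>v k x\<bar> powr r = \<bar>u x\<bar> powr r"
          by (auto simp: eventually_sequentially)
      qed
    qed (use v_int v_le in auto)
  qed
  show ?thesis
  proof
    show "0 \<le> C" by (rule C)
  next
    fix u :: "'a \<Rightarrow> real" assume u: "u \<in> W_space s p UNIV"
    show "integrable lebesgue (\<lambda>x. \<bar>u x\<bar> powr (p * q / (q - 1)))"
      using main[OF u] by (simp add: r_def)
    let ?R = "\<epsilon> * energy s p u + C * (\<integral>x. \<bar>u x\<bar> powr p \<partial>lebesgue)"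
    have R: "0 \<le> ?R" using C eps by simp
    have "(\<integral>x. \<bar>u x\<bar> powr r \<partial>lebesgue) powr (1 - 1 / q) \<le> (?R powr (q / (q - 1))) powr (1 - 1 / q)"
      using main[OF u] q by (intro powr_mono2) auto
    also have "\<dots> = ?R"
    proof -
      have "(q / (q - 1)) * (1 - 1 / q) = 1" using q by (simp add: field_simps)
      then show ?thesis using R by (simp only: powr_powr) simp
    qed
    finally show "(\<integral>x. \<bar>u x\<bar> powr (p * q / (q - 1)) \<partial>lebesgue) powr (1 - 1 / q) \<le> ?R"
      by (simp only: r_def)
  qed
qed

section \<open>Tent functions of finite energy\<close>

lemma nn_integral_lebesgue_reflect_shift:
  fixes k :: "'a::euclidean_space \<Rightarrow> ennreal"
  assumes [measurable]: "k \<in> borel_measurable borel" and even: "\<And>z. k (- z) = k z"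
  shows "(\<integral>\<^sup>+y. k (x - y) \<partial>lebesgue) = (\<integral>\<^sup>+z. k z \<partial>lborel)"
proof -
  have "(\<integral>\<^sup>+y. k (x - y) \<partial>lebesgue) = (\<integral>\<^sup>+y. k (- x + y) \<partial>lborel)"
    unfolding nn_integral_completion
  proof (rule nn_integral_cong)
    show "k (x - y) = k (- x + y)" for y using even[of "x - y"] by simp
  qed
  also have "\<dots> = (\<integral>\<^sup>+z. k z \<partial>distr lborel borel ((+) (- x)))"
    by (subst nn_integral_distr) auto
  also have "\<dots> = (\<integral>\<^sup>+z. k z \<partial>lborel)" by (simp add: lborel_distr_plus)
  finally show ?thesis .
qed

lemma dyadic_bracket:
  fixes t :: real assumes "1 \<le> t"
  obtains j :: nat where "2 ^ j \<le> t" "t < 2 ^ Suc j"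
proof -
  obtain N :: nat where "t < 2 ^ N" using real_arch_pow[of 2 t] by auto
  define m where "m = (LEAST N. t < (2::real) ^ N)"
  have m: "t < 2 ^ m" unfolding m_def by (rule LeastI[of _ N]) fact
  have "m \<noteq> 0" using m assms by (cases m) auto
  then obtain j where j: "m = Suc j" using not0_implies_Suc by blast
  have "\<not> t < 2 ^ j" using not_less_Least[of j "\<lambda>N. t < (2::real) ^ N"] j by (simp add: m_def)
  then show ?thesis using that[of j] m j by simp
qed

lemma le_suminf_ennreal: "f j \<le> (\<Sum>j. f j :: ennreal)"
  using sum_le_suminf[of f "{j}"] by simp

text \<open>
  The kernel is dominated by step functions on dyadic balls; the resulting geometric series converge near the
  origin because \<open>s < 1\<close> and at infinity because \<open>0 < s\<close>.
\<close>

lemma truncated_kernel_integrable: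
  fixes s p :: real
  assumes s: "0 < s" "s < 1" and p: "1 < p"
  shows "(\<integral>\<^sup>+z. ennreal ((min (norm z) 1) powr p / norm z powr (real DIM('a) + s * p)) \<partial>(lborel :: 'a::euclidean_space measure)) < \<infinity>"
proof -
  define n where "n = real DIM('a)"
  define e where "e = n + s * p"
  have n: "0 < n" by (simp add: n_def)
  have e: "0 < e" using s p n by (simp add: e_def add_pos_pos)
  define \<omega> where "\<omega> = unit_ball_vol n"
  have \<omega>: "0 < \<omega>" using n by (simp add: \<omega>_def)
  define h :: "nat \<Rightarrow> real" where "h = (\<lambda>j. 2 powr (- real j))"
  define a :: "nat \<Rightarrow> real" where "a = (\<lambda>j. h j powr p / h (Suc j) powr e)"
  define b :: "nat \<Rightarrow> real" where "b = (\<lambda>j. h j powr e)"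
  let ?k = "\<lambda>z::'a. (min (norm z) 1) powr p / norm z powr e"
  let ?A = "\<lambda>j. cball (0::'a) (h j)" and ?B = "\<lambda>j. cball (0::'a) (2 powr (real j + 1))"
  have hpos: "0 < h j" for j by (simp add: h_def)
  have ab: "0 \<le> a j" "0 \<le> b j" for j by (auto simp: a_def b_def)
  have pt: "ennreal (?k z) \<le> (\<Sum>j. ennreal (a j) * indicator (?A j) z) + (\<Sum>j. ennreal (b j) * indicator (?B j) z)" for z
  proof -
    consider "z = 0" | "0 < norm z" "norm z < 1" | "1 \<le> norm z" by force
    then show ?thesis
    proof cases
      case 1
      then show ?thesis by (simp add: n_def)
    next
      case 2
      then have "1 \<le> 1 / norm z" by simp
      then obtain j where j: "2 ^ j \<le> 1 / norm z" "1 / norm z < 2 ^ Suc j" by (rule dyadic_bracket)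
      have hj: "h j = 1 / 2 ^ j" "h (Suc j) = 1 / 2 ^ Suc j"
        by (simp_all add: h_def powr_minus powr_realpow powr_add field_simps)
      have le: "norm z \<le> h j" "h (Suc j) \<le> norm z"
        using j 2 unfolding hj by (auto simp: field_simps)
      have "?k z \<le> a j"
        unfolding a_def using le 2 hpos[of "Suc j"] e p by (intro frac_le powr_mono2) auto
      then have "ennreal (?k z) \<le> ennreal (a j) * indicator (?A j) z"
        using le by (simp add: ennreal_leI)
      also have "\<dots> \<le> (\<Sum>j. ennreal (a j) * indicator (?A j) z)"
        by (rule le_suminf_ennreal)
      finally show ?thesis by (rule order_trans) simp
    next
      case 3
      then obtain j where j: "2 ^ j \<le> norm z" "norm z < 2 ^ Suc j" by (rule dyadic_bracket)
      have hj: "h j = 1 / 2 ^ j" by (simp add: h_def powr_minus powr_realpow field_simps)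
      have "?k z = 1 / norm z powr e" using 3 by (simp add: min_def)
      also have "\<dots> \<le> 1 / (2 ^ j) powr e" using j e by (intro frac_le powr_mono2) auto
      also have "\<dots> = b j" by (simp add: b_def hj powr_divide)
      finally have "ennreal (?k z) \<le> ennreal (b j) * indicator (?B j) z"
        using j by (simp add: ennreal_leI powr_add powr_realpow)
      also have "\<dots> \<le> (\<Sum>j. ennreal (b j) * indicator (?B j) z)"
        by (rule le_suminf_ennreal)
      finally show ?thesis by (rule order_trans) simp
    qed
  qed
  have geo: "(\<Sum>j. ennreal (C * \<theta> ^ j)) < \<infinity>" if "0 \<le> C" "0 \<le> \<theta>" "\<theta> < 1" for C \<theta> :: real
  proof -
    have "summable (\<lambda>j. C * \<theta> ^ j)" using that by (intro summable_mult summable_geometric) auto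
    then have "(\<Sum>j. ennreal (C * \<theta> ^ j)) = ennreal (\<Sum>j. C * \<theta> ^ j)"
      using that by (intro suminf_ennreal2) auto
    then show ?thesis by simp
  qed
  have A: "ennreal (a j) * emeasure lborel (?A j) = ennreal (\<omega> * 2 powr e * (2 powr (- (p - s * p))) ^ j)" for j
  proof -
    have "ennreal (a j) * emeasure lborel (?A j) = ennreal (a j * (\<omega> * h j powr n))"
      using hpos[of j] ab \<omega> by (simp add: emeasure_cball ennreal_mult \<omega>_def n_def powr_realpow)
    also have "a j * (\<omega> * h j powr n) = \<omega> * 2 powr e * (2 powr (- (p - s * p))) ^ j"
      by (simp add: a_def h_def powr_powr e_def field_simps flip: powr_add powr_diff powr_realpow)
    finally show ?thesis .
  qed
  have B: "ennreal (b j) * emeasure lborel (?B j) = ennreal (\<omega> * 2 powr n * (2 powr (- (s * p))) ^ j)" for j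
  proof -
    have "ennreal (b j) * emeasure lborel (?B j) = ennreal (b j * (\<omega> * (2 powr (real j + 1)) powr n))"
      using ab \<omega> by (simp add: emeasure_cball ennreal_mult \<omega>_def n_def flip: powr_realpow)
    also have "b j * (\<omega> * (2 powr (real j + 1)) powr n) = \<omega> * 2 powr n * (2 powr (- (s * p))) ^ j"
      by (simp add: b_def h_def powr_powr e_def field_simps flip: powr_add powr_diff powr_realpow)
    finally show ?thesis .
  qed
  have [measurable]: "cball (0::'a) r \<in> sets borel" for r by simp
  have "(\<integral>\<^sup>+z. ennreal (?k z) \<partial>lborel)
     \<le> (\<integral>\<^sup>+z. (\<Sum>j. ennreal (a j) * indicator (?A j) z) + (\<Sum>j. ennreal (b j) * indicator (?B j) z) \<partial>lborel)"
    by (intro nn_integral_mono pt)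
  also have "\<dots> = (\<Sum>j. ennreal (a j) * emeasure lborel (?A j)) + (\<Sum>j. ennreal (b j) * emeasure lborel (?B j))"
  proof (subst nn_integral_add)
    have "(\<integral>\<^sup>+z. (\<Sum>j. ennreal (c j) * indicator (cball (0::'a) (d j)) z) \<partial>lborel) = (\<Sum>j. ennreal (c j) * emeasure lborel (cball (0::'a) (d j)))" for c d :: "nat \<Rightarrow> real"
    proof -
      have "(\<integral>\<^sup>+z. (\<Sum>j. ennreal (c j) * indicator (cball (0::'a) (d j)) z) \<partial>lborel) = (\<Sum>j. \<integral>\<^sup>+z. ennreal (c j) * indicator (cball (0::'a) (d j)) z \<partial>lborel)"
        by (rule nn_integral_suminf) measurable
      also have "\<dots> = (\<Sum>j. ennreal (c j) * emeasure lborel (cball (0::'a) (d j)))"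
        by (intro arg_cong[where f = suminf] ext nn_integral_cmult_indicator) simp
      finally show ?thesis .
    qed
    then show "(\<integral>\<^sup>+z. (\<Sum>j. ennreal (a j) * indicator (?A j) z) \<partial>lborel) + (\<integral>\<^sup>+z. (\<Sum>j. ennreal (b j) * indicator (?B j) z) \<partial>lborel)
       = (\<Sum>j. ennreal (a j) * emeasure lborel (?A j)) + (\<Sum>j. ennreal (b j) * emeasure lborel (?B j))"
      by (simp only:)
  qed measurable
  also have "\<dots> < \<infinity>"
  proof -
    have "2 powr (- (p - s * p)) < (1::real)" "2 powr (- (s * p)) < (1::real)"
      using s p powr_less_mono[of _ 0 "2::real"] by auto
    then show ?thesis unfolding A B using geo \<omega> by (auto simp: less_top)
  qed
  finally show ?thesis by (simp add: e_def n_def)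
qed

text \<open>
  Tent functions serve as test functions: Lipschitz functions with compact support have finite energy.
\<close>

lemma tent_in_W_space:
  fixes x0 :: "'a::euclidean_space" and s p R :: real
  assumes s: "0 < s" "s < 1" and p: "1 < p" and R: "0 < R" "R \<le> 1"
  shows "(\<lambda>x. max 0 (R - dist x x0)) \<in> W_space s p UNIV"
proof -
  define \<phi> where "\<phi> = (\<lambda>x::'a. max 0 (R - dist x x0))"
  define k where "k = (\<lambda>z::'a. ennreal ((min (norm z) 1) powr p / norm z powr (real DIM('a) + s * p)))"
  have [measurable]: "k \<in> borel_measurable borel" unfolding k_def by measurable
  have k_even: "k (- z) = k z" for z by (simp add: k_def)
  define K where "K = (\<integral>\<^sup>+z. k z \<partial>lborel)"
  have K: "K < \<infinity>" unfolding K_def k_def by (rule truncated_kernel_integrable[OF s p])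
  have [measurable]: "\<phi> \<in> borel_measurable lebesgue" unfolding \<phi>_def by measurable
  let ?B = "ball x0 R"
  have zero: "\<phi> x = 0" if "x \<notin> ?B" for x using that by (simp add: \<phi>_def dist_commute)
  have range: "0 \<le> \<phi> x" "\<phi> x \<le> 1" for x
    unfolding \<phi>_def by (simp, rule max.boundedI) (use R zero_le_dist[of x x0] in linarith)+
  have lip: "\<bar>\<phi> x - \<phi> y\<bar> \<le> norm (x - y)" for x y
    using dist_triangle[of x x0 y] dist_triangle[of y x0 x] by (auto simp: \<phi>_def max_def dist_norm norm_minus_commute)
  have pt: "ennreal (gagliardo_integrand s p \<phi> (x, y)) \<le> indicator ?B x * k (x - y) + indicator ?B y * k (x - y)" for x y
  proof (cases "x \<in> ?B \<or> y \<in> ?B")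
    case True
    have "\<bar>\<phi> x - \<phi> y\<bar> \<le> 1" using range[of x] range[of y] by linarith
    then have "gagliardo_integrand s p \<phi> (x, y) \<le> (min (norm (x - y)) 1) powr p / norm (x - y) powr (real DIM('a) + s * p)"
      unfolding gagliardo_integrand_def split_beta using lip[of x y] p by (auto intro!: divide_right_mono powr_mono2)
    then have "ennreal (gagliardo_integrand s p \<phi> (x, y)) \<le> k (x - y)"
      by (simp add: k_def ennreal_leI)
    with True show ?thesis by (auto simp: indicator_def intro: add_increasing2)
  next
    case False
    then show ?thesis using zero[of x] zero[of y] by (simp add: gagliardo_integrand_def)
  qed
  have km [measurable]: "(\<lambda>z. k (fst z - snd z)) \<in> borel_measurable (lebesgue \<Otimes>\<^sub>M lebesgue)" by measurable
  have [measurable]: "?B \<in> sets lebesgue" by simp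
  have 1: "(\<integral>\<^sup>+z. indicator ?B (fst z) * k (fst z - snd z) \<partial>(lebesgue \<Otimes>\<^sub>M lebesgue)) = K * emeasure lebesgue ?B"
  proof -
    have "(\<integral>\<^sup>+z. indicator ?B (fst z) * k (fst z - snd z) \<partial>(lebesgue \<Otimes>\<^sub>M lebesgue))
      = (\<integral>\<^sup>+x. \<integral>\<^sup>+y. indicator ?B x * k (x - y) \<partial>lebesgue \<partial>lebesgue)"
      by (subst lebesgue.nn_integral_fst[symmetric]) auto
    also have "\<dots> = (\<integral>\<^sup>+x. K * indicator ?B x \<partial>lebesgue)"
    proof (rule nn_integral_cong)
      fix x :: 'a
      have "(\<lambda>y. k (x - y)) \<in> borel_measurable lebesgue" by measurable
      then have "(\<integral>\<^sup>+y. indicator ?B x * k (x - y) \<partial>lebesgue) = indicator ?B x * (\<integral>\<^sup>+y. k (x - y) \<partial>lebesgue)"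
        by (rule nn_integral_cmult)
      then show "(\<integral>\<^sup>+y. indicator ?B x * k (x - y) \<partial>lebesgue) = K * indicator ?B x"
        by (simp add: nn_integral_lebesgue_reflect_shift[of k, OF _ k_even] K_def mult.commute)
    qed
    also have "\<dots> = K * emeasure lebesgue ?B" by (rule nn_integral_cmult_indicator) simp
    finally show ?thesis .
  qed
  have 2: "(\<integral>\<^sup>+z. indicator ?B (snd z) * k (fst z - snd z) \<partial>(lebesgue \<Otimes>\<^sub>M lebesgue)) = K * emeasure lebesgue ?B"
  proof -
    have "(\<integral>\<^sup>+z. indicator ?B (snd z) * k (fst z - snd z) \<partial>(lebesgue \<Otimes>\<^sub>M lebesgue))
      = (\<integral>\<^sup>+y. \<integral>\<^sup>+x. indicator ?B y * k (x - y) \<partial>lebesgue \<partial>lebesgue)"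
      by (subst lebesgue_pair.nn_integral_snd[symmetric]) auto
    also have "\<dots> = (\<integral>\<^sup>+y. K * indicator ?B y \<partial>lebesgue)"
    proof (rule nn_integral_cong)
      fix y :: 'a
      have "(\<lambda>x. k (x - y)) \<in> borel_measurable lebesgue" by measurable
      then have "(\<integral>\<^sup>+x. indicator ?B y * k (x - y) \<partial>lebesgue) = indicator ?B y * (\<integral>\<^sup>+x. k (x - y) \<partial>lebesgue)"
        by (rule nn_integral_cmult)
      moreover have "(\<integral>\<^sup>+x. k (x - y) \<partial>lebesgue) = (\<integral>\<^sup>+x. k (y - x) \<partial>lebesgue)"
        by (rule nn_integral_cong) (use k_even in \<open>metis minus_diff_eq\<close>)
      ultimately show "(\<integral>\<^sup>+x. indicator ?B y * k (x - y) \<partial>lebesgue) = K * indicator ?B y"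
        by (simp add: nn_integral_lebesgue_reflect_shift[of k, OF _ k_even] K_def mult.commute)
    qed
    also have "\<dots> = K * emeasure lebesgue ?B" by (rule nn_integral_cmult_indicator) simp
    finally show ?thesis .
  qed
  have Bfin: "emeasure lebesgue ?B < \<infinity>" using R by (simp add: emeasure_lebesgue_ball del: emeasure_completion)
  have "(\<integral>\<^sup>+z. ennreal (gagliardo_integrand s p \<phi> z) \<partial>(lebesgue \<Otimes>\<^sub>M lebesgue))
     \<le> (\<integral>\<^sup>+z. indicator ?B (fst z) * k (fst z - snd z) + indicator ?B (snd z) * k (fst z - snd z) \<partial>(lebesgue \<Otimes>\<^sub>M lebesgue))"
    using pt by (intro nn_integral_mono) (metis prod.collapse)
  also have "\<dots> = K * emeasure lebesgue ?B + K * emeasure lebesgue ?B"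
    by (subst nn_integral_add) (auto simp: 1 2)
  also have "\<dots> < \<infinity>" using K Bfin by (simp add: ennreal_mult_less_top del: emeasure_completion)
  finally have "integrable (lebesgue \<Otimes>\<^sub>M lebesgue) (gagliardo_integrand s p \<phi>)"
    by (simp add: integrable_iff_bounded)
  moreover have "integrable lebesgue (\<lambda>x. \<bar>\<phi> x\<bar> powr p)"
  proof (rule Bochner_Integration.integrable_bound[where f = "indicator ?B :: 'a \<Rightarrow> real"])
    show "integrable lebesgue (indicator ?B :: 'a \<Rightarrow> real)"
      using Bfin by (intro integrable_real_indicator) (auto simp del: emeasure_completion)
    show "AE x in lebesgue. norm (\<bar>\<phi> x\<bar> powr p) \<le> norm (indicator ?B x :: real)"
      using range zero p by (intro AE_I2) (auto simp: indicator_def powr_le1)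
  qed measurable
  ultimately show ?thesis by (simp add: W_space_UNIV_iff flip: \<phi>_def)
qed

section \<open>Compactness\<close>

text \<open>
  The value of \<open>w\<close> at a point of a ball differs from its mean over the ball by an amount that the energy density
  controls. The elementary inequality \<open>t \<le> \<eta> + \<eta> powr (1 - p) * t powr p\<close> replaces the use of Jensen's inequality.
\<close>

lemma oscillation_bound:
  fixes w :: "'a::euclidean_space \<Rightarrow> real" and s p h \<eta> :: real and t x :: 'a
  defines "m \<equiv> unit_ball_vol (real DIM('a)) * h ^ DIM('a)"
  assumes p: "1 < p" and s: "0 < s" and h: "0 < h" and eta: "0 < \<eta>"
    and [measurable]: "w \<in> borel_measurable lebesgue" and w: "integrable lebesgue w"
    and x: "x \<in> ball t h"
  shows "ennreal \<bar>w x\<bar> \<le> ennreal \<eta> + ennreal (\<eta> powr (1 - p) * (2 * h) powr (real DIM('a) + s * p) / m)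
      * (\<integral>\<^sup>+y. ennreal (gagliardo_integrand s p w (x, y)) \<partial>lebesgue)
      + ennreal (\<bar>\<integral>y. indicator (ball t h) y * w y \<partial>lebesgue\<bar> / m)"
proof -
  define e where "e = real DIM('a) + s * p"
  have e: "0 < e" using s p by (simp add: e_def add_pos_pos)
  let ?B = "ball t h"
  have m: "0 < m" using h by (simp add: m_def)
  have [measurable]: "?B \<in> sets lebesgue" by simp
  have Bm: "emeasure lebesgue ?B = ennreal m" using h by (simp add: m_def emeasure_lebesgue_ball del: emeasure_completion)
  have mB: "measure lebesgue ?B = m" using Bm m by (simp add: measure_def del: emeasure_completion)
  have intB: "integrable lebesgue (indicator ?B :: 'a \<Rightarrow> real)"
    using Bm by (intro integrable_real_indicator) (auto simp del: emeasure_completion)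
  have intw: "integrable lebesgue (\<lambda>y. indicator ?B y * w y)"
    using integrable_mult_indicator[OF _ w, of ?B] by simp
  define A where "A = (\<integral>y. indicator ?B y * w y \<partial>lebesgue)"
  have intd: "integrable lebesgue (\<lambda>y. indicator ?B y * (w x - w y))"
  proof -
    have "integrable lebesgue (\<lambda>y. indicator ?B y * w x - indicator ?B y * w y)"
      using intB intw by (intro Bochner_Integration.integrable_diff) auto
    then show ?thesis by (simp add: right_diff_distrib)
  qed
  have "w x * m - A = (\<integral>y. indicator ?B y * (w x - w y) \<partial>lebesgue)"
  proof -
    have "(\<integral>y. indicator ?B y * (w x - w y) \<partial>lebesgue) = (\<integral>y. indicator ?B y * w x - indicator ?B y * w y \<partial>lebesgue)"
      by (simp add: right_diff_distrib)
    also have "\<dots> = (\<integral>y. indicator ?B y * w x \<partial>lebesgue) - A"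
      unfolding A_def using intB intw by (intro Bochner_Integration.integral_diff) auto
    also have "(\<integral>y. indicator ?B y * w x \<partial>lebesgue) = w x * m"
      using mB by (simp add: mult.commute)
    finally show ?thesis by simp
  qed
  then have "ennreal \<bar>w x * m - A\<bar> \<le> (\<integral>\<^sup>+y. ennreal (norm (indicator ?B y * (w x - w y))) \<partial>lebesgue)"
    using integral_norm_bound_ennreal[OF intd] by simp
  also have "\<dots> \<le> (\<integral>\<^sup>+y. ennreal \<eta> * indicator ?B y
      + ennreal (\<eta> powr (1 - p) * (2 * h) powr e) * ennreal (gagliardo_integrand s p w (x, y)) \<partial>lebesgue)"
  proof (rule nn_integral_mono)
    fix y :: 'a
    show "ennreal (norm (indicator ?B y * (w x - w y))) \<le> ennreal \<eta> * indicator ?B y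
      + ennreal (\<eta> powr (1 - p) * (2 * h) powr e) * ennreal (gagliardo_integrand s p w (x, y))"
    proof (cases "y \<in> ?B \<and> y \<noteq> x")
      case True
      have "norm (x - y) \<le> 2 * h"
        using True x dist_triangle[of x y t] by (auto simp: dist_norm norm_minus_commute)
      then have "norm (x - y) powr e \<le> (2 * h) powr e" using e by (intro powr_mono2) auto
      then have "\<bar>w x - w y\<bar> powr p \<le> (2 * h) powr e * (\<bar>w x - w y\<bar> powr p / norm (x - y) powr e)"
        using True mult_right_mono[of "norm (x - y) powr e" "(2 * h) powr e" "\<bar>w x - w y\<bar> powr p / norm (x - y) powr e"]
        by (auto split: if_splits)
      then have "\<eta> powr (1 - p) * \<bar>w x - w y\<bar> powr p \<le> \<eta> powr (1 - p) * ((2 * h) powr e * gagliardo_integrand s p w (x, y))"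
        by (intro mult_left_mono) (auto simp: gagliardo_integrand_def e_def)
      moreover have "\<bar>w x - w y\<bar> \<le> \<eta> + \<eta> powr (1 - p) * \<bar>w x - w y\<bar> powr p"
        using p eta by (intro le_add_powr) auto
      ultimately have "\<bar>w x - w y\<bar> \<le> \<eta> + (\<eta> powr (1 - p) * (2 * h) powr e) * gagliardo_integrand s p w (x, y)"
        by (simp add: mult.assoc)
      then have "ennreal \<bar>w x - w y\<bar> \<le> ennreal (\<eta> + (\<eta> powr (1 - p) * (2 * h) powr e) * gagliardo_integrand s p w (x, y))"
        by (rule ennreal_leI)
      also have "\<dots> = ennreal \<eta> + ennreal (\<eta> powr (1 - p) * (2 * h) powr e) * ennreal (gagliardo_integrand s p w (x, y))"
        using eta by (simp add: ennreal_plus ennreal_mult)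
      finally show ?thesis using True by simp
    next
      case False
      then have "norm (indicator ?B y * (w x - w y)) = 0" by (auto simp: indicator_def)
      then show ?thesis by (simp only: ennreal_0) simp
    qed
  qed
  also have "\<dots> = ennreal \<eta> * ennreal m + ennreal (\<eta> powr (1 - p) * (2 * h) powr e)
      * (\<integral>\<^sup>+y. ennreal (gagliardo_integrand s p w (x, y)) \<partial>lebesgue)" (is "_ = _ + _ * ?g")
    by (subst nn_integral_add) (auto simp: nn_integral_cmult nn_integral_cmult_indicator Bm simp del: emeasure_completion)
  finally have *: "ennreal \<bar>w x * m - A\<bar> \<le> ennreal \<eta> * ennreal m + ennreal (\<eta> powr (1 - p) * (2 * h) powr e) * ?g" .
  have "\<bar>w x\<bar> \<le> \<bar>w x * m - A\<bar> * (1 / m) + \<bar>A\<bar> / m"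
  proof -
    have "\<bar>w x\<bar> * m = \<bar>w x * m\<bar>" using m by (simp add: abs_mult)
    also have "\<dots> \<le> \<bar>w x * m - A\<bar> + \<bar>A\<bar>" by linarith
    finally show ?thesis using m by (simp add: field_simps)
  qed
  then have "ennreal \<bar>w x\<bar> \<le> ennreal \<bar>w x * m - A\<bar> * ennreal (1 / m) + ennreal (\<bar>A\<bar> / m)"
    using m by (simp add: ennreal_leI flip: ennreal_mult ennreal_plus)
  also have "\<dots> \<le> (ennreal \<eta> * ennreal m + ennreal (\<eta> powr (1 - p) * (2 * h) powr e) * ?g) * ennreal (1 / m) + ennreal (\<bar>A\<bar> / m)"
    using * by (intro add_right_mono mult_right_mono) auto
  also have "(ennreal \<eta> * ennreal m + ennreal (\<eta> powr (1 - p) * (2 * h) powr e) * ?g) * ennreal (1 / m)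
    = ennreal \<eta> * (ennreal m * ennreal (1 / m)) + (ennreal (\<eta> powr (1 - p) * (2 * h) powr e) * ennreal (1 / m)) * ?g"
    by (simp add: algebra_simps)
  also have "ennreal m * ennreal (1 / m) = 1" using m by (simp flip: ennreal_mult)
  also have "ennreal (\<eta> powr (1 - p) * (2 * h) powr e) * ennreal (1 / m) = ennreal (\<eta> powr (1 - p) * (2 * h) powr e / m)"
    using m by (simp flip: ennreal_mult)
  finally show ?thesis by (simp add: A_def e_def)
qed

lemma energy_diff_le:
  assumes p: "0 < p" and u: "u \<in> W_space s p UNIV" and v: "v \<in> W_space s p UNIV"
  shows "(\<lambda>x. u x - v x) \<in> W_space s p UNIV" (is ?A)
    and "energy s p (\<lambda>x. u x - v x) \<le> 2 powr p * (energy s p u + energy s p v)" (is ?B)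
proof -
  have [measurable]: "u \<in> borel_measurable lebesgue" "v \<in> borel_measurable lebesgue"
    using u v by (auto simp: W_space_UNIV_iff)
  show A: ?A
    by (rule W_space_dominated[OF p u v, where A = 1]) (auto simp: algebra_simps)
  have "energy s p (\<lambda>x. u x - v x)
      \<le> (\<integral>z. 2 powr p * (gagliardo_integrand s p u z + gagliardo_integrand s p v z) \<partial>(lebesgue \<Otimes>\<^sub>M lebesgue))"
    unfolding energy_def
  proof (rule integral_mono)
    fix z :: "'a \<times> 'a"
    have "\<bar>u (fst z) - v (fst z) - (u (snd z) - v (snd z))\<bar> powr p
       \<le> 2 powr p * (\<bar>u (fst z) - u (snd z)\<bar> powr p + \<bar>v (fst z) - v (snd z)\<bar> powr p)"
      using abs_add_powr_le[of p "u (fst z) - u (snd z)" "v (snd z) - v (fst z)"] p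
      by (simp add: algebra_simps abs_minus_commute)
    then show "gagliardo_integrand s p (\<lambda>x. u x - v x) z
       \<le> 2 powr p * (gagliardo_integrand s p u z + gagliardo_integrand s p v z)"
      unfolding gagliardo_integrand_def split_beta by (simp add: divide_right_mono flip: add_divide_distrib)
  qed (use A u v in \<open>auto simp: W_space_UNIV_iff\<close>)
  also have "\<dots> = 2 powr p * (energy s p u + energy s p v)"
    unfolding energy_def using u v by (auto simp: W_space_UNIV_iff)
  finally show ?B .
qed

text \<open>
  Compactness for almost everywhere convergence. The means over a countable family of balls, namely finitely
  many of each radius \<open>1 / (i + 1)\<close> covering \<open>\<Omega>\<close>, converge along a diagonal subsequence; by the
  oscillation bound this subsequence is Cauchy in \<open>L^1\<close>.
\<close>

theorem fractional_rellich:
  fixes u :: "nat \<Rightarrow> 'a::euclidean_space \<Rightarrow> real" and s p M :: real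
  assumes s: "0 < s" and p: "1 < p" and bd: "bounded \<Omega>" and meas: "\<Omega> \<in> sets lebesgue"
    and W: "\<And>k. u k \<in> W_space s p UNIV" and zero: "\<And>k x. x \<notin> \<Omega> \<Longrightarrow> u k x = 0"
    and M1: "\<And>k. (\<integral>x. \<bar>u k x\<bar> powr p \<partial>lebesgue) \<le> M" and M2: "\<And>k. energy s p (u k) \<le> M"
  obtains \<theta> f where "strict_mono \<theta>" "f \<in> borel_measurable lebesgue" "\<And>x. x \<notin> \<Omega> \<Longrightarrow> f x = 0"
    "AE x in lebesgue. (\<lambda>k. u (\<theta> k) x) \<longlonglongrightarrow> f x"
proof -
  have [measurable]: "u k \<in> borel_measurable lebesgue" for k using W by (simp add: W_space_UNIV_iff)
  have [measurable]: "\<Omega> \<in> sets lebesgue" by (rule meas)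
  have fin: "\<Omega> \<in> lmeasurable" using bd meas by (simp add: bounded_set_imp_lmeasurable)
  define m\<Omega> where "m\<Omega> = measure lebesgue \<Omega>"
  have m\<Omega>: "0 \<le> m\<Omega>" by (simp add: m\<Omega>_def)
  have em: "emeasure lebesgue \<Omega> = ennreal m\<Omega>" unfolding m\<Omega>_def using fin by (rule emeasure_eq_measure2)
  have int\<Omega>: "integrable lebesgue (indicator \<Omega> :: 'a \<Rightarrow> real)"
    using fin by (simp add: fmeasurable_def del: emeasure_completion)
  have u1: "integrable lebesgue (u k)" "(\<integral>x. \<bar>u k x\<bar> \<partial>lebesgue) \<le> m\<Omega> + M" for k
  proof -
    have pt: "\<bar>u k x\<bar> \<le> indicator \<Omega> x + \<bar>u k x\<bar> powr p" for x
      using le_add_powr[of p "\<bar>u k x\<bar>" 1] p zero[of x k] by (cases "x \<in> \<Omega>") auto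
    have i: "integrable lebesgue (\<lambda>x. indicator \<Omega> x + \<bar>u k x\<bar> powr p)"
      using int\<Omega> W[of k] by (auto simp: W_space_UNIV_iff)
    show *: "integrable lebesgue (u k)"
      by (rule Bochner_Integration.integrable_bound[OF i]) (use pt in \<open>auto intro: order_trans\<close>)
    have "(\<integral>x. \<bar>u k x\<bar> \<partial>lebesgue) \<le> (\<integral>x. indicator \<Omega> x + \<bar>u k x\<bar> powr p \<partial>lebesgue)"
      using pt * i by (intro integral_mono) auto
    also have "\<dots> = m\<Omega> + (\<integral>x. \<bar>u k x\<bar> powr p \<partial>lebesgue)"
      using int\<Omega> W[of k] by (subst Bochner_Integration.integral_add) (auto simp: W_space_UNIV_iff m\<Omega>_def)
    finally show "(\<integral>x. \<bar>u k x\<bar> \<partial>lebesgue) \<le> m\<Omega> + M" using M1[of k] by linarith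
  qed
  define H where "H = (\<lambda>i::nat. inverse (real (Suc i)))"
  have Hpos: "0 < H i" for i by (simp add: H_def)
  have "\<exists>T. finite T \<and> \<Omega> \<subseteq> (\<Union>t\<in>T. ball t (H i))" for i
  proof -
    have "compact (closure \<Omega>)" using bd by (simp add: compact_closure)
    then obtain T where "finite T" "closure \<Omega> \<subseteq> (\<Union>t\<in>T. ball t (H i))"
      using Hpos[of i] by (auto simp: compact_eq_totally_bounded)
    then show ?thesis using closure_subset[of \<Omega>] by blast
  qed
  then obtain T where T: "\<And>i. finite (T i)" "\<And>i. \<Omega> \<subseteq> (\<Union>t\<in>T i. ball t (H i))" by metis
  define S where "S = (SIGMA i:(UNIV::nat set). T i)"
  define F where "F = (\<lambda>k z. \<integral>y. indicator (ball (snd z) (H (fst z))) y * u k y \<partial>lebesgue)"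
  have cS: "countable S" unfolding S_def using T(1) by (auto intro: countable_finite)
  have FM: "norm (F k z) \<le> m\<Omega> + M" for k z
  proof -
    have "norm (F k z) \<le> (\<integral>y. norm (indicator (ball (snd z) (H (fst z))) y * u k y) \<partial>lebesgue)"
      unfolding F_def by (rule integral_norm_bound)
    also have "\<dots> \<le> (\<integral>y. \<bar>u k y\<bar> \<partial>lebesgue)"
    proof (rule integral_mono)
      show "integrable lebesgue (\<lambda>y. norm (indicator (ball (snd z) (H (fst z))) y * u k y))"
        using integrable_norm[OF integrable_mult_indicator[OF _ u1(1)[of k], of "ball (snd z) (H (fst z))"]] by simp
    qed (use u1(1)[of k] in \<open>auto simp: indicator_def\<close>)
    finally show ?thesis using u1(2)[of k] by linarith
  qed
  obtain \<theta> where \<theta>: "strict_mono \<theta>" "\<And>z. z \<in> S \<Longrightarrow> \<exists>l. (\<lambda>n. F (\<theta> n) z) \<longlonglongrightarrow> l"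
    by (rule function_convergent_subsequence[where S = S and f = F and M = "m\<Omega> + M", OF cS FM]) blast
  have M0: "0 \<le> M" using M2[of 0] energy_nonneg[of s p "u 0"] by linarith
  have cauchy: "\<exists>N. \<forall>i\<ge>N. \<forall>j\<ge>N. (LINT x|lebesgue. norm (u (\<theta> i) x - u (\<theta> j) x)) < e" if e: "0 < e" for e
  proof -
    define n where "n = real DIM('a)"
    define \<omega> where "\<omega> = unit_ball_vol n"
    have \<omega>: "0 < \<omega>" by (simp add: \<omega>_def n_def)
    \<comment> \<open>The constants \<open>\<eta>\<close>, the radius \<open>h\<close> and \<open>D\<close> are chosen, in this order, so that each of the three terms of the oscillation bound contributes at most \<open>e / 4\<close>.\<close>
    define \<eta> where "\<eta> = e / (4 * (m\<Omega> + 1))"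
    have eta: "0 < \<eta>" using e m\<Omega> by (simp add: \<eta>_def)
    have eta_le: "\<eta> * m\<Omega> \<le> e / 4"
    proof -
      have "\<eta> * m\<Omega> \<le> \<eta> * (m\<Omega> + 1)" using eta by simp
      also have "\<dots> = e / 4" using m\<Omega> by (simp add: \<eta>_def field_simps)
      finally show ?thesis .
    qed
    define E where "E = 2 powr p * (M + M)"
    define c where "c = \<eta> powr (1 - p) * 2 powr (n + s * p) / \<omega>"
    have "(\<lambda>i. c * (H i powr (s * p)) * E) \<longlonglongrightarrow> c * (0 powr (s * p)) * E"
      unfolding H_def using s p by (intro tendsto_intros tendsto_powr' LIMSEQ_inverse_real_of_nat) auto
    then have "(\<lambda>i. c * (H i powr (s * p)) * E) \<longlonglongrightarrow> 0" by simp
    then have "eventually (\<lambda>i. c * (H i powr (s * p)) * E < e / 4) sequentially"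
      by (rule order_tendstoD) (use e in simp)
    then obtain i0 where i0: "c * (H i0 powr (s * p)) * E < e / 4"
      by (auto simp: eventually_sequentially)
    define h where "h = H i0"
    have h: "0 < h" using Hpos by (simp add: h_def)
    define m where "m = \<omega> * h ^ DIM('a)"
    have m: "0 < m" using h \<omega> by (simp add: m_def)
    have cm: "\<eta> powr (1 - p) * (2 * h) powr (n + s * p) / m = c * h powr (s * p)"
      using h \<omega> by (simp add: c_def m_def powr_mult powr_add n_def powr_realpow field_simps)
    define D where "D = e * m / (4 * (m\<Omega> + 1))"
    have D: "0 < D" using e m m\<Omega> by (simp add: D_def)
    have Dm: "D / m * m\<Omega> \<le> e / 4"
      using eta_le m by (simp add: D_def \<eta>_def)
    have "\<exists>N. \<forall>i\<ge>N. \<forall>j\<ge>N. \<bar>F (\<theta> i) (i0, t) - F (\<theta> j) (i0, t)\<bar> < D" if "t \<in> T i0" for t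
    proof -
      have "(i0, t) \<in> S" using that by (simp add: S_def)
      then have "Cauchy (\<lambda>n. F (\<theta> n) (i0, t))" using \<theta>(2) by (auto intro: LIMSEQ_imp_Cauchy)
      then show ?thesis using D unfolding Cauchy_def dist_real_def by meson
    qed
    then obtain NN where NN: "\<And>t i j. t \<in> T i0 \<Longrightarrow> i \<ge> NN t \<Longrightarrow> j \<ge> NN t \<Longrightarrow> \<bar>F (\<theta> i) (i0, t) - F (\<theta> j) (i0, t)\<bar> < D"
      by metis
    obtain N where N: "\<And>t. t \<in> T i0 \<Longrightarrow> NN t \<le> N"
      using T(1)[of i0] by (meson finite_imageI finite_nat_set_iff_bounded_le imageI)
    show ?thesis
    proof (intro exI allI impI)
      fix i j assume ij: "N \<le> i" "N \<le> j"
      define w where "w = (\<lambda>x. u (\<theta> i) x - u (\<theta> j) x)"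
      have wW: "w \<in> W_space s p UNIV" and wE: "energy s p w \<le> E"
        unfolding w_def E_def using energy_diff_le[OF _ W[of "\<theta> i"] W[of "\<theta> j"]] p
          mult_left_mono[OF add_mono[OF M2[of "\<theta> i"] M2[of "\<theta> j"]], of "2 powr p"]
        by (auto intro: order_trans)
      have [measurable]: "w \<in> borel_measurable lebesgue" unfolding w_def by measurable
      have wint: "integrable lebesgue w" unfolding w_def using u1(1) by auto
      have [measurable]: "(\<lambda>x. \<integral>\<^sup>+y. ennreal (gagliardo_integrand s p w (x, y)) \<partial>lebesgue) \<in> borel_measurable lebesgue"
        by (rule lebesgue.borel_measurable_nn_integral_fst) measurable
      have pt: "ennreal \<bar>w x\<bar> \<le> ennreal (\<eta> + D / m) * indicator \<Omega> x
          + ennreal (c * h powr (s * p)) * (\<integral>\<^sup>+y. ennreal (gagliardo_integrand s p w (x, y)) \<partial>lebesgue)" for x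
      proof (cases "x \<in> \<Omega>")
        case True
        then obtain t where t: "t \<in> T i0" "x \<in> ball t h" using T(2)[of i0] by (auto simp: h_def)
        have "(\<integral>y. indicator (ball t h) y * w y \<partial>lebesgue) = F (\<theta> i) (i0, t) - F (\<theta> j) (i0, t)"
        proof -
          have "(\<integral>y. indicator (ball t h) y * w y \<partial>lebesgue)
             = (\<integral>y. indicator (ball t h) y * u (\<theta> i) y - indicator (ball t h) y * u (\<theta> j) y \<partial>lebesgue)"
            by (simp add: w_def right_diff_distrib)
          also have "\<dots> = F (\<theta> i) (i0, t) - F (\<theta> j) (i0, t)"
            unfolding F_def fst_conv snd_conv h_def
            using integrable_mult_indicator[OF _ u1(1), of "ball t (H i0)"]
            by (intro Bochner_Integration.integral_diff) auto
          finally show ?thesis .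
        qed
        also have "\<bar>\<dots>\<bar> \<le> D" using NN[OF t(1)] N[OF t(1)] ij by (meson le_trans less_imp_le)
        finally have "ennreal (\<bar>\<integral>y. indicator (ball t h) y * w y \<partial>lebesgue\<bar> / m) \<le> ennreal (D / m)"
          using m by (intro ennreal_leI divide_right_mono) auto
        moreover have "ennreal \<bar>w x\<bar> \<le> ennreal \<eta> + ennreal (c * h powr (s * p))
            * (\<integral>\<^sup>+y. ennreal (gagliardo_integrand s p w (x, y)) \<partial>lebesgue)
            + ennreal (\<bar>\<integral>y. indicator (ball t h) y * w y \<partial>lebesgue\<bar> / m)"
          using oscillation_bound[OF p s h eta _ wint t(2)] unfolding cm[symmetric] m_def \<omega>_def n_def by simp
        ultimately have "ennreal \<bar>w x\<bar> \<le> ennreal \<eta> + ennreal (c * h powr (s * p))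
            * (\<integral>\<^sup>+y. ennreal (gagliardo_integrand s p w (x, y)) \<partial>lebesgue) + ennreal (D / m)"
          by (meson add_left_mono order_trans)
        also have "\<dots> = ennreal (\<eta> + D / m) * indicator \<Omega> x
          + ennreal (c * h powr (s * p)) * (\<integral>\<^sup>+y. ennreal (gagliardo_integrand s p w (x, y)) \<partial>lebesgue)"
          using True eta D m by (simp add: ennreal_plus add_ac)
        finally show ?thesis .
      next
        case False
        then show ?thesis using zero by (simp add: w_def)
      qed
      have c0: "0 \<le> c" using \<omega> by (simp add: c_def)
      have "ennreal (LINT x|lebesgue. \<bar>w x\<bar>) = (\<integral>\<^sup>+x. ennreal \<bar>w x\<bar> \<partial>lebesgue)"
        using wint by (intro nn_integral_eq_integral[symmetric]) auto
      also have "\<dots> \<le> (\<integral>\<^sup>+x. ennreal (\<eta> + D / m) * indicator \<Omega> x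
          + ennreal (c * h powr (s * p)) * (\<integral>\<^sup>+y. ennreal (gagliardo_integrand s p w (x, y)) \<partial>lebesgue) \<partial>lebesgue)"
        by (intro nn_integral_mono pt)
      also have "\<dots> = ennreal (\<eta> + D / m) * ennreal m\<Omega> + ennreal (c * h powr (s * p)) * ennreal (energy s p w)"
        by (simp add: nn_integral_add nn_integral_cmult nn_integral_cmult_indicator em energy_eq_nn_integral[OF wW] del: emeasure_completion)
      also have "\<dots> = ennreal ((\<eta> + D / m) * m\<Omega> + c * h powr (s * p) * energy s p w)"
        using eta D m c0 m\<Omega> by (simp add: ennreal_mult ennreal_plus)
      finally have "(LINT x|lebesgue. \<bar>w x\<bar>) \<le> (\<eta> + D / m) * m\<Omega> + c * h powr (s * p) * energy s p w"
        using eta D m c0 m\<Omega> by (subst (asm) ennreal_le_iff) auto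
      also have "\<dots> \<le> e / 4 + e / 4 + c * h powr (s * p) * E"
      proof (rule add_mono)
        show "(\<eta> + D / m) * m\<Omega> \<le> e / 4 + e / 4"
          unfolding distrib_right using eta_le Dm by (rule add_mono)
        show "c * h powr (s * p) * energy s p w \<le> c * h powr (s * p) * E"
          using wE c0 by (intro mult_left_mono) auto
      qed
      also have "\<dots> < e" using i0 e by (simp add: h_def)
      finally show "(LINT x|lebesgue. norm (u (\<theta> i) x - u (\<theta> j) x)) < e"
        by (simp add: w_def)
    qed
  qed
  obtain r where r: "strict_mono r" "AE x in lebesgue. Cauchy (\<lambda>i. u (\<theta> (r i)) x)"
    using cauchy_L1_AE_cauchy_subseq[of lebesgue "\<lambda>i. u (\<theta> i)"] u1(1) cauchy by blast
  define f where "f = (\<lambda>x. lim (\<lambda>i. u (\<theta> (r i)) x))"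
  show ?thesis
  proof
    show "strict_mono (\<theta> \<circ> r)" using \<theta>(1) r(1) by (rule strict_mono_o)
    show "f \<in> borel_measurable lebesgue" unfolding f_def by measurable
    show "f x = 0" if "x \<notin> \<Omega>" for x using that zero by (simp add: f_def)
    show "AE x in lebesgue. (\<lambda>k. u ((\<theta> \<circ> r) k) x) \<longlonglongrightarrow> f x"
      using r(2) by eventually_elim (simp add: f_def Cauchy_convergent_iff convergent_LIMSEQ_iff)
  qed
qed

section \<open>The reduced minimization problem\<close>

text \<open>
  The standing assumptions on the domain and the exponents; the last one makes the embedding subcritical.
\<close>

locale fractional_potential =
  fixes \<Omega> :: "'a::euclidean_space set" and s p q :: real
  assumes s: "0 < s" "s < 1" and p: "1 < p"
    and bounded_domain: "bounded \<Omega>" and nonempty_domain: "\<Omega> \<noteq> {}" and open_domain: "open \<Omega>"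
    and q: "1 < q" "real DIM('a) / (s * p) < q"
begin

text \<open>
  The exponent \<open>r = p q'\<close>, where \<open>q'\<close> is conjugate to \<open>q\<close>.
\<close>

definition r :: real where "r = p * q / (q - 1)"

text \<open>
  The \<open>p\<close>-th power of the \<open>L^p\<close> norm.
\<close>

definition mass :: "('a \<Rightarrow> real) \<Rightarrow> real" where
  "mass u = (\<integral>x. \<bar>u x\<bar> powr p \<partial>lebesgue)"

text \<open>
  The norm of \<open>\<bar>u\<bar> powr p\<close> in \<open>L^{q'}\<close>, the dual of \<open>L^q\<close>.
\<close>

definition dual_norm :: "('a \<Rightarrow> real) \<Rightarrow> real" where
  "dual_norm u = (\<integral>x. \<bar>u x\<bar> powr r \<partial>lebesgue) powr (1 - 1 / q)"

text \<open>
  The minimum over all potentials in the closed unit ball of \<open>L^q\<close> of the functional that defines the eigenvalue.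
\<close>

definition reduced_functional :: "('a \<Rightarrow> real) \<Rightarrow> real" where
  "reduced_functional u = energy s p u / 2 - dual_norm u"

text \<open>
  The functional whose infimum over the functions of mass \<open>1\<close> is the first eigenvalue for the potential \<open>V\<close>. It is
  not divided by the mass, and is therefore homogeneous of degree \<open>p\<close>.
\<close>

definition Rayleigh :: "('a \<Rightarrow> real) \<Rightarrow> ('a \<Rightarrow> real) \<Rightarrow> real" where
  "Rayleigh V u = energy s p u / 2 + (\<integral>x. V x * \<bar>u x\<bar> powr p \<partial>lebesgue_on \<Omega>)"

lemma r_gt_p: "p < r" using p q by (simp add: r_def field_simps)

lemma domain_measurable [measurable, simp]: "\<Omega> \<in> sets lebesgue"
  using open_domain by simp

lemma integral_domain:
  fixes f :: "'a \<Rightarrow> real"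
  assumes "\<And>x. x \<notin> \<Omega> \<Longrightarrow> f x = 0"
  shows "(\<integral>x. f x \<partial>lebesgue_on \<Omega>) = (\<integral>x. f x \<partial>lebesgue)"
    and "integrable (lebesgue_on \<Omega>) f \<longleftrightarrow> integrable lebesgue f"
proof -
  have *: "(\<lambda>x. indicat_real \<Omega> x *\<^sub>R f x) = f" using assms by (auto simp: indicator_def fun_eq_iff)
  show "(\<integral>x. f x \<partial>lebesgue_on \<Omega>) = (\<integral>x. f x \<partial>lebesgue)"
    by (simp add: integral_restrict_space set_lebesgue_integral_def *[simplified])
  show "integrable (lebesgue_on \<Omega>) f \<longleftrightarrow> integrable lebesgue f"
    by (simp add: integrable_restrict_space set_integrable_def *[simplified])
qed

lemma X_zero: "u \<in> W_tilde s p \<Omega> \<Longrightarrow> x \<notin> \<Omega> \<Longrightarrow> u x = 0"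
  using open_domain by (simp add: W_tilde_iff)

lemma X_W: "u \<in> W_tilde s p \<Omega> \<Longrightarrow> u \<in> W_space s p UNIV"
  using open_domain by (simp add: W_tilde_iff)

lemma X_measurable: "u \<in> W_tilde s p \<Omega> \<Longrightarrow> u \<in> borel_measurable lebesgue"
  using X_W by (auto simp: W_space_UNIV_iff)

lemma X_integrable_p: "u \<in> W_tilde s p \<Omega> \<Longrightarrow> integrable lebesgue (\<lambda>x. \<bar>u x\<bar> powr p)"
  using X_W by (auto simp: W_space_UNIV_iff)

lemma X_integrable_energy:
  "u \<in> W_tilde s p \<Omega> \<Longrightarrow> integrable (lebesgue \<Otimes>\<^sub>M lebesgue) (gagliardo_integrand s p u)"
  using X_W by (auto simp: W_space_UNIV_iff)

lemma X_integrable_r: "u \<in> W_tilde s p \<Omega> \<Longrightarrow> integrable lebesgue (\<lambda>x. \<bar>u x\<bar> powr r)"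
  using fractional_embedding[OF p s(1) q, of 1] X_W unfolding r_def by (metis zero_less_one)

lemma mass_nonneg [simp]: "0 \<le> mass u" by (simp add: mass_def)

lemma dual_norm_nonneg [simp]: "0 \<le> dual_norm u" by (simp add: dual_norm_def)

lemma scale_energy: "energy s p (\<lambda>x::'a. c * u x) = \<bar>c\<bar> powr p * energy s p u"
proof -
  have "gagliardo_integrand s p (\<lambda>x. c * u x) z = \<bar>c\<bar> powr p * gagliardo_integrand s p u z" for z :: "'a \<times> 'a"
    by (simp add: gagliardo_integrand_def split_beta powr_mult abs_mult flip: right_diff_distrib)
  then show ?thesis by (simp add: energy_def)
qed

lemma scale_mass: "mass (\<lambda>x. c * u x) = \<bar>c\<bar> powr p * mass u"
  by (simp add: mass_def abs_mult powr_mult)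

lemma scale_Rayleigh: "Rayleigh V (\<lambda>x. c * u x) = \<bar>c\<bar> powr p * Rayleigh V u"
proof -
  have "(\<integral>x. V x * \<bar>c * u x\<bar> powr p \<partial>lebesgue_on \<Omega>) = (\<integral>x. \<bar>c\<bar> powr p * (V x * \<bar>u x\<bar> powr p) \<partial>lebesgue_on \<Omega>)"
    by (simp add: abs_mult powr_mult mult_ac)
  also have "\<dots> = \<bar>c\<bar> powr p * (\<integral>x. V x * \<bar>u x\<bar> powr p \<partial>lebesgue_on \<Omega>)"
    by (rule integral_mult_right_zero)
  finally show ?thesis by (simp only: Rayleigh_def scale_energy) (simp add: algebra_simps)
qed

lemma X_scale: "u \<in> W_tilde s p \<Omega> \<Longrightarrow> (\<lambda>x. c * u x) \<in> W_tilde s p \<Omega>"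
  using W_tilde_lincomb[OF open_domain _, of p u s u c 0] p by simp

lemma mass_zero_iff:
  assumes "u \<in> W_tilde s p \<Omega>" shows "mass u = 0 \<longleftrightarrow> (AE x in lebesgue. u x = 0)"
  using X_integrable_p[OF assms] by (simp add: mass_def integral_nonneg_eq_0_iff_AE)

lemma normalize:
  assumes "u \<in> W_tilde s p \<Omega>" "mass u \<noteq> 0"
  defines "c \<equiv> mass u powr (- 1 / p)"
  shows "(\<lambda>x. c * u x) \<in> W_tilde s p \<Omega>" "mass (\<lambda>x. c * u x) = 1" "c powr p * mass u = 1" "0 < c"
proof -
  have m: "0 < mass u" using assms(2) mass_nonneg[of u] by linarith
  show "0 < c" using m by (simp add: c_def)
  have "c powr p = mass u powr (- 1)" using p by (simp add: c_def powr_powr)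
  then show 1: "c powr p * mass u = 1" using m by (simp add: powr_minus)
  show "mass (\<lambda>x. c * u x) = 1" using 1 \<open>0 < c\<close> by (simp add: scale_mass)
  show "(\<lambda>x. c * u x) \<in> W_tilde s p \<Omega>" by (rule X_scale) fact
qed

lemma tent_in_X:
  assumes "0 < R" "R \<le> 1" "ball x0 R \<subseteq> \<Omega>"
  shows "(\<lambda>x. max 0 (R - dist x x0)) \<in> W_tilde s p \<Omega>"
proof -
  have "max 0 (R - dist x x0) = 0" if "x \<notin> \<Omega>" for x
    using that assms by (force simp: dist_commute subset_iff)
  then show ?thesis
    using tent_in_W_space[OF s p assms(1,2)] open_domain by (simp add: W_tilde_iff)
qed

lemma exists_normalized: "\<exists>u \<in> W_tilde s p \<Omega>. mass u = 1"
proof -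
  obtain x0 where "x0 \<in> \<Omega>" using nonempty_domain by auto
  then obtain R' where R': "0 < R'" "ball x0 R' \<subseteq> \<Omega>" using open_domain by (meson open_contains_ball)
  define R where "R = min R' 1"
  have R: "0 < R" "R \<le> 1" "ball x0 R \<subseteq> \<Omega>" using R' by (auto simp: R_def)
  define \<phi> where "\<phi> = (\<lambda>x. max 0 (R - dist x x0))"
  have \<phi>: "\<phi> \<in> W_tilde s p \<Omega>" unfolding \<phi>_def by (rule tent_in_X[OF R])
  have "mass \<phi> \<noteq> 0"
  proof
    assume "mass \<phi> = 0"
    then have "AE x in lebesgue. \<phi> x = 0" using mass_zero_iff[OF \<phi>] by simp
    then have "AE x in lebesgue. x \<notin> ball x0 R"
      by eventually_elim (auto simp: \<phi>_def dist_commute max_def split: if_splits)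
    then have "emeasure lebesgue (ball x0 R) = 0"
      using AE_iff_null_sets[of "ball x0 R" lebesgue] by (auto simp del: emeasure_completion)
    then show False using R(1) by (simp add: emeasure_lebesgue_ball ennreal_eq_0_iff del: emeasure_completion) (metis not_le unit_ball_vol_pos of_nat_0_le_iff zero_less_mult_iff zero_less_power)
  qed
  then show ?thesis using normalize[OF \<phi>] by blast
qed

lemma potential_bound:
  assumes V: "V \<in> Lp_space q \<Omega>" and u: "u \<in> W_tilde s p \<Omega>"
  shows "integrable (lebesgue_on \<Omega>) (\<lambda>x. V x * \<bar>u x\<bar> powr p)"
    and "\<bar>\<integral>x. V x * \<bar>u x\<bar> powr p \<partial>lebesgue_on \<Omega>\<bar> \<le> Lp_norm q \<Omega> V * dual_norm u"
proof -
  define q' where "q' = q / (q - 1)"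
  have q': "1 < q'" "1 / q + 1 / q' = 1" using q by (auto simp: q'_def field_simps)
  have pq: "p * q' = r" by (simp add: q'_def r_def)
  have um: "u \<in> borel_measurable (lebesgue_on \<Omega>)"
    by (rule measurable_restrict_space1[OF X_measurable[OF u]])
  have r_int: "integrable (lebesgue_on \<Omega>) (\<lambda>x. \<bar>u x\<bar> powr r)"
    "(\<integral>x. \<bar>u x\<bar> powr r \<partial>lebesgue_on \<Omega>) = (\<integral>x. \<bar>u x\<bar> powr r \<partial>lebesgue)"
    using X_integrable_r[OF u] X_zero[OF u] by (subst integral_domain; simp)+
  have e: "(\<lambda>x. \<bar>\<bar>u x\<bar> powr p\<bar> powr q') = (\<lambda>x. \<bar>u x\<bar> powr r)" by (simp add: powr_powr pq)
  have Vq: "V \<in> borel_measurable (lebesgue_on \<Omega>)" "integrable (lebesgue_on \<Omega>) (\<lambda>x. \<bar>V x\<bar> powr q)"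
    using V by (auto simp: Lp_space_def)
  have um': "(\<lambda>x. \<bar>u x\<bar> powr p) \<in> borel_measurable (lebesgue_on \<Omega>)" using um by measurable
  note H = Holder_inequality[OF q(1) q' Vq(1) um' Vq(2), unfolded e, OF r_int(1)]
  show "integrable (lebesgue_on \<Omega>) (\<lambda>x. V x * \<bar>u x\<bar> powr p)" by (rule H(1))
  have "1 / q' = 1 - 1 / q" using q' by linarith
  then show "\<bar>\<integral>x. V x * \<bar>u x\<bar> powr p \<partial>lebesgue_on \<Omega>\<bar> \<le> Lp_norm q \<Omega> V * dual_norm u"
    using H(2) by (simp add: r_int(2) Lp_norm_def dual_norm_def)
qed

lemma Rayleigh_ge_reduced:
  assumes V: "V \<in> Lq_unit_ball q \<Omega>" and u: "u \<in> W_tilde s p \<Omega>"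
  shows "reduced_functional u \<le> Rayleigh V u"
proof -
  have "V \<in> Lp_space q \<Omega>" "Lp_norm q \<Omega> V \<le> 1" using V by (auto simp: Lq_unit_ball_def)
  then have "\<bar>\<integral>x. V x * \<bar>u x\<bar> powr p \<partial>lebesgue_on \<Omega>\<bar> \<le> 1 * dual_norm u"
    using potential_bound(2)[of V u] u mult_right_mono[of "Lp_norm q \<Omega> V" 1 "dual_norm u"] by simp
  then show ?thesis by (simp add: reduced_functional_def Rayleigh_def)
qed

lemma first_eigenvalue_eq:
  "first_eigenvalue s p \<Omega> V = (INF u \<in> {u \<in> W_tilde s p \<Omega>. mass u = 1}. Rayleigh V u)"
proof -
  have "{u \<in> W_tilde s p \<Omega>. Lp_norm p UNIV u = 1} = {u \<in> W_tilde s p \<Omega>. mass u = 1}"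
    using p by (simp add: Lp_norm_eq_1_iff lebesgue_on_UNIV_eq mass_def)
  moreover have "1 / 2 * gagliardo_seminorm s p UNIV u powr p = energy s p u / 2" for u :: "'a \<Rightarrow> real"
    using p by (simp add: gagliardo_seminorm_powr lebesgue_on_UNIV_eq energy_def)
  ultimately show ?thesis by (simp add: first_eigenvalue_def Rayleigh_def)
qed

lemma reduced_functional_coercive:
  "\<exists>C. \<forall>u \<in> W_tilde s p \<Omega>. mass u = 1 \<longrightarrow> energy s p u / 4 - C \<le> reduced_functional u"
proof -
  obtain C where C: "\<And>u :: 'a \<Rightarrow> real. u \<in> W_space s p UNIV \<Longrightarrow> dual_norm u \<le> 1 / 4 * energy s p u + C * mass u"
    using fractional_embedding[OF p s(1) q, of "1 / 4"] unfolding dual_norm_def mass_def r_def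
    by (metis zero_less_divide_1_iff zero_less_numeral)
  show ?thesis
  proof (intro exI ballI impI)
    fix u assume "u \<in> W_tilde s p \<Omega>" "mass u = 1"
    then show "energy s p u / 4 - C \<le> reduced_functional u"
      using C[OF X_W] by (force simp: reduced_functional_def)
  qed
qed

lemma AE_pair_both:
  assumes "AE x in (lebesgue :: 'a measure). P x"
  shows "AE z in (lebesgue :: 'a measure) \<Otimes>\<^sub>M (lebesgue :: 'a measure). P (fst z) \<and> P (snd z)"
proof -
  obtain N where N: "N \<in> null_sets lebesgue" "{x \<in> space lebesgue. \<not> P x} \<subseteq> N"
    using assms by (auto simp: eventually_ae_filter)
  have [measurable]: "N \<in> sets lebesgue" using N(1) by auto
  have n: "AE x in lebesgue. x \<notin> N" using N(1) by (rule AE_not_in)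
  have "AE z in lebesgue \<Otimes>\<^sub>M lebesgue. fst z \<notin> N \<and> snd z \<notin> N"
  proof (rule lebesgue_pair.AE_pair_measure)
    show "{z \<in> space (lebesgue \<Otimes>\<^sub>M lebesgue). fst z \<notin> N \<and> snd z \<notin> N} \<in> sets (lebesgue \<Otimes>\<^sub>M lebesgue)"
      by measurable
    show "AE x in lebesgue. AE y in lebesgue. fst (x, y) \<notin> N \<and> snd (x, y) \<notin> N"
      using n by eventually_elim (use n in simp)
  qed
  then show ?thesis by eventually_elim (use N(2) in auto)
qed

text \<open>
  The direct method. A minimizing sequence is bounded in energy, hence converges almost everywhere along a
  subsequence; the mass and the dual norm pass to the limit, and the energy is lower semicontinuous.
\<close>

lemma reduced_minimizer:
  obtains u where "u \<in> W_tilde s p \<Omega>" "mass u = 1" "\<And>x. 0 \<le> u x"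
    "\<And>v. v \<in> W_tilde s p \<Omega> \<Longrightarrow> mass v = 1 \<Longrightarrow> reduced_functional u \<le> reduced_functional v"
proof -
  define A where "A = {u \<in> W_tilde s p \<Omega>. mass u = 1}"
  have neA: "A \<noteq> {}" using exists_normalized by (auto simp: A_def)
  obtain C where C0: "\<And>u. u \<in> W_tilde s p \<Omega> \<Longrightarrow> mass u = 1 \<Longrightarrow> energy s p u / 4 - C \<le> reduced_functional u"
    using reduced_functional_coercive by blast
  have C: "energy s p u / 4 - C \<le> reduced_functional u" if "u \<in> A" for u
    using C0[of u] that by (simp add: A_def)
  have bdd: "bdd_below (reduced_functional ` A)"
  proof (rule bdd_belowI2)
    show "- C \<le> reduced_functional u" if "u \<in> A" for u
      using C[OF that] energy_nonneg[of s p u] by linarith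
  qed
  define m where "m = (INF u\<in>A. reduced_functional u)"
  have m_le: "m \<le> reduced_functional u" if "u \<in> A" for u
    unfolding m_def by (rule cINF_lower[OF bdd that])
  have "\<exists>u\<in>A. reduced_functional u < m + inverse (real (Suc k))" for k
    using cINF_less_iff[OF neA bdd, of "m + inverse (real (Suc k))"] by (simp add: m_def)
  then obtain u where uA: "\<And>k. u k \<in> A" and u_lt: "\<And>k. reduced_functional (u k) < m + inverse (real (Suc k))"
    by metis
  have uX: "u k \<in> W_tilde s p \<Omega>" and u1: "mass (u k) = 1" for k using uA by (auto simp: A_def)
  define M where "M = max 1 (4 * (m + 1 + C))"
  have E_le: "energy s p (u k) \<le> M" for k
  proof -
    have "inverse (real (Suc k)) \<le> 1" by (simp add: field_simps)
    then show ?thesis using C[OF uA[of k]] u_lt[of k] by (simp add: M_def)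
  qed
  obtain \<theta> f where \<theta>: "strict_mono \<theta>" and fm: "f \<in> borel_measurable lebesgue"
    and f0: "\<And>x. x \<notin> \<Omega> \<Longrightarrow> f x = 0" and lim: "AE x in lebesgue. (\<lambda>k. u (\<theta> k) x) \<longlonglongrightarrow> f x"
  proof (rule fractional_rellich[OF s(1) p bounded_domain domain_measurable, of u M])
    show "(\<integral>x. \<bar>u k x\<bar> powr p \<partial>lebesgue) \<le> M" for k using u1[of k] by (simp add: mass_def M_def)
  qed (use X_W[OF uX] X_zero[OF uX] E_le in auto)
  define v where "v = (\<lambda>k. u (\<theta> k))"
  have vX: "v k \<in> W_tilde s p \<Omega>" and v1: "mass (v k) = 1" and vE: "energy s p (v k) \<le> M" for k
    using uX u1 E_le by (auto simp: v_def)
  have vm [measurable]: "v k \<in> borel_measurable lebesgue" for k by (rule X_measurable[OF vX])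
  note fm [measurable]
  have limv: "AE x in lebesgue. (\<lambda>k. v k x) \<longlonglongrightarrow> f x" using lim by (simp add: v_def)
  \<comment> \<open>An exponent \<open>q2 < q\<close> bounds the sequence in some \<open>L^{r2}\<close> with \<open>r2 > r\<close>, so that the norms in \<open>L^r\<close> converge.\<close>
  obtain q2 where q2: "1 < q2" "real DIM('a) / (s * p) < q2" "q2 < q"
    using dense[of "max 1 (real DIM('a) / (s * p))" q] q by auto
  define r2 where "r2 = p * q2 / (q2 - 1)"
  have r2: "r < r2"
  proof -
    have "p * (1 / (q - 1)) < p * (1 / (q2 - 1))"
      using p q2 by (intro mult_strict_left_mono divide_strict_left_mono) auto
    moreover have "r = p + p * (1 / (q - 1))" "r2 = p + p * (1 / (q2 - 1))"
      using q2 q by (auto simp: r_def r2_def field_simps)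
    ultimately show ?thesis by linarith
  qed
  obtain C2 where C2: "0 \<le> C2" "\<And>u :: 'a \<Rightarrow> real. u \<in> W_space s p UNIV \<Longrightarrow> integrable lebesgue (\<lambda>x. \<bar>u x\<bar> powr r2)"
    "\<And>u :: 'a \<Rightarrow> real. u \<in> W_space s p UNIV \<Longrightarrow> (\<integral>x. \<bar>u x\<bar> powr r2 \<partial>lebesgue) powr (1 - 1 / q2)
       \<le> 1 * energy s p u + C2 * (\<integral>x. \<bar>u x\<bar> powr p \<partial>lebesgue)"
    unfolding r2_def using fractional_embedding[OF p s(1) q2(1,2) zero_less_one] by blast
  have v_r2: "(\<integral>x. \<bar>v k x\<bar> powr r2 \<partial>lebesgue) \<le> (M + C2) powr (q2 / (q2 - 1))" for k
  proof -
    have "(\<integral>x. \<bar>v k x\<bar> powr r2 \<partial>lebesgue) powr (1 - 1 / q2) \<le> M + C2"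
      using C2(3)[OF X_W[OF vX[of k]]] vE[of k] v1[of k] by (simp add: mass_def)
    then have "((\<integral>x. \<bar>v k x\<bar> powr r2 \<partial>lebesgue) powr (1 - 1 / q2)) powr (q2 / (q2 - 1)) \<le> (M + C2) powr (q2 / (q2 - 1))"
      using q2 by (intro powr_mono2) auto
    moreover have "(1 - 1 / q2) * (q2 / (q2 - 1)) = 1" using q2 by (simp add: field_simps)
    ultimately show ?thesis by (simp only: powr_powr) simp
  qed
  have finM: "finite_measure (lebesgue_on \<Omega>)"
    using bounded_domain by (intro finite_measure_lebesgue_on bounded_set_imp_lmeasurable) auto
  have conv: "integrable lebesgue (\<lambda>x. \<bar>f x\<bar> powr a)"
    "(\<lambda>k. \<integral>x. \<bar>v k x\<bar> powr a \<partial>lebesgue) \<longlonglongrightarrow> (\<integral>x. \<bar>f x\<bar> powr a \<partial>lebesgue)" if a: "0 < a" "a < r2" for a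
  proof -
    have z: "\<bar>v k x\<bar> powr b = 0" "\<bar>f x\<bar> powr b = 0" if "x \<notin> \<Omega>" for k x b
      using that X_zero[OF vX] f0 by auto
    have 1: "integrable (lebesgue_on \<Omega>) (\<lambda>x. \<bar>v k x\<bar> powr r2)" for k
      using integral_domain(2)[of "\<lambda>x. \<bar>v k x\<bar> powr r2"] z C2(2)[OF X_W[OF vX]] by simp
    have 2: "(\<integral>x. \<bar>v k x\<bar> powr r2 \<partial>lebesgue_on \<Omega>) \<le> (M + C2) powr (q2 / (q2 - 1))" for k
      using integral_domain(1)[of "\<lambda>x. \<bar>v k x\<bar> powr r2"] z v_r2 by simp
    have 3: "AE x in lebesgue_on \<Omega>. (\<lambda>k. v k x) \<longlonglongrightarrow> f x"
      using limv by (simp add: AE_restrict_space_iff eventually_mono)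
    note c = integral_abs_powr_convergence[OF finM a _ _ 1 2 3, OF measurable_restrict_space1 measurable_restrict_space1, OF fm vm]
    show "integrable lebesgue (\<lambda>x. \<bar>f x\<bar> powr a)"
      using c(1) integral_domain(2)[of "\<lambda>x. \<bar>f x\<bar> powr a"] z by simp
    show "(\<lambda>k. \<integral>x. \<bar>v k x\<bar> powr a \<partial>lebesgue) \<longlonglongrightarrow> (\<integral>x. \<bar>f x\<bar> powr a \<partial>lebesgue)"
      using c(2) integral_domain(1)[of "\<lambda>x. \<bar>f x\<bar> powr a"] integral_domain(1)[of "\<lambda>x. \<bar>v _ x\<bar> powr a"] z by simp
  qed
  have f1: "mass f = 1"
  proof -
    have "(\<lambda>k. mass (v k)) \<longlonglongrightarrow> mass f" unfolding mass_def using conv(2)[of p] p r_gt_p r2 by simp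
    then show ?thesis by (simp add: v1 LIMSEQ_const_iff)
  qed
  have dl: "(\<lambda>k. dual_norm (v k)) \<longlonglongrightarrow> dual_norm f"
    unfolding dual_norm_def using conv(2)[of r] p r_gt_p r2 q
    by (intro tendsto_powr' tendsto_const) (auto simp: field_simps)
  have rl: "(\<lambda>k. reduced_functional (v k)) \<longlonglongrightarrow> m"
  proof (rule tendsto_sandwich)
    show "\<forall>\<^sub>F k in sequentially. m \<le> reduced_functional (v k)" using m_le uA by (simp add: v_def)
    show "\<forall>\<^sub>F k in sequentially. reduced_functional (v k) \<le> m + inverse (real (Suc (\<theta> k)))"
      using u_lt by (simp add: v_def less_imp_le)
    have "(\<lambda>k. m + inverse (real (Suc k))) \<longlonglongrightarrow> m + 0"
      by (intro tendsto_intros LIMSEQ_inverse_real_of_nat)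
    then show "(\<lambda>k. m + inverse (real (Suc (\<theta> k)))) \<longlonglongrightarrow> m"
      using LIMSEQ_subseq_LIMSEQ[OF _ \<theta>] by (fastforce simp: o_def)
  qed simp
  have el: "(\<lambda>k. energy s p (v k)) \<longlonglongrightarrow> 2 * (m + dual_norm f)"
  proof -
    have "(\<lambda>k. 2 * (reduced_functional (v k) + dual_norm (v k))) \<longlonglongrightarrow> 2 * (m + dual_norm f)"
      by (intro tendsto_intros rl dl)
    then show ?thesis by (simp add: reduced_functional_def)
  qed
  have fE: "integrable (lebesgue \<Otimes>\<^sub>M lebesgue) (gagliardo_integrand s p f)"
    "energy s p f \<le> 2 * (m + dual_norm f)"
  proof -
    have "AE z in lebesgue \<Otimes>\<^sub>M lebesgue. (\<lambda>k. gagliardo_integrand s p (v k) z) \<longlonglongrightarrow> gagliardo_integrand s p f z"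
      using AE_pair_both[OF limv]
    proof eventually_elim
      case (elim z)
      then show ?case unfolding gagliardo_integrand_def split_beta using p
        by (cases "fst z = snd z") (auto intro!: tendsto_divide tendsto_powr' tendsto_rabs tendsto_diff)
    qed
    note F = fatou_limit[OF _ X_integrable_energy[OF vX] _ this el[unfolded energy_def]]
    show "integrable (lebesgue \<Otimes>\<^sub>M lebesgue) (gagliardo_integrand s p f)" by (rule F) auto
    show "energy s p f \<le> 2 * (m + dual_norm f)" unfolding energy_def by (rule F) auto
  qed
  have fX: "f \<in> W_tilde s p \<Omega>"
    using fm f0 fE(1) conv(1)[of p] p r_gt_p r2 open_domain by (simp add: W_tilde_iff W_space_UNIV_iff)
  \<comment> \<open>Taking absolute values does not increase the energy.\<close>
  define g where "g = (\<lambda>x. \<bar>f x\<bar>)"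
  have gX: "g \<in> W_tilde s p \<Omega>" unfolding g_def using W_tilde_abs[OF open_domain _ fX] p by simp
  have "energy s p g \<le> energy s p f"
    by (rule energy_mono[OF _ X_W[OF fX] X_W[OF gX]]) (use p in \<open>auto simp: g_def abs_triangle_ineq3\<close>)
  moreover have "dual_norm g = dual_norm f" "mass g = 1" using f1 by (simp_all add: g_def dual_norm_def mass_def)
  ultimately have "reduced_functional g \<le> m" using fE(2) by (simp add: reduced_functional_def)
  show ?thesis
  proof
    show "reduced_functional g \<le> reduced_functional w" if "w \<in> W_tilde s p \<Omega>" "mass w = 1" for w
      using that m_le[of w] \<open>reduced_functional g \<le> m\<close> by (simp add: A_def)
  qed (use gX \<open>mass g = 1\<close> in \<open>auto simp: g_def\<close>)
qed

section \<open>The optimal potential and first variations\<close>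

text \<open>
  The potential of unit \<open>L^q\<close> norm for which Hoelder's inequality against \<open>\<bar>u\<bar> powr p\<close> is an equality, with
  negative sign.
\<close>

definition optimal_potential :: "('a \<Rightarrow> real) \<Rightarrow> 'a \<Rightarrow> real" where
  "optimal_potential u = (\<lambda>x. - ((\<integral>x. \<bar>u x\<bar> powr r \<partial>lebesgue) powr (- 1 / q) * \<bar>u x\<bar> powr (p / (q - 1))))"

lemma optimal_potential_properties:
  assumes u: "u \<in> W_tilde s p \<Omega>" and nz: "mass u \<noteq> 0"
  shows "optimal_potential u \<in> Lq_unit_sphere q \<Omega>" (is ?A)
    and "Rayleigh (optimal_potential u) u = reduced_functional u" (is ?B)
proof -
  let ?V = "optimal_potential u"
  define J where "J = (\<integral>x. \<bar>u x\<bar> powr r \<partial>lebesgue)"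
  have um [measurable]: "u \<in> borel_measurable lebesgue" by (rule X_measurable[OF u])
  have umO: "u \<in> borel_measurable (lebesgue_on \<Omega>)" by (rule measurable_restrict_space1[OF um])
  have J0: "J \<noteq> 0"
  proof
    assume "J = 0"
    then have "AE x in lebesgue. \<bar>u x\<bar> powr r = 0"
      using X_integrable_r[OF u] by (simp add: J_def integral_nonneg_eq_0_iff_AE)
    then have "AE x in lebesgue. u x = 0" by eventually_elim simp
    then show False using nz mass_zero_iff[OF u] by simp
  qed
  moreover have "0 \<le> J" by (simp add: J_def)
  ultimately have J: "0 < J" by simp
  have JO: "(\<integral>x. \<bar>u x\<bar> powr r \<partial>lebesgue_on \<Omega>) = J" "integrable (lebesgue_on \<Omega>) (\<lambda>x. \<bar>u x\<bar> powr r)"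
    using integral_domain[of "\<lambda>x. \<bar>u x\<bar> powr r"] X_zero[OF u] X_integrable_r[OF u] by (auto simp: J_def)
  have Vx: "?V x = - (J powr (- 1 / q) * \<bar>u x\<bar> powr (p / (q - 1)))" for x
    by (simp add: optimal_potential_def J_def)
  have e1: "p / (q - 1) * q = r" "p / (q - 1) + p = r" using q by (auto simp: r_def field_simps)
  have Vq: "\<bar>?V x\<bar> powr q = \<bar>u x\<bar> powr r / J" for x
  proof -
    have "\<bar>?V x\<bar> powr q = (J powr (- 1 / q)) powr q * (\<bar>u x\<bar> powr (p / (q - 1))) powr q"
      by (simp add: Vx powr_mult abs_mult)
    also have "\<dots> = J powr (- 1) * \<bar>u x\<bar> powr r" unfolding powr_powr e1 using q by simp
    finally show ?thesis using J by (simp add: powr_minus field_simps)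
  qed
  have Vm: "?V \<in> borel_measurable (lebesgue_on \<Omega>)"
    unfolding optimal_potential_def using umO by measurable
  have "(\<integral>x. \<bar>?V x\<bar> powr q \<partial>lebesgue_on \<Omega>) = 1" using J JO(1) by (simp add: Vq)
  moreover have "integrable (lebesgue_on \<Omega>) (\<lambda>x. \<bar>?V x\<bar> powr q)" using JO(2) by (simp add: Vq)
  ultimately show ?A
    using Vm q by (simp add: Lq_unit_sphere_def Lp_space_def Lp_norm_eq_1_iff)
  have "?V x * \<bar>u x\<bar> powr p = - (J powr (- 1 / q)) * \<bar>u x\<bar> powr r" for x
    using powr_add[of "\<bar>u x\<bar>" "p / (q - 1)" p] by (simp add: Vx e1)
  then have "(\<integral>x. ?V x * \<bar>u x\<bar> powr p \<partial>lebesgue_on \<Omega>) = - (J powr (- 1 / q)) * J"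
    using JO(1) by (simp add: mult.commute)
  also have "\<dots> = - (J powr (1 - 1 / q))"
    using J powr_add[of J "- 1 / q" 1] by simp
  finally show ?B
    by (simp add: Rayleigh_def reduced_functional_def dual_norm_def J_def)
qed

lemma Lq_unit_sphere_subset_ball: "V \<in> Lq_unit_sphere q \<Omega> \<Longrightarrow> V \<in> Lq_unit_ball q \<Omega>"
  by (simp add: Lq_unit_sphere_def Lq_unit_ball_def)

lemma Rayleigh_homogeneous_bound:
  assumes V: "V \<in> Lp_space q \<Omega>"
    and min: "\<And>v. v \<in> W_tilde s p \<Omega> \<Longrightarrow> mass v = 1 \<Longrightarrow> \<mu> \<le> Rayleigh V v"
    and w: "w \<in> W_tilde s p \<Omega>"
  shows "\<mu> * mass w \<le> Rayleigh V w"
proof (cases "mass w = 0")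
  case True
  then have "AE x in lebesgue. w x = 0" using mass_zero_iff[OF w] by simp
  then have "AE x in lebesgue_on \<Omega>. V x * \<bar>w x\<bar> powr p = 0"
    by (simp add: AE_restrict_space_iff) (auto elim: eventually_mono)
  then have "(\<integral>x. V x * \<bar>w x\<bar> powr p \<partial>lebesgue_on \<Omega>) = 0" by (rule integral_eq_zero_AE)
  then show ?thesis using True by (simp add: Rayleigh_def)
next
  case False
  define c where "c = mass w powr (- 1 / p)"
  note n = normalize[OF w False, folded c_def]
  have "\<mu> \<le> c powr p * Rayleigh V w" using min[OF n(1,2)] n(4) by (simp add: scale_Rayleigh)
  then have "\<mu> * mass w \<le> c powr p * Rayleigh V w * mass w" by (rule mult_right_mono) simp
  also have "\<dots> = Rayleigh V w" using n(3) by (simp add: mult_ac)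
  finally show ?thesis .
qed

lemma energy_weighted:
  "gagliardo_integrand s p u z
    = (1 / norm (fst z - snd z) powr (real DIM('a) + s * p)) * \<bar>u (fst z) - u (snd z)\<bar> powr p"
  for u :: "'a \<Rightarrow> real"
  by (simp add: gagliardo_integrand_def split_beta)

text \<open>
  A minimizer satisfies the eigenvalue equation against every test function: along the line \<open>u + t v\<close> the function
  \<open>Rayleigh V w - \<mu> * mass w\<close> is nonnegative and vanishes at \<open>t = 0\<close>.
\<close>

lemma Euler_Lagrange:
  assumes V: "V \<in> Lp_space q \<Omega>"
    and ge: "\<And>w. w \<in> W_tilde s p \<Omega> \<Longrightarrow> \<mu> * mass w \<le> Rayleigh V w"
    and u: "u \<in> W_tilde s p \<Omega>" and eq: "Rayleigh V u = \<mu> * mass u" and v: "v \<in> W_tilde s p \<Omega>"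
  shows "H_form s p u v + (\<integral>x. V x * \<bar>u x\<bar> powr (p - 2) * u x * v x \<partial>lebesgue_on \<Omega>)
          = \<mu> * (\<integral>x. \<bar>u x\<bar> powr (p - 2) * u x * v x \<partial>lebesgue)"
proof -
  have um [measurable]: "u \<in> borel_measurable lebesgue" "v \<in> borel_measurable lebesgue"
    using u v by (auto intro: X_measurable)
  have umO: "u \<in> borel_measurable (lebesgue_on \<Omega>)" "v \<in> borel_measurable (lebesgue_on \<Omega>)"
    by (rule measurable_restrict_space1, fact um)+
  have Vm: "V \<in> borel_measurable (lebesgue_on \<Omega>)" using V by (simp add: Lp_space_def)
  let ?P = "(lebesgue :: 'a measure) \<Otimes>\<^sub>M (lebesgue :: 'a measure)"
  let ?k = "\<lambda>z::'a \<times> 'a. 1 / norm (fst z - snd z) powr (real DIM('a) + s * p)"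
  let ?d = "\<lambda>u (z::'a \<times> 'a). u (fst z) - u (snd z) :: real"
  have D1: "((\<lambda>t. \<integral>z. ?k z * \<bar>?d u z + t * ?d v z\<bar> powr p \<partial>?P) has_real_derivative
      p * (\<integral>z. ?k z * (\<bar>?d u z\<bar> powr (p - 2) * ?d u z) * ?d v z \<partial>?P)) (at 0)"
  proof (rule has_derivative_integral_abs_powr(2)[OF p])
    show "integrable ?P (\<lambda>z. ?k z * \<bar>?d u z\<bar> powr p)" "integrable ?P (\<lambda>z. ?k z * \<bar>?d v z\<bar> powr p)"
      unfolding energy_weighted[symmetric] using X_integrable_energy[OF u] X_integrable_energy[OF v] by auto
  qed measurable
  have D2: "((\<lambda>t. \<integral>x. V x * \<bar>u x + t * v x\<bar> powr p \<partial>lebesgue_on \<Omega>) has_real_derivative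
      p * (\<integral>x. V x * (\<bar>u x\<bar> powr (p - 2) * u x) * v x \<partial>lebesgue_on \<Omega>)) (at 0)"
    by (rule has_derivative_integral_abs_powr(2)[OF p Vm umO potential_bound(1)[OF V u] potential_bound(1)[OF V v]])
  have D3: "((\<lambda>t. \<integral>x. 1 * \<bar>u x + t * v x\<bar> powr p \<partial>lebesgue) has_real_derivative
      p * (\<integral>x. 1 * (\<bar>u x\<bar> powr (p - 2) * u x) * v x \<partial>lebesgue)) (at 0)"
    by (rule has_derivative_integral_abs_powr(2)[OF p])
      (use X_integrable_p[OF u] X_integrable_p[OF v] in auto)
  define h where "h = (\<lambda>t. Rayleigh V (\<lambda>x. u x + t * v x) - \<mu> * mass (\<lambda>x. u x + t * v x))"
  define h' where "h' = (p * (\<integral>z. ?k z * (\<bar>?d u z\<bar> powr (p - 2) * ?d u z) * ?d v z \<partial>?P)) / 2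
      + p * (\<integral>x. V x * (\<bar>u x\<bar> powr (p - 2) * u x) * v x \<partial>lebesgue_on \<Omega>)
      - \<mu> * (p * (\<integral>x. 1 * (\<bar>u x\<bar> powr (p - 2) * u x) * v x \<partial>lebesgue))"
  have en: "energy s p (\<lambda>x. u x + t * v x) = (\<integral>z. ?k z * \<bar>?d u z + t * ?d v z\<bar> powr p \<partial>?P)" for t
    unfolding energy_def energy_weighted by (simp add: algebra_simps)
  have "(h has_real_derivative h') (at 0)"
    unfolding h_def h'_def Rayleigh_def mass_def en
    using DERIV_diff[OF DERIV_add[OF DERIV_cdivide[OF D1, of 2] D2] DERIV_cmult[OF D3, of \<mu>]] by simp
  moreover have "h 0 \<le> h t" for t
  proof -
    have "h 0 = 0" using eq by (simp add: h_def)
    moreover have "(\<lambda>x. u x + t * v x) \<in> W_tilde s p \<Omega>"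
      using W_tilde_lincomb[OF open_domain _ u v, of 1 t] p by simp
    ultimately show ?thesis using ge by (simp add: h_def)
  qed
  ultimately have "h' = 0" by (intro DERIV_local_min[of h h' 0 1]) auto
  then have "p * ((\<integral>z. ?k z * (\<bar>?d u z\<bar> powr (p - 2) * ?d u z) * ?d v z \<partial>?P) / 2
      + (\<integral>x. V x * (\<bar>u x\<bar> powr (p - 2) * u x) * v x \<partial>lebesgue_on \<Omega>)
      - \<mu> * (\<integral>x. 1 * (\<bar>u x\<bar> powr (p - 2) * u x) * v x \<partial>lebesgue)) = 0"
    by (simp add: h'_def algebra_simps)
  then have "(\<integral>z. ?k z * (\<bar>?d u z\<bar> powr (p - 2) * ?d u z) * ?d v z \<partial>?P) / 2
      + (\<integral>x. V x * (\<bar>u x\<bar> powr (p - 2) * u x) * v x \<partial>lebesgue_on \<Omega>)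
      = \<mu> * (\<integral>x. (\<bar>u x\<bar> powr (p - 2) * u x) * v x \<partial>lebesgue)" using p by simp
  moreover have "H_form s p u v = (\<integral>z. ?k z * (\<bar>?d u z\<bar> powr (p - 2) * ?d u z) * ?d v z \<partial>?P) / 2"
    by (simp add: H_form_def case_prod_beta')
  ultimately show ?thesis by (simp add: mult.assoc)
qed

lemma abs_powr_mult_self: "\<bar>d\<bar> powr (a - 2) * d * d = \<bar>d\<bar> powr a" for a d :: real
proof (cases "d = 0")
  case False
  then have "d * d = \<bar>d\<bar> powr 2" by (simp add: powr_numeral power2_eq_square)
  then have "\<bar>d\<bar> powr (a - 2) * d * d = \<bar>d\<bar> powr (a - 2) * \<bar>d\<bar> powr 2" by (simp only: mult.assoc)
  also have "\<dots> = \<bar>d\<bar> powr (a - 2 + 2)" by (rule powr_add[symmetric])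
  finally show ?thesis by simp
qed simp

lemma H_form_diag: "H_form s p u u = energy s p u / 2" for u :: "'a \<Rightarrow> real"
proof -
  have "\<bar>d\<bar> powr (p - 2) * d * d = \<bar>d\<bar> powr p" for d :: real
    by (rule abs_powr_mult_self)
  then show ?thesis by (simp add: H_form_def energy_def gagliardo_integrand_def case_prod_beta')
qed

lemma eigenfunction_Rayleigh:
  assumes "eigenfunction s p \<Omega> V \<mu> u"
  shows "Rayleigh V u = \<mu> * mass u"
proof -
  have d: "\<bar>d\<bar> powr (p - 2) * d * d = \<bar>d\<bar> powr p" for d :: real
    by (rule abs_powr_mult_self)
  have d': "c * \<bar>d\<bar> powr (p - 2) * d * d = c * \<bar>d\<bar> powr p" for c d :: real
    using d[of d] by (simp add: mult.assoc)
  have "u \<in> W_tilde s p \<Omega>" using assms by (simp add: eigenfunction_def)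
  then have "H_form s p u u + (\<integral>x. V x * \<bar>u x\<bar> powr (p - 2) * u x * u x \<partial>lebesgue_on \<Omega>)
          = \<mu> * (\<integral>x. \<bar>u x\<bar> powr (p - 2) * u x * u x \<partial>lebesgue)"
    using assms by (simp add: eigenfunction_def)
  then show ?thesis unfolding d d' H_form_diag by (simp add: Rayleigh_def mass_def)
qed

text \<open>
  For \<open>W\<close> tangent at \<open>V\<close>, the \<open>L^q\<close> norm \<open>N t\<close> of \<open>V + t W\<close> has derivative \<open>0\<close> at \<open>t = 0\<close>. Comparing \<open>V\<close> with the
  normalized potentials \<open>(V + t W) / N t\<close> therefore forces the derivative of \<open>\<integral> (V + t W) \<bar>u\<bar> powr p\<close> to vanish.
\<close>

lemma tangent_orthogonality:
  assumes V: "V \<in> Lq_unit_sphere q \<Omega>" and W: "W \<in> tangent_space q \<Omega> V"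
    and u: "u \<in> W_tilde s p \<Omega>"
    and min: "\<And>Z. Z \<in> Lq_unit_ball q \<Omega> \<Longrightarrow> Rayleigh V u \<le> Rayleigh Z u"
  shows "(\<integral>x. W x * \<bar>u x\<bar> powr p \<partial>lebesgue_on \<Omega>) = 0"
proof -
  have V': "V \<in> Lp_space q \<Omega>" and W': "W \<in> Lp_space q \<Omega>"
    using V W by (auto simp: Lq_unit_sphere_def tangent_space_def)
  have Vm: "V \<in> borel_measurable (lebesgue_on \<Omega>)" "integrable (lebesgue_on \<Omega>) (\<lambda>x. 1 * \<bar>V x\<bar> powr q)"
    and Wm: "W \<in> borel_measurable (lebesgue_on \<Omega>)" "integrable (lebesgue_on \<Omega>) (\<lambda>x. 1 * \<bar>W x\<bar> powr q)"
    using V' W' by (auto simp: Lp_space_def)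
  have m1: "(\<lambda>x. 1::real) \<in> borel_measurable (lebesgue_on \<Omega>)" by simp
  define S where "S = (\<lambda>t. \<integral>x. 1 * \<bar>V x + t * W x\<bar> powr q \<partial>lebesgue_on \<Omega>)"
  have S0: "S 0 = 1" using V q by (simp add: S_def Lq_unit_sphere_def Lp_norm_eq_1_iff)
  have W0: "(\<integral>x. 1 * (\<bar>V x\<bar> powr (q - 2) * V x) * W x \<partial>lebesgue_on \<Omega>) = 0"
    using W by (simp add: tangent_space_def)
  have DS: "(S has_real_derivative 0) (at 0)"
    using has_derivative_integral_abs_powr(2)[OF q(1) m1 Vm(1) Wm(1) Vm(2) Wm(2)] unfolding W0 S_def by simp
  have Sint: "integrable (lebesgue_on \<Omega>) (\<lambda>x. \<bar>V x + t * W x\<bar> powr q)" for t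
    using has_derivative_integral_abs_powr(1)[OF q(1) m1 Vm(1) Wm(1) Vm(2) Wm(2)] by simp
  define N where "N = (\<lambda>t. S t powr (1 / q))"
  have "((\<lambda>t. S t powr (1 / q)) has_real_derivative (1 / q) * S 0 powr (1 / q - 1) * 0) (at 0)"
    by (rule DERIV_chain2[OF has_real_derivative_powr DS]) (simp add: S0)
  then have DN: "(N has_real_derivative 0) (at 0)" by (simp add: N_def)
  define A where "A = (\<integral>x. V x * \<bar>u x\<bar> powr p \<partial>lebesgue_on \<Omega>)"
  define B where "B = (\<integral>x. W x * \<bar>u x\<bar> powr p \<partial>lebesgue_on \<Omega>)"
  define h where "h = (\<lambda>t. A + t * B - N t * A)"
  have "(h has_real_derivative (0 + (1 * B) - 0 * A)) (at 0)"
    unfolding h_def by (intro DERIV_diff DERIV_add DERIV_const DERIV_cmult_right DERIV_ident DN)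
  then have Dh: "(h has_real_derivative B) (at 0)" by simp
  have "isCont S 0" using DS by (rule DERIV_isCont)
  then have "eventually (\<lambda>t. 0 < S t) (at 0)"
    using S0 by (intro order_tendstoD(1)[of S 1]) (auto simp: isCont_def)
  then obtain e where e: "0 < e" "\<And>t. t \<noteq> 0 \<Longrightarrow> \<bar>t\<bar> < e \<Longrightarrow> 0 < S t"
    by (auto simp: eventually_at dist_real_def)
  have "h 0 \<le> h t" if "\<bar>0 - t\<bar> < e" for t
  proof -
    \<comment> \<open>For small \<open>t\<close> the potential \<open>V + t W\<close> can be normalized.\<close>
    have St: "0 < S t" using e(2)[of t] that S0 by (cases "t = 0") auto
    then have Nt: "0 < N t" by (simp add: N_def)
    have Nq: "N t powr q = S t" using St q by (simp add: N_def powr_powr)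
    define Z where "Z = (\<lambda>x. (V x + t * W x) / N t)"
    have Zq: "\<bar>Z x\<bar> powr q = \<bar>V x + t * W x\<bar> powr q / S t" for x
      using Nt by (simp add: Z_def powr_divide Nq)
    have "Z \<in> borel_measurable (lebesgue_on \<Omega>)" unfolding Z_def using Vm(1) Wm(1) by measurable
    moreover have "integrable (lebesgue_on \<Omega>) (\<lambda>x. \<bar>Z x\<bar> powr q)" unfolding Zq using Sint by simp
    moreover have "(\<integral>x. \<bar>Z x\<bar> powr q \<partial>lebesgue_on \<Omega>) = 1" unfolding Zq using St by (simp add: S_def)
    ultimately have "Z \<in> Lq_unit_sphere q \<Omega>" using q by (simp add: Lq_unit_sphere_def Lp_space_def Lp_norm_eq_1_iff)
    then have "Rayleigh V u \<le> Rayleigh Z u" by (intro min Lq_unit_sphere_subset_ball)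
    then have "A \<le> (\<integral>x. Z x * \<bar>u x\<bar> powr p \<partial>lebesgue_on \<Omega>)" by (simp add: Rayleigh_def A_def)
    also have "\<dots> = (\<integral>x. (V x * \<bar>u x\<bar> powr p + t * (W x * \<bar>u x\<bar> powr p)) / N t \<partial>lebesgue_on \<Omega>)"
      by (simp add: Z_def algebra_simps)
    also have "\<dots> = (A + t * B) / N t"
      using potential_bound(1)[OF V' u] potential_bound(1)[OF W' u] by (simp add: A_def B_def)
    finally have "N t * A \<le> A + t * B" using Nt by (simp add: field_simps)
    then have "0 \<le> h t" by (simp add: h_def)
    moreover have "h 0 = 0" by (simp add: h_def N_def S0)
    ultimately show ?thesis by simp
  qed
  then have "B = 0" using DERIV_local_min[OF Dh e(1)] by blast
  then show ?thesis by (simp add: B_def)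
qed

section \<open>Strict positivity of minimizers\<close>

lemma positive_superlevel:
  assumes u: "u \<in> W_tilde s p \<Omega>" and u0: "\<And>x. 0 \<le> u x" and nz: "mass u \<noteq> 0"
  obtains \<delta> where "0 < \<delta>" "0 < measure lebesgue {x \<in> \<Omega>. \<delta> \<le> u x}"
proof -
  have um [measurable]: "u \<in> borel_measurable lebesgue" by (rule X_measurable[OF u])
  have fm: "{x \<in> \<Omega>. d \<le> u x} \<in> lmeasurable" for d
  proof (rule bounded_set_imp_lmeasurable)
    show "bounded {x \<in> \<Omega>. d \<le> u x}" using bounded_domain by (rule bounded_subset) auto
    have "{x \<in> \<Omega>. d \<le> u x} = \<Omega> \<inter> {x \<in> space lebesgue. d \<le> u x}" by auto
    also have "\<dots> \<in> sets lebesgue" by (intro sets.Int borel_measurable_le) auto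
    finally show "{x \<in> \<Omega>. d \<le> u x} \<in> sets lebesgue" .
  qed
  have "\<exists>k::nat. measure lebesgue {x \<in> \<Omega>. inverse (real (Suc k)) \<le> u x} \<noteq> 0"
  proof (rule ccontr)
    assume "\<nexists>k::nat. measure lebesgue {x \<in> \<Omega>. inverse (real (Suc k)) \<le> u x} \<noteq> 0"
    then have "negligible {x \<in> \<Omega>. inverse (real (Suc k)) \<le> u x}" for k
      using fm[of "inverse (real (Suc k))"] negligible_iff_measure by blast
    then have "negligible (\<Union>k. {x \<in> \<Omega>. inverse (real (Suc k)) \<le> u x})" by (rule negligible_Union_nat)
    moreover have "(\<Union>k. {x \<in> \<Omega>. inverse (real (Suc k)) \<le> u x}) = {x. u x \<noteq> 0}"
    proof (safe)
      fix x assume "u x \<noteq> 0"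
      then have pos: "0 < u x" "x \<in> \<Omega>" using u0[of x] X_zero[OF u, of x] by auto
      then obtain k where "inverse (real (Suc k)) < u x" using reals_Archimedean by blast
      then show "x \<in> (\<Union>k. {x \<in> \<Omega>. inverse (real (Suc k)) \<le> u x})" using pos by (auto intro: less_imp_le)
    next
      fix x k assume "inverse (real (Suc k)) \<le> u x" "u x = 0"
      moreover have "0 < inverse (real (Suc k))" by simp
      ultimately show False by linarith
    qed
    ultimately have "AE x in lebesgue. x \<notin> {x. u x \<noteq> 0}"
      using AE_not_in negligible_iff_null_sets by metis
    then show False using nz mass_zero_iff[OF u] by simp
  qed
  then obtain k :: nat where "measure lebesgue {x \<in> \<Omega>. inverse (real (Suc k)) \<le> u x} \<noteq> 0" by blast
  then show ?thesis using that[of "inverse (real (Suc k))"] measure_nonneg[of lebesgue "{x \<in> \<Omega>. inverse (real (Suc k)) \<le> u x}"]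
    by (simp add: order_less_le)
qed

lemma non_null_in_small_ball:
  assumes Z: "Z \<in> sets lebesgue" "Z \<subseteq> \<Omega>" "\<not> negligible Z" and R0: "0 < R0"
  obtains x0 R where "0 < R" "R \<le> R0" "ball x0 R \<subseteq> \<Omega>" "\<not> negligible (Z \<inter> ball x0 (R / 2))"
proof (rule ccontr)
  note found = that
  assume no: "\<not> thesis"
  have "\<exists>R. 0 < R \<and> R \<le> R0 \<and> ball x R \<subseteq> \<Omega>" if x: "x \<in> \<Omega>" for x
  proof -
    obtain R where "0 < R" "ball x R \<subseteq> \<Omega>" using x open_domain by (meson open_contains_ball)
    then show ?thesis using R0 by (intro exI[of _ "min R R0"]) auto
  qed
  then obtain R where R: "\<And>x. x \<in> \<Omega> \<Longrightarrow> 0 < R x" "\<And>x. x \<in> \<Omega> \<Longrightarrow> R x \<le> R0" "\<And>x. x \<in> \<Omega> \<Longrightarrow> ball x (R x) \<subseteq> \<Omega>"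
    by metis
  have null: "negligible (Z \<inter> ball x (R x / 2))" if "x \<in> \<Omega>" for x
    using no found[OF R[OF that]] by blast
  obtain F where F: "F \<subseteq> (\<lambda>x. ball x (R x / 2)) ` \<Omega>" "countable F" "\<Union>F = \<Union>((\<lambda>x. ball x (R x / 2)) ` \<Omega>)"
    using Lindelof[of "(\<lambda>x. ball x (R x / 2)) ` \<Omega>"] by auto
  have "Z \<subseteq> (\<Union>B\<in>F. Z \<inter> B)"
  proof
    fix x assume "x \<in> Z"
    then have "x \<in> \<Union>F" using F(3) Z(2) R(1) by fastforce
    then show "x \<in> (\<Union>B\<in>F. Z \<inter> B)" using \<open>x \<in> Z\<close> by auto
  qed
  moreover have "negligible (\<Union>B\<in>F. Z \<inter> B)"
    using F(1,2) null by (intro negligible_countable_Union) auto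
  ultimately show False using Z(3) negligible_subset by blast
qed

text \<open>
  The quantitative form of submodularity at a pair of points where one function has the values \<open>0\<close> and \<open>b\<close>, and
  the other one has the values \<open>c\<close> and \<open>0\<close>.
\<close>

lemma lattice_gap:
  fixes b c :: real
  assumes "0 \<le> c" "c \<le> \<delta>" "\<delta> \<le> b" "1 \<le> p"
  shows "\<bar>c - b\<bar> powr p + c * \<delta> powr (p - 1) \<le> b powr p"
proof (cases "b = 0")
  case False
  have b: "0 < b" using False assms by linarith
  have "(b - c) powr p \<le> (b - c) * b powr (p - 1)"
  proof (cases "b = c")
    case False
    then have "(b - c) powr p = (b - c) * (b - c) powr (p - 1)"
      using assms powr_add[of "b - c" 1 "p - 1"] by simp
    also have "\<dots> \<le> (b - c) * b powr (p - 1)"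
      using assms by (intro mult_mono powr_mono2) auto
    finally show ?thesis .
  qed auto
  also have "\<dots> = b powr p - c * b powr (p - 1)"
    using b powr_add[of b 1 "p - 1"] by (simp add: algebra_simps)
  also have "\<dots> \<le> b powr p - c * \<delta> powr (p - 1)"
    using assms by (intro diff_left_mono mult_left_mono powr_mono2) auto
  finally show ?thesis using assms by (simp add: abs_minus_commute)
next
  case True
  then have "c = 0" using assms by linarith
  then show ?thesis using True by simp
qed

text \<open>
  Strict positivity. If \<open>u\<close> vanished on a set of positive measure, one could compare it with \<open>\<psi> = \<epsilon> \<phi>\<close> for a
  small tent \<open>\<phi>\<close> centred near that set. Submodularity applied to the maximum and the minimum of \<open>u\<close> and \<open>\<psi>\<close> has
  a gap of order \<open>\<epsilon>\<close>, caused by pairs of a zero of \<open>u\<close> inside the tent and a point outside the tent where \<open>u\<close>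
  is bounded below, whereas the tent costs only an amount of order \<open>\<epsilon> powr p\<close>. Since the interaction is nonlocal,
  \<open>\<Omega>\<close> need not be connected.
\<close>

lemma minimizer_positive:
  assumes V: "V \<in> Lp_space q \<Omega>"
    and ge: "\<And>w. w \<in> W_tilde s p \<Omega> \<Longrightarrow> \<mu> * mass w \<le> Rayleigh V w"
    and u: "u \<in> W_tilde s p \<Omega>" and eq: "Rayleigh V u = \<mu> * mass u"
    and u0: "\<And>x. 0 \<le> u x" and nz: "mass u \<noteq> 0"
  shows "AE x in lebesgue_on \<Omega>. 0 < u x"
proof (rule ccontr)
  assume neg: "\<not> (AE x in lebesgue_on \<Omega>. 0 < u x)"
  have um [measurable]: "u \<in> borel_measurable lebesgue" by (rule X_measurable[OF u])
  define e where "e = real DIM('a) + s * p"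
  have e: "0 < e" using s p by (simp add: e_def add_pos_pos)
  define Z where "Z = {x \<in> \<Omega>. u x \<le> 0}"
  have "Z = \<Omega> \<inter> {x \<in> space lebesgue. u x \<le> 0}" by (auto simp: Z_def)
  also have "\<dots> \<in> sets lebesgue" by (intro sets.Int borel_measurable_le) auto
  finally have Zm [measurable]: "Z \<in> sets lebesgue" .
  have Zn: "\<not> negligible Z"
  proof
    assume "negligible Z"
    then have "AE x in lebesgue. x \<notin> Z" by (simp add: AE_not_in negligible_iff_null_sets)
    then have "AE x in lebesgue_on \<Omega>. 0 < u x"
      by (simp add: AE_restrict_space_iff Z_def) (auto elim: eventually_mono)
    then show False using neg by simp
  qed
  obtain \<delta> where \<delta>: "0 < \<delta>" "0 < measure lebesgue {x \<in> \<Omega>. \<delta> \<le> u x}"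
    by (rule positive_superlevel[OF u u0 nz])
  define P where "P = {x \<in> \<Omega>. \<delta> \<le> u x}"
  have "P = \<Omega> \<inter> {x \<in> space lebesgue. \<delta> \<le> u x}" by (auto simp: P_def)
  also have "\<dots> \<in> sets lebesgue" by (intro sets.Int borel_measurable_le) auto
  finally have Pm [measurable]: "P \<in> sets lebesgue" .
  have mP: "0 < measure lebesgue P" using \<delta> by (simp add: P_def)
  define \<omega> where "\<omega> = unit_ball_vol (real DIM('a))"
  have \<omega>: "0 < \<omega>" by (simp add: \<omega>_def)
  \<comment> \<open>A ball of radius at most \<open>R0\<close> has at most half the measure of \<open>P\<close>.\<close>
  define R0 where "R0 = min 1 (measure lebesgue P / (2 * \<omega>))"
  have R0: "0 < R0" "R0 \<le> 1" using mP \<omega> by (auto simp: R0_def)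
  obtain x0 R where R: "0 < R" "R \<le> R0" "ball x0 R \<subseteq> \<Omega>" and AZ: "\<not> negligible (Z \<inter> ball x0 (R / 2))"
    by (rule non_null_in_small_ball[OF Zm _ Zn R0(1)]) (auto simp: Z_def)
  have R1: "R \<le> 1" using R R0 by simp
  define A where "A = Z \<inter> ball x0 (R / 2)"
  define B where "B = P - ball x0 R"
  have Am [measurable]: "A \<in> sets lebesgue" and Bm [measurable]: "B \<in> sets lebesgue"
    by (auto simp: A_def B_def)
  have fin: "S \<in> lmeasurable" if "S \<subseteq> \<Omega>" "S \<in> sets lebesgue" for S
    using that bounded_domain by (intro bounded_set_imp_lmeasurable) (auto intro: bounded_subset)
  have Afin: "A \<in> lmeasurable" by (rule fin) (auto simp: A_def Z_def)
  have Bfin: "B \<in> lmeasurable" by (rule fin) (auto simp: B_def P_def)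
  have Pfin: "P \<in> lmeasurable" by (rule fin) (auto simp: P_def)
  have mA: "0 < measure lebesgue A"
    using AZ Afin negligible_iff_measure[of A] measure_nonneg[of lebesgue A] by (auto simp: A_def order_less_le)
  have mB: "0 < measure lebesgue B"
  proof -
    have "measure lebesgue (ball x0 R) = \<omega> * R ^ DIM('a)" using R(1) by (simp add: content_ball \<omega>_def)
    also have "\<dots> \<le> \<omega> * R"
      using R(1) R1 \<omega> power_decreasing[of 1 "DIM('a)" R] by (intro mult_left_mono) auto
    also have "\<dots> \<le> \<omega> * (measure lebesgue P / (2 * \<omega>))"
      using R(2) \<omega> by (intro mult_left_mono) (auto simp: R0_def)
    also have "\<dots> < measure lebesgue P" using \<omega> mP by simp
    finally have "measure lebesgue (ball x0 R) < measure lebesgue P" .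
    moreover have "measure lebesgue P \<le> measure lebesgue (B \<union> ball x0 R)"
      by (rule measure_mono_fmeasurable) (use Pfin in \<open>auto simp: B_def intro!: fmeasurable.Un\<close>)
    moreover have "measure lebesgue (B \<union> ball x0 R) \<le> measure lebesgue B + measure lebesgue (ball x0 R)"
      by (rule measure_Un_le) auto
    ultimately show ?thesis by linarith
  qed
  obtain D where D: "0 < D" "\<And>x y. x \<in> \<Omega> \<Longrightarrow> y \<in> \<Omega> \<Longrightarrow> norm (x - y) \<le> D"
  proof -
    obtain b where b: "\<And>x. x \<in> \<Omega> \<Longrightarrow> norm x \<le> b" "0 < b" using bounded_domain by (auto simp: bounded_pos)
    show ?thesis
    proof (rule that[of "2 * b"])
      show "norm (x - y) \<le> 2 * b" if "x \<in> \<Omega>" "y \<in> \<Omega>" for x y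
        using norm_triangle_ineq4[of x y] b(1)[OF that(1)] b(1)[OF that(2)] by linarith
    qed (use b in auto)
  qed
  define \<phi> where "\<phi> = (\<lambda>x. max 0 (R - dist x x0))"
  have \<phi>X: "\<phi> \<in> W_tilde s p \<Omega>" unfolding \<phi>_def by (rule tent_in_X[OF R(1) R1 R(3)])
  have \<phi>0: "0 \<le> \<phi> x" "\<phi> x \<le> 1" for x
    unfolding \<phi>_def by (simp, rule max.boundedI) (use R1 zero_le_dist[of x x0] in linarith)+
  define c where "c = R / 2 * \<delta> powr (p - 1) / D powr e"
  have c: "0 < c" using R \<delta> D by (simp add: c_def)
  define \<kappa> where "\<kappa> = measure lebesgue A * measure lebesgue B"
  have \<kappa>: "0 < \<kappa>" using mA mB by (simp add: \<kappa>_def)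
  let ?L = "(lebesgue :: 'a measure) \<Otimes>\<^sub>M (lebesgue :: 'a measure)"
  have AB: "integrable ?L (indicator (A \<times> B) :: 'a \<times> 'a \<Rightarrow> real)" "(\<integral>z. indicator (A \<times> B) z \<partial>?L) = \<kappa>"
  proof -
    have em: "emeasure ?L (A \<times> B) = ennreal \<kappa>"
      using Afin Bfin
      by (simp add: lebesgue.emeasure_pair_measure_Times emeasure_eq_measure2 \<kappa>_def ennreal_mult del: emeasure_completion)
    then show "integrable ?L (indicator (A \<times> B) :: 'a \<times> 'a \<Rightarrow> real)"
      by (intro integrable_real_indicator) auto
    show "(\<integral>z. indicator (A \<times> B) z \<partial>?L) = \<kappa>"
      using em \<kappa> by (simp add: measure_def space_pair_measure)
  qed
  \<comment> \<open>\<open>EE\<close> is nonnegative and vanishes at \<open>u\<close>; its terms other than the energy are additive on maximum and minimum.\<close>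
  define EE where "EE = (\<lambda>w. Rayleigh V w - \<mu> * mass w)"
  have key: "\<epsilon> * (c * \<kappa> / 2) \<le> \<epsilon> powr p * EE \<phi>" if eps: "0 < \<epsilon>" "\<epsilon> \<le> \<delta>" for \<epsilon>
  proof -
    define \<psi> where "\<psi> = (\<lambda>x. \<epsilon> * \<phi> x)"
    have \<psi>X: "\<psi> \<in> W_tilde s p \<Omega>" unfolding \<psi>_def by (rule X_scale[OF \<phi>X])
    have \<psi>0: "0 \<le> \<psi> x" "\<psi> x \<le> \<delta>" for x
    proof -
      show "0 \<le> \<psi> x" using eps \<phi>0 by (simp add: \<psi>_def)
      have "\<epsilon> * \<phi> x \<le> \<epsilon> * 1" using eps \<phi>0 by (intro mult_left_mono) auto
      then show "\<psi> x \<le> \<delta>" using eps(2) unfolding \<psi>_def by linarith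
    qed
    define w1 where "w1 = (\<lambda>x. max (u x) (\<psi> x))"
    define w2 where "w2 = (\<lambda>x. min (u x) (\<psi> x))"
    have p0: "0 < p" using p by simp
    have w1X: "w1 \<in> W_tilde s p \<Omega>" unfolding w1_def by (rule W_tilde_max[OF open_domain p0 u \<psi>X])
    have w2X: "w2 \<in> W_tilde s p \<Omega>" unfolding w2_def by (rule W_tilde_min[OF open_domain p0 u \<psi>X])
    have pt: "gagliardo_integrand s p w1 z + gagliardo_integrand s p w2 z + \<epsilon> * c * indicator (A \<times> B) z
        \<le> gagliardo_integrand s p u z + gagliardo_integrand s p \<psi> z" for z
    proof -
      obtain x y where z: "z = (x, y)" by (cases z)
      let ?n = "norm (x - y) powr e"
      have sub: "\<bar>w1 x - w1 y\<bar> powr p + \<bar>w2 x - w2 y\<bar> powr p \<le> \<bar>u x - u y\<bar> powr p + \<bar>\<psi> x - \<psi> y\<bar> powr p"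
        unfolding w1_def w2_def using p by (intro abs_powr_submodular) auto
      have "\<bar>w1 x - w1 y\<bar> powr p + \<bar>w2 x - w2 y\<bar> powr p + \<epsilon> * (R / 2) * \<delta> powr (p - 1) * indicator (A \<times> B) z
         \<le> \<bar>u x - u y\<bar> powr p + \<bar>\<psi> x - \<psi> y\<bar> powr p"
      proof (cases "x \<in> A \<and> y \<in> B")
        case True
        have ux: "u x = 0" using True u0[of x] by (auto simp: A_def Z_def)
        have uy: "\<delta> \<le> u y" using True by (auto simp: B_def P_def)
        have "\<phi> y = 0" using True by (auto simp: B_def \<phi>_def dist_commute)
        then have \<psi>y: "\<psi> y = 0" by (simp add: \<psi>_def)
        have "R / 2 \<le> \<phi> x" using True by (auto simp: A_def \<phi>_def dist_commute max_def)
        then have \<psi>x: "\<epsilon> * (R / 2) \<le> \<psi> x" using eps by (simp add: \<psi>_def)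
        have "\<bar>\<psi> x - u y\<bar> powr p + \<psi> x * \<delta> powr (p - 1) \<le> u y powr p"
          using p \<psi>0 uy by (intro lattice_gap) auto
        moreover have "\<epsilon> * (R / 2) * \<delta> powr (p - 1) \<le> \<psi> x * \<delta> powr (p - 1)"
          using \<psi>x by (intro mult_right_mono) auto
        moreover have "w1 x = \<psi> x" "w1 y = u y" "w2 x = 0" "w2 y = 0"
          using ux uy \<psi>y \<psi>0[of x] \<delta>(1) by (auto simp: w1_def w2_def)
        then have "\<bar>w1 x - w1 y\<bar> powr p = \<bar>\<psi> x - u y\<bar> powr p" "\<bar>w2 x - w2 y\<bar> powr p = 0" by simp_all
        moreover have "\<bar>u x - u y\<bar> powr p = u y powr p" using ux uy \<delta>(1) by simp
        moreover have "\<epsilon> * (R / 2) * \<delta> powr (p - 1) * indicator (A \<times> B) z = \<epsilon> * (R / 2) * \<delta> powr (p - 1)"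
          using True by (simp add: z)
        moreover have "0 \<le> \<bar>\<psi> x - \<psi> y\<bar> powr p" by simp
        ultimately show ?thesis by linarith
      next
        case False
        then show ?thesis using sub by (auto simp: z)
      qed
      then have "(\<bar>w1 x - w1 y\<bar> powr p + \<bar>w2 x - w2 y\<bar> powr p + \<epsilon> * (R / 2) * \<delta> powr (p - 1) * indicator (A \<times> B) z) / ?n
         \<le> (\<bar>u x - u y\<bar> powr p + \<bar>\<psi> x - \<psi> y\<bar> powr p) / ?n"
        by (rule divide_right_mono) simp
      moreover have "\<epsilon> * c * indicator (A \<times> B) z \<le> (\<epsilon> * (R / 2) * \<delta> powr (p - 1) * indicator (A \<times> B) z) / ?n"
      proof (cases "x \<in> A \<and> y \<in> B")
        case True
        then have "x \<in> \<Omega>" "y \<in> \<Omega>" by (auto simp: A_def B_def Z_def P_def)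
        then have "norm (x - y) \<le> D" by (rule D)
        moreover have "x \<noteq> y" using True \<delta>(1) by (auto simp: A_def B_def Z_def P_def)
        ultimately have "1 / D powr e \<le> 1 / ?n" using e by (intro divide_left_mono powr_mono2 mult_pos_pos) auto
        then have "(\<epsilon> * (R / 2) * \<delta> powr (p - 1)) * (1 / D powr e) \<le> (\<epsilon> * (R / 2) * \<delta> powr (p - 1)) * (1 / ?n)"
          using eps R by (intro mult_left_mono) auto
        then show ?thesis using True by (simp add: z c_def)
      next
        case False
        then show ?thesis by (auto simp: z)
      qed
      ultimately show ?thesis
        by (simp add: z gagliardo_integrand_def add_divide_distrib flip: e_def)
    qed
    have "energy s p w1 + energy s p w2 + \<epsilon> * c * \<kappa>
       = (\<integral>z. gagliardo_integrand s p w1 z + gagliardo_integrand s p w2 z + \<epsilon> * c * indicator (A \<times> B) z \<partial>?L)"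
      using X_integrable_energy[OF w1X] X_integrable_energy[OF w2X] AB by (simp add: energy_def)
    also have "\<dots> \<le> (\<integral>z. gagliardo_integrand s p u z + gagliardo_integrand s p \<psi> z \<partial>?L)"
      using X_integrable_energy[OF w1X] X_integrable_energy[OF w2X] X_integrable_energy[OF u] X_integrable_energy[OF \<psi>X] AB pt
      by (intro integral_mono) auto
    also have "\<dots> = energy s p u + energy s p \<psi>"
      using X_integrable_energy[OF u] X_integrable_energy[OF \<psi>X] by (simp add: energy_def)
    finally have E: "energy s p w1 + energy s p w2 + \<epsilon> * c * \<kappa> \<le> energy s p u + energy s p \<psi>" .
    have mm: "\<bar>w1 x\<bar> powr p + \<bar>w2 x\<bar> powr p = \<bar>u x\<bar> powr p + \<bar>\<psi> x\<bar> powr p" for x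
      by (auto simp: w1_def w2_def max_def min_def)
    have M: "mass w1 + mass w2 = mass u + mass \<psi>"
      unfolding mass_def
      using X_integrable_p[OF w1X] X_integrable_p[OF w2X] X_integrable_p[OF u] X_integrable_p[OF \<psi>X]
      by (simp add: mm flip: Bochner_Integration.integral_add)
    have VV: "(\<integral>x. V x * \<bar>w1 x\<bar> powr p \<partial>lebesgue_on \<Omega>) + (\<integral>x. V x * \<bar>w2 x\<bar> powr p \<partial>lebesgue_on \<Omega>)
       = (\<integral>x. V x * \<bar>u x\<bar> powr p \<partial>lebesgue_on \<Omega>) + (\<integral>x. V x * \<bar>\<psi> x\<bar> powr p \<partial>lebesgue_on \<Omega>)"
      using potential_bound(1)[OF V w1X] potential_bound(1)[OF V w2X] potential_bound(1)[OF V u] potential_bound(1)[OF V \<psi>X]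
      by (simp add: mm flip: Bochner_Integration.integral_add distrib_left)
    have \<mu>M: "\<mu> * mass w1 + \<mu> * mass w2 = \<mu> * mass u + \<mu> * mass \<psi>"
      using M by (simp flip: distrib_left)
    have "EE w1 + EE w2 + \<epsilon> * c * \<kappa> / 2 \<le> EE u + EE \<psi>"
      using E VV \<mu>M unfolding EE_def Rayleigh_def by argo
    moreover have "0 \<le> EE w1" "0 \<le> EE w2" using ge w1X w2X by (auto simp: EE_def)
    moreover have "EE u = 0" using eq by (simp add: EE_def)
    moreover have "EE \<psi> = \<epsilon> powr p * EE \<phi>"
      using eps by (simp add: EE_def \<psi>_def scale_Rayleigh scale_mass algebra_simps)
    ultimately show ?thesis by simp
  qed
  have "((\<lambda>\<epsilon>. \<epsilon> powr (p - 1) * EE \<phi>) \<longlongrightarrow> 0 powr (p - 1) * EE \<phi>) (at_right 0)"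
    using p by (intro tendsto_intros tendsto_powr') (auto simp: eventually_at_filter)
  then have "((\<lambda>\<epsilon>. \<epsilon> powr (p - 1) * EE \<phi>) \<longlongrightarrow> 0) (at_right 0)" by simp
  moreover have "eventually (\<lambda>\<epsilon>. c * \<kappa> / 2 \<le> \<epsilon> powr (p - 1) * EE \<phi>) (at_right 0)"
    using eventually_at_right_real[OF \<delta>(1)]
  proof eventually_elim
    case (elim \<epsilon>)
    then have eps: "0 < \<epsilon>" "\<epsilon> \<le> \<delta>" by auto
    have "\<epsilon> powr p = \<epsilon> * \<epsilon> powr (p - 1)" using eps powr_add[of \<epsilon> 1 "p - 1"] by simp
    then have "\<epsilon> * (c * \<kappa> / 2) \<le> \<epsilon> * (\<epsilon> powr (p - 1) * EE \<phi>)" using key[OF eps] by (simp add: mult.assoc)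
    then show ?case using eps by simp
  qed
  ultimately have "c * \<kappa> / 2 \<le> 0" by (rule tendsto_lowerbound) simp
  then show False using c \<kappa> by (simp add: mult_le_0_iff)
qed

end

section \<open>Minimizing the first eigenvalue\<close>

theorem theorem5p4:
  fixes \<Omega> :: "'a::euclidean_space set" and s p q :: real
  assumes "0 < s" and "s < 1" and "1 < p"
    and "bounded \<Omega>" and "\<Omega> \<noteq> {}" and "extension_domain s p \<Omega>"
    and "1 < q" and "real DIM('a) / (s * p) < q"
  shows "\<exists>V\<^sub>0 \<in> Lq_unit_sphere q \<Omega>.
      (\<forall>V \<in> Lq_unit_ball q \<Omega>. first_eigenvalue s p \<Omega> V\<^sub>0 \<le> first_eigenvalue s p \<Omega> V) \<and>
      (AE x in lebesgue_on \<Omega>. V\<^sub>0 x \<le> 0) \<and>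
      Lp_norm q \<Omega> V\<^sub>0 = 1 \<and>
      (\<exists>u. positive_normalized_eigenfunction s p \<Omega> V\<^sub>0 u) \<and>
      (\<forall>u. positive_normalized_eigenfunction s p \<Omega> V\<^sub>0 u \<longrightarrow>
         (\<forall>W \<in> tangent_space q \<Omega> V\<^sub>0. (\<integral>x. W x * \<bar>u x\<bar> powr p \<partial>lebesgue_on \<Omega>) = 0))"
proof -
  have "open \<Omega>" using assms(6) by (simp add: extension_domain_def)
  then interpret fractional_potential \<Omega> s p q
    using assms by unfold_locales auto
  obtain u where u: "u \<in> W_tilde s p \<Omega>" "mass u = 1" "\<And>x. 0 \<le> u x"
    and u_min: "\<And>v. v \<in> W_tilde s p \<Omega> \<Longrightarrow> mass v = 1 \<Longrightarrow> reduced_functional u \<le> reduced_functional v"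
    by (rule reduced_minimizer) auto
  define m where "m = reduced_functional u"
  define V0 where "V0 = optimal_potential u"
  have V0: "V0 \<in> Lq_unit_sphere q \<Omega>" and V0u: "Rayleigh V0 u = m"
    using optimal_potential_properties[OF u(1)] u(2) by (simp_all add: V0_def m_def)
  have V0_ball: "V0 \<in> Lq_unit_ball q \<Omega>" by (rule Lq_unit_sphere_subset_ball[OF V0])
  have V0_Lp: "V0 \<in> Lp_space q \<Omega>" using V0 by (simp add: Lq_unit_sphere_def)
  have m_le: "m \<le> Rayleigh V v" if "V \<in> Lq_unit_ball q \<Omega>" "v \<in> W_tilde s p \<Omega>" "mass v = 1" for V v
    unfolding m_def using u_min[OF that(2,3)] Rayleigh_ge_reduced[OF that(1,2)] by (rule order_trans)
  have m_le_eig: "m \<le> first_eigenvalue s p \<Omega> V" if "V \<in> Lq_unit_ball q \<Omega>" for V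
    unfolding first_eigenvalue_eq using exists_normalized m_le[OF that] by (intro cINF_greatest) auto
  have eig: "first_eigenvalue s p \<Omega> V0 = m"
  proof (rule antisym[OF _ m_le_eig[OF V0_ball]])
    have "bdd_below (Rayleigh V0 ` {u \<in> W_tilde s p \<Omega>. mass u = 1})"
      using m_le[OF V0_ball] by (intro bdd_belowI2[of _ m]) auto
    from cINF_lower[OF this, of u] show "first_eigenvalue s p \<Omega> V0 \<le> m"
      unfolding first_eigenvalue_eq using u V0u by simp
  qed
  have homog: "m * mass w \<le> Rayleigh V0 w" if "w \<in> W_tilde s p \<Omega>" for w
    using m_le[OF V0_ball] by (intro Rayleigh_homogeneous_bound[OF V0_Lp _ that])
  have V0u': "Rayleigh V0 u = m * mass u" using V0u u(2) by simp
  have norm_iff: "Lp_norm p UNIV w = 1 \<longleftrightarrow> mass w = 1" for w :: "'a \<Rightarrow> real"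
    using p by (simp add: Lp_norm_eq_1_iff lebesgue_on_UNIV_eq mass_def)
  have "positive_normalized_eigenfunction s p \<Omega> V0 u"
    unfolding positive_normalized_eigenfunction_def eigenfunction_def eig norm_iff
  proof (intro conjI ballI)
    show "\<not> (AE x in lebesgue. u x = 0)" using mass_zero_iff[OF u(1)] u(2) by simp
    show "AE x in lebesgue_on \<Omega>. 0 < u x"
      by (rule minimizer_positive[OF V0_Lp homog u(1) V0u' u(3)]) (use u(2) in auto)
  qed (use u Euler_Lagrange[OF V0_Lp homog u(1) V0u'] in auto)
  moreover have "(\<integral>x. W x * \<bar>v x\<bar> powr p \<partial>lebesgue_on \<Omega>) = 0"
    if v: "positive_normalized_eigenfunction s p \<Omega> V0 v" and W: "W \<in> tangent_space q \<Omega> V0" for v W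
  proof (rule tangent_orthogonality[OF V0 W])
    have v': "eigenfunction s p \<Omega> V0 m v" "mass v = 1"
      using v by (auto simp: positive_normalized_eigenfunction_def eig norm_iff)
    then show vX: "v \<in> W_tilde s p \<Omega>" by (simp add: eigenfunction_def)
    show "Rayleigh V0 v \<le> Rayleigh Z v" if "Z \<in> Lq_unit_ball q \<Omega>" for Z
      using m_le[OF that vX v'(2)] eigenfunction_Rayleigh[OF v'(1)] v'(2) by simp
  qed
  moreover have "AE x in lebesgue_on \<Omega>. V0 x \<le> 0"
    by (rule AE_I2) (simp add: V0_def optimal_potential_def)
  moreover have "Lp_norm q \<Omega> V0 = 1" using V0 by (simp add: Lq_unit_sphere_def)
  ultimately show ?thesis
    using V0 m_le_eig by (intro bexI[of _ V0]) (auto simp: eig)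
qed

end
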